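(* Let $X$ be a compact metric space and $T:X\to X$ continuous and expansive. Then: (i) The pressure $P:C(X)\to\mathbb{R}$ is Gâteaux differentiable at $\phi\in C(X)$ if and only if $\phi$ has a unique equilibrium state. (ii) When $P$ is differentiable at $\phi$, the Gâteaux derivative is $DP(\phi)(\psi)=\int\psi\,d\mu_\phi$ for all $\psi\in C(X)$, where $\mu_\phi$ is the unique equilibrium state. (iii) The set of potentials $\phi\in C(X)$ with a unique equilibrium state is a dense $G_\delta$ subset of $C(X)$. (iv) If moreover $(X,T)$ has the specification property and $\phi\in C^\alpha(X)$ has a unique equilibrium state with exponential decay of correlations, then $P:C^\alpha(X)\to\mathbb{R}$ is Fréchet differentiable at $\phi$ in the $\|\cdot\|_\alpha$ norm.
   Context: $C(X)$ carries the supremum norm; $C^\alpha(X)$ is the Banach space of $\alpha$-Hölder real functions with the Hölder norm $\|\cdot\|_\alpha$ (sup norm plus Hölder seminorm). $\mathcal{M}_T(X)$ is the set of $T$-invariant Borel probability measures; $h_\mu(T)$ is the measure-theoretic entropy. Let $d_n(x,y)=\max_{0\le k<n}d(T^kx,T^ky)$; $E\subset X$ is $(n,\epsilon)$-separated if $d_n(x,y)>\epsilon$ for distinct $x,y\in E$. With $S_n\phi=\sum_{k=0}^{n-1}\phi\circ T^k$ and $Q_n(\phi,\epsilon)=\sup\{\sum_{x\in E}e^{S_n\phi(x)}: E\ (n,\epsilon)\text{-separated}\}$, the topological pressure is $P(\phi)=\lim_{\epsilon\to0}\limsup_{n\to\infty}\frac1n\log Q_n(\phi,\epsilon)$. An equilibrium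 state for $\phi$ is $\mu\in\mathcal{M}_T(X)$ with $h_\mu(T)+\int\phi\,d\mu=P(\phi)$. Expansive has its standard meaning (existence of an expansiveness constant $\delta>0$). Specification property: for every $\epsilon>0$ there is $M(\epsilon)\in\mathbb{N}$ such that any finite collection of orbit segments can be $\epsilon$-shadowed by a single periodic orbit with gaps of length at most $M(\epsilon)$. Exponential decay of correlations for $\mu$: there are $C>0$, $\gamma\in(0,1)$ with $|\mathrm{Cov}_\mu(f,g\circ T^n)|\le C\gamma^n\|f\|_\alpha\|g\|_\alpha$ for all $f,g\in C^\alpha(X)$, $n\ge0$. *)

theory Defs
  imports "HOL-Probability.Probability"
begin

section \<open>Topological dynamics\<close>

text \<open>
  The compact metric space is a whole type \<open>'a :: metric_space\<close> with \<open>compact (UNIV :: 'a set)\<close>;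
  then \<open>'a \<Rightarrow>\<^sub>C real\<close> is the space of all continuous real functions with the supremum norm.
\<close>

text \<open>
  The usual convention: points are separated along forward orbits, or, when the map is
  invertible (hence a homeomorphism, by compactness), along two-sided orbits.
\<close>

definition expansive :: "('a::metric_space \<Rightarrow> 'a) \<Rightarrow> bool" where
  "expansive T \<longleftrightarrow> (\<exists>\<delta>>0.
     (\<forall>x y. (\<forall>n. dist ((T ^^ n) x) ((T ^^ n) y) \<le> \<delta>) \<longrightarrow> x = y) \<or>
     bij T \<and>
     (\<forall>x y. (\<forall>n. dist ((T ^^ n) x) ((T ^^ n) y) \<le> \<delta> \<and>
                 dist ((inv T ^^ n) x) ((inv T ^^ n) y) \<le> \<delta>) \<longrightarrow> x = y))"

text \<open>
  The \<open>i\<close>-th orbit segment is \<open>x i, T (x i), \<dots>\<close> of length \<open>len i\<close>; it is followed by a gap of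
  length \<open>gap i\<close>. The last gap closes up the periodic orbit, whose period is the total length.
\<close>

definition specification_property :: "('a::metric_space \<Rightarrow> 'a) \<Rightarrow> bool" where
  "specification_property T \<longleftrightarrow> (\<forall>\<epsilon>>0. \<exists>M::nat. \<forall>(k::nat) (x :: nat \<Rightarrow> 'a) (len :: nat \<Rightarrow> nat).
     k > 0 \<and> (\<forall>i<k. len i > 0) \<longrightarrow>
     (\<exists>z (gap :: nat \<Rightarrow> nat).
        (\<forall>i<k. gap i \<le> M) \<and>
        (T ^^ (\<Sum>i<k. len i + gap i)) z = z \<and>
        (\<forall>i<k. \<forall>j<len i.
           dist ((T ^^ ((\<Sum>l<i. len l + gap l) + j)) z) ((T ^^ j) (x i)) \<le> \<epsilon>)))"


section \<open>Topological pressure\<close>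

text \<open>
  The value at \<open>n = 0\<close> is irrelevant, as the pressure is a limit superior in \<open>n\<close>.
\<close>

definition bowen_dist :: "('a::metric_space \<Rightarrow> 'a) \<Rightarrow> nat \<Rightarrow> 'a \<Rightarrow> 'a \<Rightarrow> real" where
  "bowen_dist T n x y = (MAX k\<in>{..<n}. dist ((T ^^ k) x) ((T ^^ k) y))"

definition separated :: "('a::metric_space \<Rightarrow> 'a) \<Rightarrow> nat \<Rightarrow> real \<Rightarrow> 'a set \<Rightarrow> bool" where
  "separated T n \<epsilon> E \<longleftrightarrow> (\<forall>x\<in>E. \<forall>y\<in>E. x \<noteq> y \<longrightarrow> bowen_dist T n x y > \<epsilon>)"

definition birkhoff_sum :: "('a \<Rightarrow> 'a) \<Rightarrow> nat \<Rightarrow> ('a \<Rightarrow> real) \<Rightarrow> 'a \<Rightarrow> real" where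
  "birkhoff_sum T n \<phi> x = (\<Sum>k<n. \<phi> ((T ^^ k) x))"

text \<open>
  On a compact space with \<open>T\<close> and \<open>\<phi>\<close> continuous, separated sets for \<open>n > 0\<close> and \<open>\<epsilon> > 0\<close> are
  finite, of uniformly bounded cardinality, so that both the sums and the supremum are genuine.
\<close>

definition separated_sum :: "('a::metric_space \<Rightarrow> 'a) \<Rightarrow> ('a \<Rightarrow> real) \<Rightarrow> nat \<Rightarrow> real \<Rightarrow> real" where
  "separated_sum T \<phi> n \<epsilon> = (SUP E\<in>{E. separated T n \<epsilon> E}. \<Sum>x\<in>E. exp (birkhoff_sum T n \<phi> x))"

definition pressure :: "('a::metric_space \<Rightarrow> 'a) \<Rightarrow> ('a \<Rightarrow> real) \<Rightarrow> ereal" where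
  "pressure T \<phi> =
     Lim (at_right 0) (\<lambda>\<epsilon>. limsup (\<lambda>n. ereal (1 / real n * ln (separated_sum T \<phi> n \<epsilon>))))"

definition real_pressure :: "('a::metric_space \<Rightarrow> 'a) \<Rightarrow> ('a \<Rightarrow>\<^sub>C real) \<Rightarrow> real" where
  "real_pressure T \<phi> = real_of_ereal (pressure T (apply_bcontfun \<phi>))"


section \<open>Invariant measures, entropy and equilibrium states\<close>

definition invariant_measures :: "('a::topological_space \<Rightarrow> 'a) \<Rightarrow> 'a measure set" where
  "invariant_measures T = {\<mu>. prob_space \<mu> \<and> sets \<mu> = sets borel \<and> distr \<mu> borel T = \<mu>}"

definition finite_measurable_partition :: "'a measure \<Rightarrow> 'a set set \<Rightarrow> bool" where
  "finite_measurable_partition \<mu> \<P> \<longleftrightarrow> finite \<P> \<and> \<P> \<subseteq> sets \<mu> \<and> partition_on (space \<mu>) \<P>"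

definition partition_entropy :: "'a measure \<Rightarrow> 'a set set \<Rightarrow> real" where
  "partition_entropy \<mu> \<P> = - (\<Sum>A\<in>\<P>. measure \<mu> A * ln (measure \<mu> A))"

text \<open>The join of the partitions \<open>(T ^^ k) -` \<P>\<close> for \<open>k < n\<close>.\<close>

definition dynamical_join :: "('a \<Rightarrow> 'a) \<Rightarrow> 'a set set \<Rightarrow> nat \<Rightarrow> 'a set set" where
  "dynamical_join T \<P> n = {\<Inter>k<n. (T ^^ k) -` A k | A. \<forall>k<n. A k \<in> \<P>} - {{}}"

definition entropy_wrt_partition :: "('a \<Rightarrow> 'a) \<Rightarrow> 'a measure \<Rightarrow> 'a set set \<Rightarrow> real" where
  "entropy_wrt_partition T \<mu> \<P> =
     lim (\<lambda>n. 1 / real n * partition_entropy \<mu> (dynamical_join T \<P> n))"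

definition measure_entropy :: "('a \<Rightarrow> 'a) \<Rightarrow> 'a measure \<Rightarrow> ereal" where
  "measure_entropy T \<mu> =
     (SUP \<P>\<in>{\<P>. finite_measurable_partition \<mu> \<P>}. ereal (entropy_wrt_partition T \<mu> \<P>))"

definition equilibrium_states :: "('a::metric_space \<Rightarrow> 'a) \<Rightarrow> ('a \<Rightarrow> real) \<Rightarrow> 'a measure set" where
  "equilibrium_states T \<phi> =
     {\<mu> \<in> invariant_measures T. measure_entropy T \<mu> + ereal (\<integral>x. \<phi> x \<partial>\<mu>) = pressure T \<phi>}"


section \<open>Hoelder functions and decay of correlations\<close>

definition hoelder_space :: "real \<Rightarrow> ('a::metric_space \<Rightarrow>\<^sub>C real) set" where
  "hoelder_space \<alpha> = {f :: 'a \<Rightarrow>\<^sub>C real. \<exists>K. \<forall>x y. \<bar>f x - f y\<bar> \<le> K * dist x y powr \<alpha>}"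

text \<open>Pairs with \<open>x = y\<close> contribute \<open>0 / 0 = 0\<close> to the supremum.\<close>

definition hoelder_seminorm :: "real \<Rightarrow> ('a::metric_space \<Rightarrow>\<^sub>C real) \<Rightarrow> real" where
  "hoelder_seminorm \<alpha> f = (SUP (x, y)\<in>UNIV. \<bar>f x - f y\<bar> / dist x y powr \<alpha>)"

definition hoelder_norm :: "real \<Rightarrow> ('a::metric_space \<Rightarrow>\<^sub>C real) \<Rightarrow> real" where
  "hoelder_norm \<alpha> f = norm f + hoelder_seminorm \<alpha> f"

definition covariance :: "'a measure \<Rightarrow> ('a \<Rightarrow> real) \<Rightarrow> ('a \<Rightarrow> real) \<Rightarrow> real" where
  "covariance \<mu> f g = (\<integral>x. f x * g x \<partial>\<mu>) - (\<integral>x. f x \<partial>\<mu>) * (\<integral>x. g x \<partial>\<mu>)"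

definition exponential_decay_of_correlations ::
    "('a::metric_space \<Rightarrow> 'a) \<Rightarrow> real \<Rightarrow> 'a measure \<Rightarrow> bool" where
  "exponential_decay_of_correlations T \<alpha> \<mu> \<longleftrightarrow> (\<exists>C>0. \<exists>\<gamma>\<in>{0<..<1}.
     \<forall>f\<in>hoelder_space \<alpha>. \<forall>g\<in>hoelder_space \<alpha>. \<forall>n.
       \<bar>covariance \<mu> (apply_bcontfun f) (\<lambda>x. apply_bcontfun g ((T ^^ n) x))\<bar>
         \<le> C * \<gamma> ^ n * hoelder_norm \<alpha> f * hoelder_norm \<alpha> g)"


section \<open>Differentiability\<close>

definition has_gateaux_derivative ::
    "('b::real_normed_vector \<Rightarrow> 'c::real_normed_vector) \<Rightarrow> ('b \<Rightarrow> 'c) \<Rightarrow> 'b \<Rightarrow> bool" where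
  "has_gateaux_derivative F D x \<longleftrightarrow>
     bounded_linear D \<and> (\<forall>v. ((\<lambda>t. F (x + t *\<^sub>R v)) has_vector_derivative D v) (at 0))"

definition gateaux_differentiable ::
    "('b::real_normed_vector \<Rightarrow> 'c::real_normed_vector) \<Rightarrow> 'b \<Rightarrow> bool" where
  "gateaux_differentiable F x \<longleftrightarrow> (\<exists>D. has_gateaux_derivative F D x)"

text \<open>
  Frechet differentiability at \<open>x \<in> V\<close> of the restriction of \<open>F\<close> to a linear subspace \<open>V\<close>
  carrying its own norm \<open>N\<close>. The derivative \<open>D\<close> matters only on \<open>V\<close>. The library's
  \<open>has_derivative\<close> is tied to the norm of the ambient type.
\<close>

definition frechet_differentiable_wrt ::
    "'b::real_vector set \<Rightarrow> ('b \<Rightarrow> real) \<Rightarrow> ('b \<Rightarrow> 'c::real_normed_vector) \<Rightarrow> 'b \<Rightarrow> bool" where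
  "frechet_differentiable_wrt V N F x \<longleftrightarrow> (\<exists>D.
     (\<forall>u\<in>V. \<forall>v\<in>V. D (u + v) = D u + D v) \<and>
     (\<forall>c. \<forall>v\<in>V. D (c *\<^sub>R v) = c *\<^sub>R D v) \<and>
     (\<exists>K. \<forall>v\<in>V. norm (D v) \<le> K * N v) \<and>
     (\<forall>\<epsilon>>0. \<exists>\<delta>>0. \<forall>h\<in>V. N h < \<delta> \<longrightarrow> norm (F (x + h) - F x - D h) \<le> \<epsilon> * N h))"

end

theory Submission
  imports Defs
begin

text \<open>
  For an expansive map the pressure is already attained at one fixed scale \<open>\<delta>\<close>. Misiurewicz's
  construction at that scale therefore produces equilibrium states without upper semicontinuity of
  the entropy: a weak limit of weighted empirical measures on \<open>(n, \<delta>)\<close>-separated sets is an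
  equilibrium state. Running it with the potentials \<open>\<phi> + t \<psi>\<close> for \<open>t\<close> decreasing to \<open>0\<close> yields an
  equilibrium state \<open>\<mu>\<close> of \<open>\<phi>\<close> whose integral \<open>\<integral>\<psi> d\<mu>\<close> is at least the right derivative
  of \<open>t \<mapsto> P(\<phi> + t \<psi>)\<close> at \<open>0\<close>, while every equilibrium state gives a lower bound
  \<open>P(\<phi> + \<psi>) \<ge> P(\<phi>) + \<integral>\<psi> d\<mu>\<close> by the variational inequality. Hence uniqueness is equivalent to
  Gateaux differentiability. Differentiability in the directions of a countable dense set is a
  countable intersection of open dense sets, and Baire's theorem applies. In the Hoelder norm the
  unit ball is totally bounded in \<open>C(X)\<close>, so the Lipschitz function \<open>P\<close> is even Frechet
  differentiable where it is Gateaux differentiable.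
\<close>

section \<open>Entropy of finite-valued maps and itineraries\<close>

text \<open>Why one scale suffices: an \<open>(n, e)\<close>-separated set is pulled back along
  \<open>T ^^ m\<close> and its orbits are lengthened by a fixed \<open>m + N\<close>, which makes
  it separated at scale \<delta> and changes the sums by a bounded factor only; division by n
  removes it. The partition that bounds the entropy from below needs boundaries of \<mu>-measure
  zero, so it can be chosen only after the limit \<mu> is known. The approximating measures are
  therefore built without reference to any partition. The bound on the derivative comes from Gibbs'
  inequality: weights adapted to \<open>\<phi> + t \<psi>\<close>, tested against
  \<open>\<phi>\<close>, bound the increment of the pressure by t times the integral of \<psi> plus
  an error of order \<open>t^2\<close>. This is why sets optimal up to \<open>t^2\<close> are used.
  In the variational inequality each point is replaced by a close point of a maximal separated set.
  The cell forgotten in this way is recovered from a labelling of small entropy, which marks only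
  the points outside closed cores of the cells; no passage to powers of T is made. Convexity of P is
  read off from the equilibrium states as supporting functionals.\<close>

text \<open>This is the entropy of the partition into fibres of \<open>f\<close>. With labellings in
  place of partitions, joins become pairs and refinement becomes factorization of maps. Null fibres
  contribute 0.\<close>

definition ent :: "'a measure \<Rightarrow> ('a \<Rightarrow> 'b) \<Rightarrow> real" where
  "ent M f = - (\<Sum>b\<in>f ` space M. measure M (f -` {b} \<inter> space M) * ln (measure M (f -` {b} \<inter> space M)))"

lemma ent_eq_sum:
  assumes "finite B" "f ` space M \<subseteq> B"
  shows "ent M f = - (\<Sum>b\<in>B. measure M (f -` {b} \<inter> space M) * ln (measure M (f -` {b} \<inter> space M)))"
proof -
  have "f -` {b} \<inter> space M = {}" if "b \<in> B - f ` space M" for b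
    using that by auto
  then show ?thesis
    unfolding ent_def using assms by (subst sum.mono_neutral_left[of B "f ` space M"]) auto
qed

lemma information_space_exp: "prob_space M \<Longrightarrow> information_space M (exp 1)"
  by (simp add: information_space_def information_space_axioms_def)

text \<open>Bridge to the library's information theory, in base \<open>exp 1\<close> so that its
  logarithm is \<open>ln\<close>. Data processing, the chain rule and the bound by the uniform
  distribution are imported through it.\<close>

lemma entropy_eq_ent:
  assumes "prob_space M" "simple_function M f"
  shows "prob_space.entropy M (exp 1) (count_space (f ` space M)) f = ent M f"
proof -
  interpret information_space M "exp 1" by (rule information_space_exp) fact
  have "simple_distributed M f (\<lambda>b. measure M (f -` {b} \<inter> space M))"
    by (rule simple_distributedI[OF assms(2)]) auto
  from entropy_simple_distributed[OF this] show ?thesis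
    unfolding ent_def log_ln ln_exp by (simp add: log_def)
qed

lemma ent_comp_le:
  assumes "prob_space M" "simple_function M f"
  shows "ent M (\<lambda>x. u (f x)) \<le> ent M f"
proof -
  interpret information_space M "exp 1" by (rule information_space_exp) fact
  have "simple_function M (u \<circ> f)" using assms by (intro simple_function_compose) auto
  then show ?thesis
    using entropy_data_processing[OF assms(2), of u] assms
    by (simp add: entropy_eq_ent[symmetric] comp_def)
qed

lemma ent_pair_le:
  assumes "prob_space M" "simple_function M f" "simple_function M g"
  shows "ent M (\<lambda>x. (f x, g x)) \<le> ent M f + ent M g"
proof -
  interpret information_space M "exp 1" by (rule information_space_exp) fact
  have "simple_function M (\<lambda>x. (f x, g x))" using assms by (intro simple_function_Pair) auto
  then show ?thesis
    using entropy_chain_rule[OF assms(2,3)] conditional_entropy_less_eq_entropy[OF assms(3,2)] assms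
    by (simp add: entropy_eq_ent[symmetric])
qed

lemma ent_le_ln_card:
  assumes "prob_space M" "simple_function M f"
  shows "ent M f \<le> ln (card (f ` space M))"
proof -
  interpret information_space M "exp 1" by (rule information_space_exp) fact
  have "simple_distributed M f (\<lambda>b. measure M (f -` {b} \<inter> space M))"
    by (rule simple_distributedI[OF assms(2)]) auto
  from entropy_le_card[OF this] show ?thesis
    using assms by (simp add: entropy_eq_ent[symmetric] log_def)
qed

lemma ent_nonneg:
  assumes "prob_space M"
  shows "0 \<le> ent M f"
proof -
  interpret prob_space M by fact
  have "prob A * ln (prob A) \<le> 0" for A
    using prob_le_1[of A] by (cases "prob A = 0") (auto intro!: mult_nonneg_nonpos simp: less_le)
  then show ?thesis unfolding ent_def by (simp add: sum_nonpos)
qed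

text \<open>Labels that only one of the two maps attains have a fibre of measure 0, so the ranges
  may differ.\<close>

lemma ent_transport:
  assumes "\<And>b. measure M (f -` {b} \<inter> space M) = measure N (g -` {b} \<inter> space N)"
    and "finite (f ` space M)" "finite (g ` space N)"
  shows "ent M f = ent N g"
  using ent_eq_sum[of "f ` space M \<union> g ` space N" f M] ent_eq_sum[of "f ` space M \<union> g ` space N" g N] assms
  by simp

text \<open>Division with remainder by a nearly optimal \<open>m\<close>. The second output, a bound
  by every single quotient, later allows the variational inequality to work at one fixed length
  \<open>n\<close>.\<close>

lemma fekete:
  fixes a :: "nat \<Rightarrow> real"
  assumes nonneg: "\<And>n. 0 \<le> a n" and sub: "\<And>m n. a (m + n) \<le> a m + a n"
  obtains L where "(\<lambda>n. a n / real n) \<longlonglongrightarrow> L" "\<And>n. n > 0 \<Longrightarrow> L \<le> a n / real n"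
proof -
  define L where "L = (INF n\<in>{0<..}. a n / real n)"
  have bdd: "bdd_below ((\<lambda>n. a n / real n) ` {0<..})"
    using nonneg by (auto intro!: bdd_belowI2[where m=0])
  have L: "L \<le> a n / real n" if "n > 0" for n
    unfolding L_def using that bdd by (intro cINF_lower) auto
  have mult: "a (q * m + r) \<le> real q * a m + a r" for q m r
  proof (induction q)
    case (Suc q)
    have "a (Suc q * m + r) \<le> a m + a (q * m + r)"
      using sub[of m "q * m + r"] by (simp add: algebra_simps)
    with Suc show ?case by (simp add: algebra_simps)
  qed simp
  have "(\<lambda>n. a n / real n) \<longlonglongrightarrow> L"
  proof (rule LIMSEQ_I)
    fix e :: real assume "e > 0"
    then have "\<exists>m\<in>{0<..}. a m / real m < L + e / 2"
      unfolding L_def using bdd by (intro cINF_less_iff[THEN iffD1]) auto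
    then obtain m where m: "m > 0" "a m / real m < L + e / 2" by auto
    \<comment> \<open>Bounds \<open>a r\<close> for all remainders \<open>r < m\<close> at once, so
      the remainder vanishes on division by \<open>n\<close>.\<close>
    define C where "C = (\<Sum>r<m. a r)"
    obtain N :: nat where N: "2 * C / e < real N" using reals_Archimedean2 by blast
    show "\<exists>no. \<forall>n\<ge>no. norm (a n / real n - L) < e"
    proof (intro exI[of _ "Suc N"] allI impI)
      fix n assume n: "Suc N \<le> n"
      have "a n = a ((n div m) * m + n mod m)" by simp
      also have "\<dots> \<le> real (n div m) * a m + a (n mod m)" by (rule mult)
      also have "a (n mod m) \<le> C"
        unfolding C_def using m nonneg by (intro member_le_sum) auto
      also have "real (n div m) * a m \<le> real n / real m * a m"
        using nonneg[of m] m by (intro mult_right_mono) (simp_all add: le_divide_eq div_times_less_eq_dividend flip: of_nat_mult)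
      finally have "a n \<le> real n * (a m / real m) + C" by simp
      then have "a n / real n \<le> a m / real m + C / real n"
        using n by (simp add: field_simps)
      moreover have "C / real n < e / 2"
      proof -
        have "2 * C / e < real n" using N n by linarith
        then show ?thesis using \<open>e > 0\<close> n by (simp add: field_simps)
      qed
      ultimately have "a n / real n < L + e" using m by linarith
      moreover have "L \<le> a n / real n" using n by (intro L) auto
      ultimately show "norm (a n / real n - L) < e" using \<open>e > 0\<close> by simp
    qed
  qed
  with L show thesis using that by blast
qed

section \<open>Itineraries and the atoms of dynamical joins\<close>

definition itinerary :: "('a \<Rightarrow> 'a) \<Rightarrow> ('a \<Rightarrow> 'b) \<Rightarrow> nat \<Rightarrow> 'a \<Rightarrow> 'b list" where
  "itinerary T g n x = map (\<lambda>k. g ((T ^^ k) x)) [0..<n]"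

lemma length_itinerary [simp]: "length (itinerary T g n x) = n"
  by (simp add: itinerary_def)

lemma nth_itinerary [simp]: "k < n \<Longrightarrow> itinerary T g n x ! k = g ((T ^^ k) x)"
  by (simp add: itinerary_def)

lemma itinerary_add:
  "itinerary T g (m + n) x = itinerary T g m x @ itinerary T g n ((T ^^ m) x)"
  by (rule nth_equalityI) (auto simp: nth_append funpow_add[symmetric, THEN fun_cong, unfolded comp_def] add.commute)

lemma itinerary_vimage: "itinerary T g n -` {b} = (if length b = n then (\<Inter>k<n. (T ^^ k) -` (g -` {b ! k})) else {})"
  by (auto simp: list_eq_iff_nth_eq)

lemma finite_range_itinerary:
  assumes "finite (range g)"
  shows "finite (range (itinerary T g n))"
proof (rule finite_subset)
  show "range (itinerary T g n) \<subseteq> {xs. set xs \<subseteq> range g \<and> length xs = n}"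
    by (auto simp: itinerary_def)
  show "finite {xs. set xs \<subseteq> range g \<and> length xs = n}"
    using assms by (rule finite_lists_length_eq)
qed

lemma card_range_itinerary_le:
  assumes "finite (range g)"
  shows "card (range (itinerary T g n)) \<le> card (range g) ^ n"
proof -
  have "range (itinerary T g n) \<subseteq> {xs. set xs \<subseteq> range g \<and> length xs = n}"
    by (auto simp: itinerary_def)
  from card_mono[OF finite_lists_length_eq[OF assms] this] show ?thesis
    by (simp add: card_lists_length_eq[OF assms])
qed

definition cell :: "'a set set \<Rightarrow> 'a \<Rightarrow> 'a set" where
  "cell \<P> x = (THE A. A \<in> \<P> \<and> x \<in> A)"

lemma cell_eqI:
  assumes "partition_on UNIV \<P>" "A \<in> \<P>" "x \<in> A"
  shows "cell \<P> x = A"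
  unfolding cell_def using assms partition_onD2[OF assms(1)]
  by (intro the_equality) (auto simp: disjoint_def)

lemma cell_mem:
  assumes "partition_on UNIV \<P>"
  shows "cell \<P> x \<in> \<P>" "x \<in> cell \<P> x"
proof -
  obtain A where "A \<in> \<P>" "x \<in> A" using partition_onD1[OF assms] by auto
  with cell_eqI[OF assms this] show "cell \<P> x \<in> \<P>" "x \<in> cell \<P> x" by auto
qed

lemma range_cell:
  assumes "partition_on UNIV \<P>"
  shows "range (cell \<P>) = \<P>"
proof -
  have "A \<in> range (cell \<P>)" if "A \<in> \<P>" for A
  proof -
    have "A \<noteq> {}" using partition_onD3[OF assms] that by metis
    then obtain x where "x \<in> A" by blast
    then show ?thesis using cell_eqI[OF assms that] by auto
  qed
  then show ?thesis using cell_mem[OF assms] by auto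
qed

lemma cell_vimage:
  assumes "partition_on UNIV \<P>" "A \<in> \<P>"
  shows "cell \<P> -` {A} = A"
  using cell_mem[OF assms(1)] cell_eqI[OF assms] by auto

text \<open>An atom containing \<open>x\<close> is the fibre through the itinerary of
  \<open>x\<close>. The empty set is missing on both sides: it is removed in the definition of the
  join, and on the right only attained itineraries occur.\<close>

lemma dynamical_join_eq:
  assumes "partition_on UNIV \<P>"
  shows "dynamical_join T \<P> n =
    (\<lambda>b. itinerary T (cell \<P>) n -` {b}) ` range (itinerary T (cell \<P>) n)"
proof (intro set_eqI iffI)
  fix B assume "B \<in> dynamical_join T \<P> n"
  then obtain A x where A: "B = (\<Inter>k<n. (T ^^ k) -` A k)" "\<forall>k<n. A k \<in> \<P>" "x \<in> B"
    unfolding dynamical_join_def by blast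
  have "(T ^^ k) -` A k = (T ^^ k) -` (cell \<P> -` {cell \<P> ((T ^^ k) x)})" if "k < n" for k
  proof -
    have "A k \<in> \<P>" "(T ^^ k) x \<in> A k" using A that by auto
    then show ?thesis using cell_eqI[OF assms] cell_vimage[OF assms] by metis
  qed
  then have "B = itinerary T (cell \<P>) n -` {itinerary T (cell \<P>) n x}"
    unfolding A(1) itinerary_vimage by auto
  then show "B \<in> (\<lambda>b. itinerary T (cell \<P>) n -` {b}) ` range (itinerary T (cell \<P>) n)" by auto
next
  fix B assume "B \<in> (\<lambda>b. itinerary T (cell \<P>) n -` {b}) ` range (itinerary T (cell \<P>) n)"
  then obtain x where B: "B = itinerary T (cell \<P>) n -` {itinerary T (cell \<P>) n x}" by auto
  have "B = (\<Inter>k<n. (T ^^ k) -` (cell \<P> ((T ^^ k) x)))"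
    unfolding B itinerary_vimage using cell_vimage[OF assms cell_mem(1)[OF assms]] by auto
  moreover have "x \<in> B" using B by auto
  ultimately show "B \<in> dynamical_join T \<P> n"
    unfolding dynamical_join_def using cell_mem(1)[OF assms]
    by (intro DiffI CollectI exI[of _ "\<lambda>k. cell \<P> ((T ^^ k) x)"] conjI) blast+
qed

text \<open>Attained itineraries have nonempty, hence distinct, fibres, so the sum over atoms can be
  reindexed by labels. From here on entropy is computed with \<open>ent\<close> only.\<close>

lemma partition_entropy_dynamical_join:
  assumes "partition_on UNIV \<P>" "space \<mu> = UNIV"
  shows "partition_entropy \<mu> (dynamical_join T \<P> n) = ent \<mu> (itinerary T (cell \<P>) n)"
proof -
  have "inj_on (\<lambda>b. itinerary T (cell \<P>) n -` {b}) (range (itinerary T (cell \<P>) n))"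
    by (rule inj_onI) blast
  then show ?thesis
    unfolding partition_entropy_def dynamical_join_eq[OF assms(1)] ent_def
    by (subst sum.reindex) (auto simp: assms)
qed

section \<open>Borel probability measures on metric spaces\<close>

text \<open>These cutoffs are the continuous test functions for closed sets. Nonemptiness matters
  because \<open>infdist x {}\<close> is 0, which would make the cutoffs constantly 1.\<close>

lemma tendsto_approx_infdist_indicator:
  fixes F :: "'a::metric_space set"
  assumes "closed F" "F \<noteq> {}"
  shows "(\<lambda>j. max 0 (1 - real j * infdist x F)) \<longlonglongrightarrow> indicator F x"
proof (cases "x \<in> F")
  case True
  then show ?thesis by simp
next
  case False
  then have pos: "infdist x F > 0"
    using assms in_closed_iff_infdist_zero[OF assms] infdist_nonneg[of x F] by (metis less_le)
  obtain N :: nat where N: "1 / infdist x F < real N" using reals_Archimedean2 by blast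
  have "\<forall>\<^sub>F j in sequentially. max 0 (1 - real j * infdist x F) = 0"
    using eventually_ge_at_top[of N]
  proof eventually_elim
    case (elim j)
    then have "1 / infdist x F < real j" using N by linarith
    then show ?case using pos by (simp add: field_simps)
  qed
  then show ?thesis using False by (simp add: tendsto_eventually)
qed

lemma continuous_on_infdist_cutoff:
  "continuous_on UNIV (\<lambda>x. max 0 (1 - real j * infdist x F))"
  by (intro continuous_intros)

lemma integral_infdist_cutoff_tendsto:
  fixes L :: "'a::metric_space measure"
  assumes L: "prob_space L" "sets L = sets borel" and F: "closed F" "F \<noteq> {}"
  shows "(\<lambda>j. \<integral>x. max 0 (1 - real j * infdist x F) \<partial>L) \<longlonglongrightarrow> measure L F"
proof -
  interpret prob_space L by fact
  have "(\<lambda>j. \<integral>x. max 0 (1 - real j * infdist x F) \<partial>L) \<longlonglongrightarrow> (\<integral>x. indicator F x \<partial>L)"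
  proof (rule integral_dominated_convergence[where w="\<lambda>_. 1"])
    show "(\<lambda>x. indicator F x :: real) \<in> borel_measurable L"
      using F(1) L(2) by (intro borel_measurable_indicator) auto
    show "(\<lambda>x. max 0 (1 - real j * infdist x F)) \<in> borel_measurable L" for j
      using borel_measurable_continuous_onI[OF continuous_on_infdist_cutoff] L(2)
      by (simp cong: measurable_cong_sets)
    show "integrable L (\<lambda>x. 1::real)" by simp
    show "AE x in L. (\<lambda>j. max 0 (1 - real j * infdist x F)) \<longlonglongrightarrow> indicator F x"
      using tendsto_approx_infdist_indicator[OF F] by auto
    show "AE x in L. norm (max 0 (1 - real j * infdist x F)) \<le> 1" for j
      by (auto intro!: AE_I2 mult_nonneg_nonneg infdist_nonneg)
  qed
  then show ?thesis using F(1) L(2) by (simp add: sets_eq_imp_space_eq)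
qed

text \<open>Integrals of the cutoffs determine the measure of every closed set, and closed sets form
  an intersection-stable generator of the Borel sets.\<close>

lemma finite_measure_eqI_continuous:
  fixes M N :: "'a::metric_space measure"
  assumes M: "prob_space M" "sets M = sets borel" and N: "prob_space N" "sets N = sets borel"
    and eq: "\<And>f :: 'a \<Rightarrow> real. continuous_on UNIV f \<Longrightarrow> (\<And>x. \<bar>f x\<bar> \<le> 1) \<Longrightarrow> (\<integral>x. f x \<partial>M) = (\<integral>x. f x \<partial>N)"
  shows "M = N"
proof (rule measure_eqI_generator_eq[where E="Collect closed" and \<Omega>=UNIV and A="\<lambda>_. UNIV"])
  interpret M: prob_space M by fact
  interpret N: prob_space N by fact
  show "Int_stable (Collect closed)" by (auto simp: Int_stable_def)
  show "sets M = sigma_sets UNIV (Collect closed)" "sets N = sigma_sets UNIV (Collect closed)"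
    unfolding M N by (auto simp: borel_eq_closed)
  fix F :: "'a set" assume "F \<in> Collect closed"
  then have F: "closed F" by simp
  have "(\<integral>x. max 0 (1 - real j * infdist x F) \<partial>M) = (\<integral>x. max 0 (1 - real j * infdist x F) \<partial>N)" for j
    by (intro eq continuous_on_infdist_cutoff) (auto intro!: mult_nonneg_nonneg infdist_nonneg)
  then have "measure M F = measure N F"
    using LIMSEQ_unique[OF integral_infdist_cutoff_tendsto[OF M F]] integral_infdist_cutoff_tendsto[OF N F]
    by (cases "F = {}") auto
  then show "emeasure M F = emeasure N F"
    by (simp add: M.emeasure_eq_measure N.emeasure_eq_measure)
qed (use M N in \<open>auto simp: prob_space_def finite_measure.emeasure_finite\<close>)

text \<open>Induction over the sigma-algebra generated by the closed sets. The claim is symmetric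
  under complements since \<open>(- C) - (- U) = U - C\<close>; only countable unions need
  work.\<close>

lemma closed_open_regular:
  fixes M :: "'a::metric_space measure"
  assumes M: "prob_space M" "sets M = sets borel" and A: "A \<in> sets borel" and "e > 0"
  shows "\<exists>C U. closed C \<and> open U \<and> C \<subseteq> A \<and> A \<subseteq> U \<and> measure M (U - C) < e"

proof -
  interpret prob_space M by fact
  have sp: "space M = UNIV" using M by (simp add: sets_eq_imp_space_eq)
  have cl: "F \<in> events" if "closed F" for F using that M by simp
  have op: "F \<in> events" if "open F" for F using that M by simp
  note [simp] = M(2)
  have "A \<in> sigma_sets UNIV (Collect closed)" using A by (simp add: borel_eq_closed)
  moreover have triv: "\<exists>C U. closed C \<and> open U \<and> C \<subseteq> {} \<and> {} \<subseteq> U \<and> prob (U - C) < e" if "e > 0" for e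
    by (rule exI[of _ "{}"], rule exI[of _ "{}"]) (use that in simp)
  ultimately have "\<forall>e>0. \<exists>C U. closed C \<and> open U \<and> C \<subseteq> A \<and> A \<subseteq> U \<and> prob (U - C) < e"
  proof (induction rule: sigma_sets.induct)
    case (Basic F)
    then have F: "closed F" by simp
    show ?case
    proof (cases "F = {}")
      case True then show ?thesis using triv by simp
    next
      case False
      \<comment> \<open>Shrinking neighbourhoods present the closed set as a decreasing intersection
        of open sets.\<close>
      define U where "U j = {x. infdist x F < 1 / real (Suc j)}" for j
      have U: "open (U j)" for j
        unfolding U_def by (intro open_Collect_less continuous_intros)
      have FU: "F \<subseteq> U j" for j by (auto simp: U_def)
      have "(\<Inter>j. U j) = F"
      proof (intro equalityI subsetI)
        fix x assume x: "x \<in> (\<Inter>j. U j)"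
        have "infdist x F \<le> 0"
        proof (rule field_le_epsilon)
          fix e :: real assume "e > 0"
          then obtain j where "inverse (real (Suc j)) < e" using reals_Archimedean by blast
          then show "infdist x F \<le> 0 + e" using x by (auto simp: U_def inverse_eq_divide dest: spec[of _ j])
        qed
        then show "x \<in> F" using in_closed_iff_infdist_zero[OF F False] infdist_nonneg[of x F] by auto
      qed (use FU in auto)
      moreover have "decseq U"
      proof (rule decseq_SucI)
        have "1 / real (Suc (Suc j)) \<le> 1 / real (Suc j)" for j by (simp add: field_simps)
        then show "U (Suc j) \<subseteq> U j" for j unfolding U_def by (auto intro: less_le_trans)
      qed
      then have "(\<lambda>j. prob (U j)) \<longlonglongrightarrow> prob (\<Inter>j. U j)"
        using op U by (intro finite_Lim_measure_decseq) auto
      ultimately have lim: "(\<lambda>j. prob (U j)) \<longlonglongrightarrow> prob F" by simp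
      show ?thesis
      proof (intro allI impI)
        fix e :: real assume "e > 0"
        then have "\<forall>\<^sub>F j in sequentially. prob (U j) < prob F + e"
          using order_tendstoD(2)[OF lim, of "prob F + e"] by simp
        then obtain j where "prob (U j) < prob F + e" by (auto simp: eventually_sequentially)
        moreover have "prob (U j - F) = prob (U j) - prob F"
          using U F FU by (intro finite_measure_Diff cl op)
        ultimately show "\<exists>C U. closed C \<and> open U \<and> C \<subseteq> F \<and> F \<subseteq> U \<and> prob (U - C) < e"
          using F U[of j] FU[of j] by (intro exI[of _ F] exI[of _ "U j"]) auto
      qed
    qed
  next
    case Empty
    show ?case using triv by simp
  next
    case (Compl A)
    show ?case
    proof (intro allI impI)
      fix e :: real assume "e > 0"
      then obtain C U where CU: "closed C" "open U" "C \<subseteq> A" "A \<subseteq> U" "prob (U - C) < e"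
        using Compl by blast
      have "(- C) - (- U) = U - C" by auto
      show "\<exists>C U. closed C \<and> open U \<and> C \<subseteq> UNIV - A \<and> UNIV - A \<subseteq> U \<and> prob (U - C) < e"
      proof (intro exI conjI)
        show "closed (- U)" "open (- C)" using CU by auto
        show "- U \<subseteq> UNIV - A" "UNIV - A \<subseteq> - C" using CU by auto
        show "prob ((- C) - (- U)) < e" using CU \<open>(- C) - (- U) = U - C\<close> by simp
      qed
    qed
  next
    case (Union A)
    show ?case
    proof (intro allI impI)
      fix e :: real assume e: "e > 0"
      \<comment> \<open>The total is \<open>e / 2\<close>. The remaining half pays for replacing the
        infinite union of closed sets, which need not be closed, by a finite one.\<close>
      define d where "d i = (e / 4) * (1 / 2) ^ i" for i :: nat
      have "d i > 0" for i using e by (simp add: d_def)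
      then have "\<exists>C U. closed C \<and> open U \<and> C \<subseteq> A i \<and> A i \<subseteq> U \<and> prob (U - C) < d i" for i
        using Union by blast
      then obtain C U where CU: "\<And>i. closed (C i)" "\<And>i. open (U i)" "\<And>i. C i \<subseteq> A i" "\<And>i. A i \<subseteq> U i"
        "\<And>i. prob (U i - C i) < d i" by metis
      have sd: "summable d" "suminf d = e / 2"
        using sums_mult[OF geometric_sums[of "1/2::real"], of "e/4"] unfolding d_def
        by (auto simp: sums_iff)
      have summ: "summable (\<lambda>i. prob (U i - C i))"
        using CU(5) by (intro summable_comparison_test[OF _ sd(1)]) (auto intro!: exI[of _ 0] less_imp_le)
      have "prob (\<Union>i. U i - C i) \<le> (\<Sum>i. prob (U i - C i))"
        using CU cl op by (intro finite_measure_subadditive_countably summ) auto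
      also have "\<dots> \<le> suminf d"
        using CU(5) by (intro suminf_le summ sd) (auto intro: less_imp_le)
      finally have 1: "prob (\<Union>i. U i - C i) \<le> e / 2" using sd by simp
      define V where "V = (\<Union>i. U i)"
      \<comment> \<open>The excess of \<open>V\<close> over finite unions decreases into the union
        of the \<open>U i - C i\<close>, so it is below \<open>e\<close> from some \<open>n\<close>
        on.\<close>
      define D where "D n = V - (\<Union>i\<le>n. C i)" for n
      have D: "D n \<in> events" for n
        unfolding D_def V_def using CU by (auto intro!: sets.Diff sets.countable_UN sets.finite_UN)
      have "decseq D" by (auto simp: D_def decseq_def)
      then have lim: "(\<lambda>n. prob (D n)) \<longlonglongrightarrow> prob (\<Inter>n. D n)"
        using D by (intro finite_Lim_measure_decseq) auto
      moreover have "prob (\<Inter>n. D n) \<le> e / 2"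
      proof -
        have "(\<Inter>n. D n) \<subseteq> (\<Union>i. U i - C i)" unfolding D_def V_def by blast
        then have "prob (\<Inter>n. D n) \<le> prob (\<Union>i. U i - C i)"
          using CU cl op by (intro finite_measure_mono) (auto intro!: sets.countable_UN sets.Diff)
        with 1 show ?thesis by simp
      qed
      ultimately have "\<forall>\<^sub>F n in sequentially. prob (D n) < e"
        using e by (intro order_tendstoD(2)[OF lim]) auto
      then obtain n where n: "prob (D n) < e" by (auto simp: eventually_sequentially)
      show "\<exists>C U. closed C \<and> open U \<and> C \<subseteq> \<Union> (range A) \<and> \<Union> (range A) \<subseteq> U \<and> prob (U - C) < e"
      proof (intro exI conjI)
        show "closed (\<Union>i\<le>n. C i)" using CU by (intro closed_UN) auto
        show "open V" unfolding V_def using CU by auto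
        show "(\<Union>i\<le>n. C i) \<subseteq> \<Union> (range A)" using CU(3) by (auto dest!: subsetD)
        show "\<Union> (range A) \<subseteq> V" unfolding V_def using CU(4) by (intro UN_mono) auto
        show "prob (V - (\<Union>i\<le>n. C i)) < e" using n by (simp add: D_def)
      qed
    qed
  qed
  then show ?thesis using \<open>e > 0\<close> by blast
qed

section \<open>Weak sequential compactness by coding points as real numbers\<close>

lemma compact_finite_net:
  assumes "compact (UNIV :: 'a::metric_space set)" "e > 0"
  shows "\<exists>F :: 'a set. finite F \<and> UNIV \<subseteq> (\<Union>z\<in>F. ball z e)"
proof -
  have "UNIV \<subseteq> (\<Union>z\<in>UNIV. ball z e)" using \<open>e > 0\<close> by auto
  then show ?thesis
    using compactE_image[OF assms(1), of UNIV "\<lambda>z. ball z e"] by (metis open_ball)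
qed

text \<open>Membership in a countable family of balls is written into ternary digits 0 and 2, as in
  the Cantor set. The code need not be continuous, but its inverse is uniformly continuous, and only
  this is claimed.\<close>

lemma compact_ex_coding:
  assumes "compact (UNIV :: 'a::metric_space set)"
  shows "\<exists>c :: 'a \<Rightarrow> real. (\<forall>x. c x \<in> {0..1}) \<and>
    (\<forall>e>0. \<exists>d>0. \<forall>x y. \<bar>c x - c y\<bar> < d \<longrightarrow> dist x y < e)"
proof -
  have "\<exists>F. finite F \<and> (UNIV :: 'a set) \<subseteq> (\<Union>z\<in>F. ball z (1 / real (Suc m)))" for m
    using compact_finite_net[OF assms] by simp
  then obtain F :: "nat \<Rightarrow> 'a set" where F: "\<And>m. finite (F m)" "\<And>m. UNIV \<subseteq> (\<Union>z\<in>F m. ball z (1 / real (Suc m)))"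
    by metis
  define B where "B = (\<Union>m. (\<lambda>z. ball z (1 / real (Suc m))) ` F m)"
  have B: "countable B" unfolding B_def using F by (auto intro: countable_finite)
  have "F 0 \<noteq> {}" using F(2)[of 0] by auto
  then have "B \<noteq> {}" by (auto simp: B_def)
  define U where "U = from_nat_into B"
  \<comment> \<open>The digits after position \<open>k\<close> add up to at most
    \<open>(1 / 3) ^ Suc k\<close>, half of a jump at position \<open>k\<close>; hence the first
    differing digit cannot be compensated by later ones.\<close>
  define a :: "nat \<Rightarrow> 'a \<Rightarrow> real" where "a k x = 2 / 3 * (1 / 3) ^ k * indicator (U k) x" for k x
  define c where "c x = (\<Sum>k. a k x)" for x
  have geo: "(\<lambda>k. 2 / 3 * (1 / 3 :: real) ^ k) sums 1"
    using sums_mult[OF geometric_sums[of "1/3::real"], of "2/3"] by simp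
  have a01: "0 \<le> a k x" "a k x \<le> 2 / 3 * (1 / 3) ^ k" for k x
    by (auto simp: a_def indicator_def)
  have summ: "summable (\<lambda>k. a k x)" for x
    by (rule summable_comparison_test[OF _ sums_summable[OF geo]]) (use a01 in auto)
  have sep: "(1 / 3) ^ Suc N \<le> \<bar>c x - c y\<bar>" if "k \<le> N" "x \<in> U k" "y \<notin> U k" for k N x y
  proof -
    define j where "j = (LEAST j. indicator (U j) x \<noteq> (indicator (U j) y :: real))"
    have "indicator (U k) x \<noteq> (indicator (U k) y :: real)" using that by auto
    then have j: "indicator (U j) x \<noteq> (indicator (U j) y :: real)" "j \<le> k"
      unfolding j_def by (fact LeastI[of "\<lambda>j. indicator (U j) x \<noteq> (indicator (U j) y :: real)" k],
        fact Least_le[of "\<lambda>j. indicator (U j) x \<noteq> (indicator (U j) y :: real)" k])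
    have lt: "a i x = a i y" if "i < j" for i
      using not_less_Least[OF that[unfolded j_def]] by (simp add: a_def)
    have split: "c z = (\<Sum>i<j. a i z) + a j z + (\<Sum>i. a (i + Suc j) z)" for z
      unfolding c_def using suminf_split_initial_segment[OF summ, of z "Suc j"] by simp
    have tail: "(\<Sum>i. a (i + Suc j) z) \<in> {0..(1 / 3) ^ Suc j}" for z
    proof -
      have sg: "(\<lambda>i. 2 / 3 * (1 / 3 :: real) ^ (i + Suc j)) sums ((1 / 3) ^ Suc j)"
        using sums_mult[OF geo, of "(1 / 3) ^ Suc j"] by (simp add: power_add algebra_simps)
      have "(\<Sum>i. a (i + Suc j) z) \<le> (\<Sum>i. 2 / 3 * (1 / 3 :: real) ^ (i + Suc j))"
        by (intro suminf_le a01 summable_ignore_initial_segment[OF summ] sums_summable[OF sg])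
      moreover have "0 \<le> (\<Sum>i. a (i + Suc j) z)"
        by (intro suminf_nonneg summable_ignore_initial_segment[OF summ] a01)
      ultimately show ?thesis
        using sums_unique[OF sg] unfolding atLeastAtMost_iff by linarith
    qed
    have "\<bar>a j x - a j y\<bar> = 2 * (1 / 3) ^ Suc j"
      using j(1) by (auto simp: a_def indicator_def split: if_splits)
    moreover have "c x - c y = (a j x - a j y) + ((\<Sum>i. a (i + Suc j) x) - (\<Sum>i. a (i + Suc j) y))"
      using lt by (simp add: split)
    ultimately have "(1 / 3) ^ Suc j \<le> \<bar>c x - c y\<bar>"
      using tail[of x] tail[of y] unfolding atLeastAtMost_iff by linarith
    moreover have "(1 / 3 :: real) ^ Suc N \<le> (1 / 3) ^ Suc j"
      using that j by (intro power_decreasing) auto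
    ultimately show ?thesis by linarith
  qed
  show ?thesis
  proof (rule exI[of _ c], intro conjI allI impI)
    show "c x \<in> {0..1}" for x
      using suminf_le[OF a01(2) summ sums_summable[OF geo]] sums_unique[OF geo]
        suminf_nonneg[OF summ a01(1)] unfolding c_def by auto
  next
    fix e :: real assume "e > 0"
    then obtain m where m: "inverse (real (Suc m)) < e / 2" using reals_Archimedean[of "e/2"] by auto
    have "\<exists>k. U k = ball z (1 / real (Suc m))" if "z \<in> F m" for z
      using from_nat_into_surj[OF B, of "ball z (1 / real (Suc m))"] that unfolding U_def B_def by blast
    then obtain idx where idx: "\<And>z. z \<in> F m \<Longrightarrow> U (idx z) = ball z (1 / real (Suc m))" by metis
    \<comment> \<open>The sum serves as a common bound for the indices of the finitely many balls of
      the net.\<close>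
    define N where "N = (\<Sum>z\<in>F m. idx z)"
    have "dist x y < e" if "\<bar>c x - c y\<bar> < (1 / 3) ^ Suc N" for x y
    proof (rule ccontr)
      assume "\<not> dist x y < e"
      obtain z where z: "z \<in> F m" "x \<in> ball z (1 / real (Suc m))" using F(2) by blast
      have "y \<notin> ball z (1 / real (Suc m))"
      proof
        assume "y \<in> ball z (1 / real (Suc m))"
        then have "dist x y < 2 * inverse (real (Suc m))"
          using z dist_triangle3[of x y z] by (simp add: inverse_eq_divide)
        then show False using m \<open>\<not> dist x y < e\<close> by simp
      qed
      moreover have "idx z \<le> N" unfolding N_def using F z by (intro member_le_sum) auto
      ultimately have "(1 / 3) ^ Suc N \<le> \<bar>c x - c y\<bar>" using z idx by (intro sep[of "idx z"]) auto
      then show False using that by simp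
    qed
    moreover have "(1 / 3 :: real) ^ Suc N > 0" by simp
    ultimately show "\<exists>d>0. \<forall>x y. \<bar>c x - c y\<bar> < d \<longrightarrow> dist x y < e" by metis
  qed
qed

text \<open>The measures are pushed to the real line by the code, where tightness yields a weakly
  convergent subsequence. The limit is carried by the closure \<open>K\<close> of the set of codes
  and is pulled back along the continuous extension to \<open>K\<close> of the inverse of the
  code.\<close>

lemma pmf_weak_limit:
  fixes p :: "nat \<Rightarrow> 'a::metric_space pmf"
  assumes cpt: "compact (UNIV :: 'a set)"
  shows "\<exists>s \<mu>. strict_mono (s :: nat \<Rightarrow> nat) \<and> prob_space \<mu> \<and> sets \<mu> = sets (borel :: 'a measure) \<and>
    (\<forall>f :: 'a \<Rightarrow> real. continuous_on UNIV f \<longrightarrow>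
       (\<lambda>k. \<integral>x. f x \<partial>measure_pmf (p (s k))) \<longlonglongrightarrow> (\<integral>x. f x \<partial>\<mu>))"
proof -
  obtain c :: "'a \<Rightarrow> real" where c01: "\<And>x. c x \<in> {0..1}"
    and cinv: "\<And>e. e > 0 \<Longrightarrow> \<exists>d>0. \<forall>x y. \<bar>c x - c y\<bar> < d \<longrightarrow> dist x y < e"
    using compact_ex_coding[OF cpt] by blast
  define K where "K = closure (range c)"
  have K: "closed K" unfolding K_def by simp
  have cK: "c x \<in> K" for x unfolding K_def by (rule subsetD[OF closure_subset]) simp

  \<comment> \<open>The value of the inverse at a limit \<open>t\<close> of codes: compactness gives
    a limit point \<open>z\<close> of the coded points, and the modulus from \<open>cinv\<close>
    forces every point with code near \<open>t\<close> to be near \<open>z\<close>.\<close>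
  have ex: "\<exists>z. \<forall>e>0. \<exists>d>0. \<forall>x. \<bar>c x - t\<bar> < d \<longrightarrow> dist x z < e" if "t \<in> K" for t
  proof -
    obtain u where u: "\<And>n. u n \<in> range c" "u \<longlonglongrightarrow> t"
      using \<open>t \<in> K\<close> unfolding K_def closure_sequential by blast
    have "\<forall>n. \<exists>y. u n = c y" using u(1) by (simp add: image_iff)
    from choice[OF this] obtain y where y: "\<And>n. u n = c (y n)" by blast
    have "\<exists>z r. strict_mono r \<and> (y \<circ> r) \<longlonglongrightarrow> z"
      using cpt by (simp add: compact_eq_seq_compact_metric seq_compact_def)
    then obtain z and r :: "nat \<Rightarrow> nat" where r: "strict_mono r" "(y \<circ> r) \<longlonglongrightarrow> z" by blast
    have ur: "(u \<circ> r) \<longlonglongrightarrow> t" using u(2) r(1) by (rule LIMSEQ_subseq_LIMSEQ)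
    show ?thesis
    proof (intro exI[of _ z] allI impI)
      fix e :: real assume "e > 0"
      then obtain d where d: "d > 0" "\<And>x y. \<bar>c x - c y\<bar> < d \<Longrightarrow> dist x y < e / 2"
        using cinv[of "e / 2"] by auto
      have "\<forall>\<^sub>F n in sequentially. dist ((u \<circ> r) n) t < d / 2 \<and> dist ((y \<circ> r) n) z < e / 2"
        using tendstoD[OF ur, of "d/2"] tendstoD[OF r(2), of "e/2"] d \<open>e > 0\<close> by (simp add: eventually_conj)
      then obtain n where n: "dist ((u \<circ> r) n) t < d / 2" "dist ((y \<circ> r) n) z < e / 2"
        by (auto simp: eventually_sequentially)
      have "dist x z < e" if "\<bar>c x - t\<bar> < d / 2" for x
      proof -
        have "\<bar>c x - c (y (r n))\<bar> < d" using that n(1) unfolding comp_def y dist_real_def by linarith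
        from d(2)[OF this] n(2) show ?thesis using dist_triangle[of x z "y (r n)"] by simp
      qed
      then show "\<exists>d>0. \<forall>x. \<bar>c x - t\<bar> < d \<longrightarrow> dist x z < e" using d by (intro exI[of _ "d / 2"]) auto
    qed
  qed
  define \<pi> where "\<pi> t = (SOME z. \<forall>e>0. \<exists>d>0. \<forall>x. \<bar>c x - t\<bar> < d \<longrightarrow> dist x z < e)" for t
  have \<pi>: "\<exists>d>0. \<forall>x. \<bar>c x - t\<bar> < d \<longrightarrow> dist x (\<pi> t) < e" if "t \<in> K" "e > 0" for t e
    using someI_ex[OF ex[OF that(1)]] that(2) unfolding \<pi>_def by blast
  have \<pi>c: "\<pi> (c x) = x" for x
  proof -
    have "dist x (\<pi> (c x)) < e" if "e > 0" for e
      using \<pi>[OF cK that, of x] by (auto dest: spec[of _ x])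
    then have "dist x (\<pi> (c x)) \<le> 0" by (meson less_irrefl not_le)
    then show ?thesis by simp
  qed
  \<comment> \<open>The values at \<open>t\<close> and \<open>t'\<close> are both compared with one
    point whose code is close to \<open>t'\<close>, and hence to \<open>t\<close>.\<close>
  have cont: "continuous_on K \<pi>"
    unfolding continuous_on_iff
  proof (intro ballI allI impI)
    fix t e :: real assume t: "t \<in> K" "e > 0"
    then obtain d where d: "d > 0" "\<And>x. \<bar>c x - t\<bar> < d \<Longrightarrow> dist x (\<pi> t) < e / 2"
      using \<pi>[of t "e / 2"] by auto
    have "dist (\<pi> t') (\<pi> t) < e" if t': "t' \<in> K" "dist t' t < d / 2" for t'
    proof -
      obtain d' where d': "d' > 0" "\<And>x. \<bar>c x - t'\<bar> < d' \<Longrightarrow> dist x (\<pi> t') < e / 2"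
        using \<pi>[of t' "e / 2"] t t' by auto
      have "0 < min d' (d / 2)" using d(1) d'(1) by simp
      then have "\<exists>z\<in>range c. dist z t' < min d' (d / 2)"
        using t'(1) unfolding K_def closure_approachable by blast
      then obtain x where x: "dist (c x) t' < min d' (d / 2)" by blast
      then have "dist x (\<pi> t') < e / 2" "dist x (\<pi> t) < e / 2"
        using t'(2) unfolding dist_real_def by (intro d d'; linarith)+
      then show ?thesis using dist_triangle3[of "\<pi> t'" "\<pi> t" x] by simp
    qed
    then show "\<exists>d>0. \<forall>x'\<in>K. dist x' t < d \<longrightarrow> dist (\<pi> x') (\<pi> t) < e"
      using d(1) by (intro exI[of _ "d / 2"]) auto
  qed

  \<comment> \<open>Every map is measurable on a \<open>pmf\<close>, so a discontinuous code causes
    no difficulty here.\<close>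
  define \<nu> where "\<nu> n = distr (measure_pmf (p n)) borel c" for n
  have rd: "real_distribution (\<nu> n)" for n
    unfolding \<nu>_def by (intro prob_space.real_distribution_distr prob_space_measure_pmf) simp
  have m1: "measure (\<nu> n) A = 1" if "A \<in> sets borel" "range c \<subseteq> A" for n A
  proof -
    have "c -` A = UNIV" using that by auto
    then show ?thesis unfolding \<nu>_def using that by (subst measure_distr) auto
  qed
  have "tight \<nu>"
    unfolding tight_def
  proof (intro conjI allI impI rd)
    fix e :: real assume "e > 0"
    have "range c \<subseteq> {-1<..1}" proof (rule image_subsetI)
      show "c x \<in> {-1<..1}" for x using c01[of x] by simp
    qed
    with \<open>e > 0\<close> show "\<exists>a b. a < b \<and> (\<forall>n. 1 - e < measure (\<nu> n) {a<..b})"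
      by (intro exI[of _ "-1"] exI[of _ 1]) (simp add: m1)
  qed
  then obtain r N where r: "strict_mono (r :: nat \<Rightarrow> nat)" and N: "real_distribution N" "weak_conv_m (\<nu> \<circ> id \<circ> r) N"
    using tight_imp_convergent_subsubsequence[of \<nu> id] by (auto simp: strict_mono_id)
  interpret N: real_distribution N by fact
  have weak: "(\<lambda>k. \<integral>t. g t \<partial>\<nu> (r k)) \<longlonglongrightarrow> (\<integral>t. g t \<partial>N)"
    if "continuous_on UNIV g" "\<And>t. norm (g t) \<le> B" for g :: "real \<Rightarrow> real" and B
  proof -
    have "isCont g t" for t using that(1) by (simp add: continuous_on_eq_continuous_at)
    from weak_conv_imp_integral_bdd_continuous_conv[OF _ N this that(2)] show ?thesis using rd by simp
  qed
  have int\<nu>: "(\<integral>t. g t \<partial>\<nu> n) = (\<integral>x. g (c x) \<partial>measure_pmf (p n))"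
    if "continuous_on UNIV g" for g :: "real \<Rightarrow> real" and n
    unfolding \<nu>_def using that by (subst integral_distr) (auto intro: borel_measurable_continuous_onI)
  have "range c \<noteq> {}" by simp
  then have "K \<noteq> {}" unfolding K_def by simp
  \<comment> \<open>The test function \<open>min 1 (infdist t K)\<close> vanishes on all codes, so
    its integral against the limit is 0, while it is positive off the closed set
    \<open>K\<close>.\<close>
  have N_K: "AE t in N. t \<in> K"
  proof -
    define g where "g t = min 1 (infdist t K)" for t
    have g: "continuous_on UNIV g" unfolding g_def by (intro continuous_intros)
    have [measurable]: "g \<in> borel_measurable borel" by (rule borel_measurable_continuous_onI[OF g])
    have g1: "norm (g t) \<le> 1" "0 \<le> g t" for t using infdist_nonneg[of t K] by (auto simp: g_def)
    have "(\<integral>t. g t \<partial>\<nu> n) = 0" for n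
      using cK by (simp add: int\<nu>[OF g]) (simp add: g_def)
    then have "(\<integral>t. g t \<partial>N) = 0" using weak[OF g g1(1)] by (simp add: LIMSEQ_const_iff)
    moreover have "integrable N g"
      using g1 by (intro N.integrable_const_bound[of _ 1]) (simp, measurable)
    ultimately have "AE t in N. g t = 0"
      using integral_nonneg_eq_0_iff_AE[of N g] g1(2) by simp
    then show ?thesis
    proof eventually_elim
      case (elim t)
      then have "infdist t K = 0" by (auto simp: g_def min_def split: if_splits)
      then show ?case using in_closed_iff_infdist_zero[OF K \<open>K \<noteq> {}\<close>] by simp
    qed
  qed
  obtain k0 where "k0 \<in> K" using \<open>K \<noteq> {}\<close> by blast
  \<comment> \<open>Extended by a constant off \<open>K\<close> to obtain a Borel map on the whole
    line; \<open>N\<close> does not charge the complement of \<open>K\<close>.\<close>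
  define \<rho> where "\<rho> t = (if t \<in> K then \<pi> t else \<pi> k0)" for t
  have \<rho>: "\<rho> \<in> borel_measurable borel"
    unfolding \<rho>_def using K cont by (intro borel_measurable_continuous_on_if borel_closed) auto
  define \<mu> where "\<mu> = distr N borel \<rho>"
  show ?thesis
  proof (rule exI[of _ r], rule exI[of _ \<mu>], intro conjI allI impI)
    show "strict_mono r" by fact
    show "prob_space \<mu>" unfolding \<mu>_def using \<rho> by (intro N.prob_space_distr) simp
    show "sets \<mu> = sets borel" by (simp add: \<mu>_def)
    fix f :: "'a \<Rightarrow> real" assume f: "continuous_on UNIV f"
    have "bounded (range f)" using compact_continuous_image[OF f cpt] compact_imp_bounded by blast
    then obtain B where B: "\<And>x. norm (f x) \<le> B" by (auto simp: bounded_iff)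
    have "0 \<le> B" using B[of undefined] norm_ge_zero order_trans by blast
    have "continuous_on K (\<lambda>t. f (\<pi> t))"
      using continuous_on_compose2[OF f cont] by auto
    \<comment> \<open>Weak convergence on the line needs a test function on the whole line, and
      Tietze's theorem extends \<open>f\<close> composed with \<open>\<pi>\<close> from
      \<open>K\<close> with the same bound.\<close>
    then obtain g where g: "continuous_on UNIV g" "\<And>t. t \<in> K \<Longrightarrow> g t = f (\<pi> t)" "\<And>t. norm (g t) \<le> B"
      using Tietze[of K "\<lambda>t. f (\<pi> t)" UNIV B] K \<open>0 \<le> B\<close> B by (auto simp: closed_closedin[symmetric])
    have "(\<integral>t. g t \<partial>\<nu> n) = (\<integral>x. f x \<partial>measure_pmf (p n))" for n
      by (simp add: int\<nu>[OF g(1)] g(2)[OF cK] \<pi>c)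
    moreover have "(\<integral>t. g t \<partial>N) = (\<integral>t. f (\<rho> t) \<partial>N)"
    proof (rule integral_cong_AE)
      have [measurable]: "g \<in> borel_measurable borel" "f \<in> borel_measurable borel" "\<rho> \<in> borel_measurable borel"
        using g f \<rho> by (auto intro: borel_measurable_continuous_onI)
      show "g \<in> borel_measurable N" "(\<lambda>t. f (\<rho> t)) \<in> borel_measurable N" by measurable
      show "AE t in N. g t = f (\<rho> t)" using N_K by eventually_elim (simp add: g \<rho>_def)
    qed
    moreover have "\<dots> = (\<integral>x. f x \<partial>\<mu>)"
      unfolding \<mu>_def using \<rho> borel_measurable_continuous_onI[OF f] by (subst integral_distr) auto
    ultimately show "(\<lambda>k. \<integral>x. f x \<partial>measure_pmf (p (r k))) \<longlonglongrightarrow> (\<integral>x. f x \<partial>\<mu>)"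
      using weak[OF g(1,3)] by simp
  qed
qed

section \<open>Separated sums and pressure at a fixed scale\<close>

lemma birkhoff_sum_add:
  "birkhoff_sum T (m + n) f x = birkhoff_sum T m f x + birkhoff_sum T n f ((T ^^ m) x)"
  unfolding birkhoff_sum_def
  by (induction n) (simp_all add: funpow_add[THEN fun_cong, unfolded comp_def] add.commute)

lemma bcontfun_abs_le: "\<bar>apply_bcontfun f x\<bar> \<le> norm (f :: 'a::topological_space \<Rightarrow>\<^sub>C real)"
  using norm_bounded[of f x] by simp

lemma abs_birkhoff_sum_le:
  fixes f :: "'a::topological_space \<Rightarrow>\<^sub>C real"
  shows "\<bar>birkhoff_sum T n f x\<bar> \<le> real n * norm f"
proof -
  have "\<bar>birkhoff_sum T n f x\<bar> \<le> (\<Sum>k<n. \<bar>f ((T ^^ k) x)\<bar>)"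
    unfolding birkhoff_sum_def by (rule sum_abs)
  also have "\<dots> \<le> (\<Sum>k<n. norm f)"
    by (intro sum_mono bcontfun_abs_le)
  finally show ?thesis by simp
qed

lemma bowen_dist_le_iff:
  assumes "n > 0"
  shows "bowen_dist T n x y \<le> e \<longleftrightarrow> (\<forall>k<n. dist ((T ^^ k) x) ((T ^^ k) y) \<le> e)"
proof -
  have "{..<n} \<noteq> {}" using assms by auto
  then show ?thesis unfolding bowen_dist_def by (subst Max_le_iff) auto
qed

lemma separated_iff:
  assumes "n > 0"
  shows "separated T n e E \<longleftrightarrow> (\<forall>x\<in>E. \<forall>y\<in>E. x \<noteq> y \<longrightarrow> (\<exists>k<n. dist ((T ^^ k) x) ((T ^^ k) y) > e))"
proof -
  have "bowen_dist T n x y > e \<longleftrightarrow> (\<exists>k<n. dist ((T ^^ k) x) ((T ^^ k) y) > e)" for x y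
    using bowen_dist_le_iff[OF assms, of T x y e] by (meson not_le)
  then show ?thesis unfolding separated_def by simp
qed

lemma ex_finite_labelling:
  assumes "compact (UNIV :: 'a::metric_space set)" "e > 0"
  shows "\<exists>g :: 'a \<Rightarrow> 'a. finite (range g) \<and> (\<forall>x y. g x = g y \<longrightarrow> dist x y \<le> e)"
proof -
  have "e / 2 > 0" using assms by simp
  from compact_finite_net[OF assms(1) this] obtain F :: "'a set"
    where F: "finite F" "UNIV \<subseteq> (\<Union>z\<in>F. ball z (e / 2))" by blast
  have "\<forall>x. \<exists>z. z \<in> F \<and> dist z x < e / 2" using F(2) by (auto simp: subset_eq)
  from choice[OF this] obtain g where g: "\<And>x. g x \<in> F" "\<And>x. dist (g x) x < e / 2" by blast
  have "dist x y \<le> e" if "g x = g y" for x y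
    using g(2)[of x] g(2)[of y] dist_triangle3[of x y "g x"] that by simp
  moreover have "range g \<subseteq> F" using g(1) by (rule image_subsetI)
  then have "finite (range g)" using F(1) by (rule finite_subset)
  ultimately show ?thesis by blast
qed

text \<open>Label the space by finitely many sets of diameter at most \<open>e\<close>. Points of a
  separated set have different itineraries of length \<open>n\<close>, and there are at most
  \<open>K ^ n\<close> of these, with \<open>K\<close> the number of labels.\<close>

lemma separated_card_bound:
  assumes "compact (UNIV :: 'a::metric_space set)" "e > 0"
  shows "\<exists>K>0. \<forall>(T :: 'a \<Rightarrow> 'a) n E. n > 0 \<and> separated T n e E \<longrightarrow> finite E \<and> card E \<le> K ^ n"
proof -
  obtain g :: "'a \<Rightarrow> 'a" where g: "finite (range g)" "\<And>x y. g x = g y \<Longrightarrow> dist x y \<le> e"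
    using ex_finite_labelling[OF assms] by blast
  have "finite E \<and> card E \<le> card (range g) ^ n" if E: "n > 0" "separated T n e E" for T :: "'a \<Rightarrow> 'a" and n E
  proof -
    have inj: "inj_on (itinerary T g n) E"
    proof (rule inj_onI, rule ccontr)
      fix x y assume xy: "x \<in> E" "y \<in> E" "itinerary T g n x = itinerary T g n y" "x \<noteq> y"
      then obtain k where k: "k < n" "dist ((T ^^ k) x) ((T ^^ k) y) > e"
        using separated_iff[OF E(1), of T e E] E(2) by blast
      have "g ((T ^^ k) x) = g ((T ^^ k) y)"
        using arg_cong[OF xy(3), of "\<lambda>b. b ! k"] k(1) by simp
      then show False using g(2) k(2) by fastforce
    qed
    have sub: "itinerary T g n ` E \<subseteq> range (itinerary T g n)" by auto
    note fin = finite_range_itinerary[OF g(1), of T n]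
    have "finite E" using finite_imageD[OF finite_subset[OF sub fin] inj] .
    moreover have "card E \<le> card (range g) ^ n"
      using card_mono[OF fin sub] card_image[OF inj] card_range_itinerary_le[OF g(1), of T n] by linarith
    ultimately show ?thesis by blast
  qed
  moreover have "card (range g) > 0" using g(1) by (simp add: card_gt_0_iff)
  ultimately show ?thesis by blast
qed

context
  fixes T :: "'a::metric_space \<Rightarrow> 'a"
  assumes cpt: "compact (UNIV :: 'a set)"
begin

abbreviation (input) sep_sum :: "('a \<Rightarrow>\<^sub>C real) \<Rightarrow> nat \<Rightarrow> real \<Rightarrow> real" where
  "sep_sum \<phi> n e \<equiv> separated_sum T (apply_bcontfun \<phi>) n e"

abbreviation (input) exp_sum :: "('a \<Rightarrow>\<^sub>C real) \<Rightarrow> nat \<Rightarrow> 'a set \<Rightarrow> real" where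
  "exp_sum \<phi> n E \<equiv> \<Sum>x\<in>E. exp (birkhoff_sum T n (apply_bcontfun \<phi>) x)"

lemma separated_finite:
  assumes "e > 0" "n > 0" "separated T n e E"
  shows "finite E"
proof -
  obtain K where K: "\<forall>(T :: 'a \<Rightarrow> 'a) n E. n > 0 \<and> separated T n e E \<longrightarrow> finite E \<and> card E \<le> K ^ n"
    using separated_card_bound[OF cpt assms(1)] by (elim exE conjE)
  from K[rule_format, of n T E] assms show ?thesis by simp
qed

lemma separated_sum_bound:
  assumes "e > 0"
  shows "\<exists>K>0. \<forall>n E. n > 0 \<longrightarrow> separated T n e E \<longrightarrow> exp_sum \<phi> n E \<le> real K ^ n * exp (real n * norm \<phi>)"
proof -
  obtain K where K: "K > 0" "\<forall>(T :: 'a \<Rightarrow> 'a) n E. n > 0 \<and> separated T n e E \<longrightarrow> finite E \<and> card E \<le> K ^ n"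
    using separated_card_bound[OF cpt assms(1)] by (elim exE conjE)
  have "exp_sum \<phi> n E \<le> real K ^ n * exp (real n * norm \<phi>)" if "n > 0" "separated T n e E" for n E
  proof -
    have "exp_sum \<phi> n E \<le> real (card E) * exp (real n * norm \<phi>)"
      using abs_birkhoff_sum_le[of T n \<phi>] by (intro sum_bounded_above) (simp add: abs_le_iff)
    also have "card E \<le> K ^ n"
      using K(2)[rule_format, of n T E] that by simp
    then have "real (card E) \<le> real K ^ n" by (simp flip: of_nat_power)
    finally show ?thesis by simp
  qed
  with K(1) show ?thesis by (intro exI[of _ K]) simp
qed

lemma exp_sum_le_sep_sum:
  assumes "e > 0" "n > 0" "separated T n e E"
  shows "exp_sum \<phi> n E \<le> sep_sum \<phi> n e"
proof -
  obtain K where K: "\<forall>n E. n > 0 \<longrightarrow> separated T n e E \<longrightarrow> exp_sum \<phi> n E \<le> real K ^ n * exp (real n * norm \<phi>)"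
    using separated_sum_bound[OF assms(1), of \<phi>] by (elim exE conjE)
  have "bdd_above ((\<lambda>E. exp_sum \<phi> n E) ` {E. separated T n e E})"
    by (rule bdd_aboveI2, rule K[rule_format]) (use assms(2) in simp_all)
  then show ?thesis unfolding separated_sum_def using assms(3) by (intro cSUP_upper) simp_all
qed

lemma separated_empty: "separated T n e {}" and separated_singleton: "separated T n e {x}"
  by (auto simp: separated_def)

lemma sep_sum_le:
  assumes "n > 0" "\<And>E. separated T n e E \<Longrightarrow> exp_sum \<phi> n E \<le> c"
  shows "sep_sum \<phi> n e \<le> c"
  unfolding separated_sum_def using separated_empty by (intro cSUP_least assms) (simp_all, blast)

lemma sep_sum_lower:
  assumes "e > 0" "n > 0"
  shows "exp (- (real n * norm \<phi>)) \<le> sep_sum \<phi> n e"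
proof -
  have "exp (- (real n * norm \<phi>)) \<le> exp_sum \<phi> n {undefined}"
    using abs_birkhoff_sum_le[of T n \<phi> undefined] by simp
  also have "\<dots> \<le> sep_sum \<phi> n e" by (rule exp_sum_le_sep_sum[OF assms separated_singleton])
  finally show ?thesis .
qed

lemma sep_sum_pos: "e > 0 \<Longrightarrow> n > 0 \<Longrightarrow> sep_sum \<phi> n e > 0"
  using sep_sum_lower[of e n \<phi>] exp_gt_zero less_le_trans by blast

lemma ln_sep_sum_lower: "e > 0 \<Longrightarrow> n > 0 \<Longrightarrow> - (real n * norm \<phi>) \<le> ln (sep_sum \<phi> n e)"
  using sep_sum_lower[of e n \<phi>] sep_sum_pos[of e n \<phi>] by (simp add: ln_ge_iff)

lemma ln_sep_sum_upper:
  assumes "e > 0"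
  shows "\<exists>B. \<forall>n>0. ln (sep_sum \<phi> n e) \<le> real n * B"
proof -
  obtain K where K: "K > 0" "\<forall>n E. n > 0 \<longrightarrow> separated T n e E \<longrightarrow> exp_sum \<phi> n E \<le> real K ^ n * exp (real n * norm \<phi>)"
    using separated_sum_bound[OF assms(1), of \<phi>] by (elim exE conjE)
  have "ln (sep_sum \<phi> n e) \<le> real n * (ln (real K) + norm \<phi>)" if "n > 0" for n
  proof -
    have "sep_sum \<phi> n e \<le> real K ^ n * exp (real n * norm \<phi>)" using K(2) that by (intro sep_sum_le) simp_all
    then have "ln (sep_sum \<phi> n e) \<le> ln (real K ^ n * exp (real n * norm \<phi>))"
      using sep_sum_pos[OF assms that] K by (subst ln_le_cancel_iff) auto
    also have "\<dots> = real n * (ln (real K) + norm \<phi>)"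
      using K by (simp add: ln_mult_pos ln_realpow algebra_simps)
    finally show ?thesis .
  qed
  then show ?thesis by blast
qed

lemma sep_sum_antimono:
  assumes "0 < e" "e \<le> e'" "n > 0"
  shows "sep_sum \<phi> n e' \<le> sep_sum \<phi> n e"
proof (rule sep_sum_le[OF assms(3)])
  fix E assume "separated T n e' E"
  then have "separated T n e E" using assms(2) unfolding separated_def by (meson le_less_trans)
  then show "exp_sum \<phi> n E \<le> sep_sum \<phi> n e" using assms by (intro exp_sum_le_sep_sum) auto
qed

text \<open>A set that is optimal up to the factor \<open>exp 1\<close> is enough: the loss of 1 in
  the logarithm disappears on division by \<open>n\<close>.\<close>

lemma sep_sum_attained_approx:
  assumes "e > 0" "n > 0"
  obtains E where "finite E" "E \<noteq> {}" "separated T n e E" "ln (sep_sum \<phi> n e) - 1 \<le> ln (exp_sum \<phi> n E)"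
proof -
  have "\<exists>E. separated T n e E \<and> exp (- 1) * sep_sum \<phi> n e < exp_sum \<phi> n E"
  proof (rule ccontr)
    assume "\<not> ?thesis"
    then have "sep_sum \<phi> n e \<le> exp (- 1) * sep_sum \<phi> n e" using assms by (intro sep_sum_le) (auto simp: not_less)
    moreover have "exp (- 1) * sep_sum \<phi> n e < 1 * sep_sum \<phi> n e"
      using sep_sum_pos[OF assms] by (intro mult_strict_right_mono) auto
    ultimately show False by simp
  qed
  then obtain E where E: "separated T n e E" "exp (- 1) * sep_sum \<phi> n e < exp_sum \<phi> n E" by blast
  have pos: "0 < exp (- 1) * sep_sum \<phi> n e" using sep_sum_pos[OF assms] by simp
  have "ln (exp (- 1) * sep_sum \<phi> n e) \<le> ln (exp_sum \<phi> n E)"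
    using E(2) pos by (subst ln_le_cancel_iff) auto
  moreover have "ln (exp (- 1) * sep_sum \<phi> n e) = ln (sep_sum \<phi> n e) - 1"
    using sep_sum_pos[OF assms] by (simp add: ln_mult_pos)
  ultimately have "ln (sep_sum \<phi> n e) - 1 \<le> ln (exp_sum \<phi> n E)" by simp
  moreover have "E \<noteq> {}" using E(2) pos by auto
  ultimately show thesis using that E(1) separated_finite[OF assms E(1)] by blast
qed

lemma exp_sum_mono_potential:
  assumes "finite E"
  shows "exp_sum \<phi> n E \<le> exp (real n * norm (\<phi> - \<psi>)) * exp_sum \<psi> n E"
  unfolding sum_distrib_left
proof (intro sum_mono)
  fix x
  have "birkhoff_sum T n \<phi> x - birkhoff_sum T n \<psi> x = birkhoff_sum T n (\<phi> - \<psi>) x"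
    by (simp add: birkhoff_sum_def sum_subtractf)
  then have "birkhoff_sum T n \<phi> x \<le> real n * norm (\<phi> - \<psi>) + birkhoff_sum T n \<psi> x"
    using abs_birkhoff_sum_le[of T n "\<phi> - \<psi>" x] by linarith
  then show "exp (birkhoff_sum T n \<phi> x) \<le> exp (real n * norm (\<phi> - \<psi>)) * exp (birkhoff_sum T n \<psi> x)"
    by (simp add: exp_add[symmetric])
qed

lemma ln_sep_sum_lipschitz:
  assumes "e > 0" "n > 0"
  shows "ln (sep_sum \<phi> n e) \<le> real n * norm (\<phi> - \<psi>) + ln (sep_sum \<psi> n e)"
proof -
  have "sep_sum \<phi> n e \<le> exp (real n * norm (\<phi> - \<psi>)) * sep_sum \<psi> n e"
  proof (rule sep_sum_le[OF assms(2)])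
    fix E assume E: "separated T n e E"
    have "exp_sum \<phi> n E \<le> exp (real n * norm (\<phi> - \<psi>)) * exp_sum \<psi> n E"
      by (rule exp_sum_mono_potential[OF separated_finite[OF assms E]])
    also have "\<dots> \<le> exp (real n * norm (\<phi> - \<psi>)) * sep_sum \<psi> n e"
      by (intro mult_left_mono exp_sum_le_sep_sum assms E) simp
    finally show "exp_sum \<phi> n E \<le> exp (real n * norm (\<phi> - \<psi>)) * sep_sum \<psi> n e" .
  qed
  then have "ln (sep_sum \<phi> n e) \<le> ln (exp (real n * norm (\<phi> - \<psi>)) * sep_sum \<psi> n e)"
    using sep_sum_pos[OF assms] by (subst ln_le_cancel_iff) auto
  then show ?thesis using sep_sum_pos[OF assms, of \<psi>] by (simp add: ln_mult_pos)
qed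

definition scale_pressure :: "('a \<Rightarrow>\<^sub>C real) \<Rightarrow> real \<Rightarrow> ereal" where
  "scale_pressure \<phi> e = limsup (\<lambda>n. ereal (1 / real n * ln (sep_sum \<phi> n e)))"

text \<open>The constant \<open>C\<close> is harmless after division by \<open>n\<close>; it will
  absorb the bounded lengthening of orbits in the comparison of scales.\<close>

lemma scale_pressure_le:
  assumes "\<forall>\<^sub>F n in sequentially. ln (sep_sum \<phi> n e) \<le> real n * c + C"
  shows "scale_pressure \<phi> e \<le> ereal c"
proof (rule ereal_le_epsilon2)
  fix d :: real assume "d > 0"
  obtain N :: nat where N: "\<bar>C\<bar> / d < real N" using reals_Archimedean2 by blast
  have "\<forall>\<^sub>F n in sequentially. ereal (1 / real n * ln (sep_sum \<phi> n e)) \<le> ereal (c + d)"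
    using assms eventually_ge_at_top[of "Suc N"]
  proof eventually_elim
    case (elim n)
    then have "\<bar>C\<bar> / d < real n" using N by simp
    then have "C < real n * d" using \<open>d > 0\<close> by (simp add: field_simps)
    then have "ln (sep_sum \<phi> n e) \<le> real n * (c + d)" using elim by (simp add: algebra_simps)
    then show ?case using elim by (simp add: field_simps)
  qed
  then show "scale_pressure \<phi> e \<le> ereal c + ereal d"
    unfolding scale_pressure_def by (auto intro: Limsup_bounded)
qed

lemma scale_pressure_finite:
  assumes "e > 0"
  shows "\<bar>scale_pressure \<phi> e\<bar> \<noteq> \<infinity>"
proof -
  obtain B where "\<And>n. n > 0 \<Longrightarrow> ln (sep_sum \<phi> n e) \<le> real n * B"
    using ln_sep_sum_upper[OF assms] by blast
  then have "\<forall>\<^sub>F n in sequentially. ln (sep_sum \<phi> n e) \<le> real n * B + 0"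
    by (intro eventually_sequentiallyI[of 1]) auto
  from scale_pressure_le[OF this] have up: "scale_pressure \<phi> e \<le> ereal B" .
  have "\<forall>\<^sub>F n in sequentially. ereal (- norm \<phi>) \<le> ereal (1 / real n * ln (sep_sum \<phi> n e))"
  proof (rule eventually_sequentiallyI[of 1])
    fix n :: nat assume "1 \<le> n"
    then show "ereal (- norm \<phi>) \<le> ereal (1 / real n * ln (sep_sum \<phi> n e))"
      using ln_sep_sum_lower[OF assms, of n \<phi>] by (simp add: field_simps)
  qed
  then have "ereal (- norm \<phi>) \<le> liminf (\<lambda>n. ereal (1 / real n * ln (sep_sum \<phi> n e)))"
    by (rule Liminf_bounded)
  also have "\<dots> \<le> scale_pressure \<phi> e"
    unfolding scale_pressure_def by (rule Liminf_le_Limsup) simp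
  finally show ?thesis using up by auto
qed

lemma scale_pressure_eventually:
  assumes "scale_pressure \<phi> e = ereal p" "d > 0"
  shows "\<forall>\<^sub>F n in sequentially. ln (sep_sum \<phi> n e) \<le> real n * (p + d)"
proof -
  have "limsup (\<lambda>n. ereal (1 / real n * ln (sep_sum \<phi> n e))) < ereal (p + d)"
    using assms unfolding scale_pressure_def by simp
  from Limsup_lessD[OF this] show ?thesis
    using eventually_gt_at_top[of 0]
    by eventually_elim (simp add: field_simps)
qed

lemma scale_pressure_frequently:
  assumes "scale_pressure \<phi> e = ereal p" "d > 0"
  shows "\<exists>n\<ge>N. real n * (p - d) \<le> ln (sep_sum \<phi> n e)"
proof (rule ccontr)
  assume "\<not> ?thesis"
  then have "ln (sep_sum \<phi> n e) \<le> real n * (p - d) + 0" if "n \<ge> N" for n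
    using that by (metis linear add_0_right)
  then have "\<forall>\<^sub>F n in sequentially. ln (sep_sum \<phi> n e) \<le> real n * (p - d) + 0"
    by (rule eventually_sequentiallyI)
  from scale_pressure_le[OF this] show False using assms by simp
qed

end

section \<open>Expansivity and the pressure at one fixed scale\<close>

text \<open>Counterexamples for every \<open>N\<close> would accumulate at a pair of points that all
  the \<open>S i\<close> keep within \<open>d\<close>, hence at equal points, although the distances
  stay above \<open>e\<close>. The family \<open>S\<close> is left general to serve one-sided and
  two-sided orbits alike.\<close>

lemma expansive_uniform:
  fixes T :: "'a::metric_space \<Rightarrow> 'a"
  assumes cpt: "compact (UNIV :: 'a set)"
    and cont: "\<And>i. continuous_on UNIV (S i :: 'a \<Rightarrow> 'a)"
    and exp: "\<And>x y. (\<And>i. dist (S i x) (S i y) \<le> d) \<Longrightarrow> x = y"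
    and "e > 0"
  shows "\<exists>N. \<forall>x y. (\<forall>i\<le>(N::nat). dist (S i x) (S i y) \<le> d) \<longrightarrow> dist x y \<le> e"
proof (rule ccontr)
  assume "\<not> ?thesis"
  then have "\<forall>N. \<exists>p. (\<forall>i\<le>N. dist (S i (fst p)) (S i (snd p)) \<le> d) \<and> dist (fst p) (snd p) > e"
    by (simp add: not_le)
  from choice[OF this] obtain p where *: "\<forall>N. (\<forall>i\<le>N. dist (S i (fst (p N))) (S i (snd (p N))) \<le> d) \<and>
    dist (fst (p N)) (snd (p N)) > e" ..
  have p: "dist (S i (fst (p N))) (S i (snd (p N))) \<le> d" if "i \<le> N" for N i
    using *[rule_format, of N] that by simp
  have p2: "dist (fst (p N)) (snd (p N)) > e" for N
    using *[rule_format, of N] by simp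
  have "compact (UNIV :: ('a \<times> 'a) set)" using compact_Times[OF cpt cpt] by simp
  then have "\<exists>l r. strict_mono r \<and> (p \<circ> r) \<longlonglongrightarrow> l"
    by (simp add: compact_eq_seq_compact_metric seq_compact_def)
  then obtain l and r :: "nat \<Rightarrow> nat" where r: "strict_mono r" "(p \<circ> r) \<longlonglongrightarrow> l" by blast
  have l1: "(\<lambda>n. fst (p (r n))) \<longlonglongrightarrow> fst l" and l2: "(\<lambda>n. snd (p (r n))) \<longlonglongrightarrow> snd l"
    using tendsto_fst[OF r(2)] tendsto_snd[OF r(2)] by (simp_all add: comp_def)
  have "dist (S i (fst l)) (S i (snd l)) \<le> d" for i
  proof (rule tendsto_upperbound)
    have c: "isCont (S i) x" for x using cont by (simp add: continuous_on_eq_continuous_at)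
    show "(\<lambda>n. dist (S i (fst (p (r n)))) (S i (snd (p (r n))))) \<longlonglongrightarrow> dist (S i (fst l)) (S i (snd l))"
      by (intro tendsto_dist isCont_tendsto_compose[OF c] l1 l2)
    show "\<forall>\<^sub>F n in sequentially. dist (S i (fst (p (r n)))) (S i (snd (p (r n)))) \<le> d"
    proof (rule eventually_sequentiallyI[of i])
      fix n assume "i \<le> n"
      then have "i \<le> r n" using seq_suble[OF r(1), of n] by simp
      then show "dist (S i (fst (p (r n)))) (S i (snd (p (r n)))) \<le> d" by (rule p)
    qed
  qed simp
  then have "fst l = snd l" by (rule exp)
  moreover have "e \<le> dist (fst l) (snd l)"
    by (rule tendsto_lowerbound[OF tendsto_dist[OF l1 l2]]) (simp_all add: p2 less_imp_le)
  ultimately show False using \<open>e > 0\<close> by simp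
qed

lemma continuous_on_funpow:
  assumes "continuous_on UNIV (T :: 'a::topological_space \<Rightarrow> 'a)"
  shows "continuous_on UNIV (T ^^ n)"
proof (induction n)
  case (Suc n)
  have "continuous_on UNIV (T \<circ> (T ^^ n))"
    by (intro continuous_on_compose Suc continuous_on_subset[OF assms] subset_UNIV)
  then show ?case by simp
qed (simp add: id_def)

text \<open>
  The shift by \<open>m\<close> places the controlled time in the middle of the window, as is necessary for
  two-sided expansivity; for one-sided expansivity \<open>m = 0\<close>.
\<close>

lemma expansive_window:
  fixes T :: "'a::metric_space \<Rightarrow> 'a"
  assumes cpt: "compact (UNIV :: 'a set)" and cont: "continuous_on UNIV T" and "expansive T"
  shows "\<exists>\<delta>>0. \<forall>e>0. \<exists>N m. surj (T ^^ m) \<and>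
    (\<forall>x y. (\<forall>k\<le>N. dist ((T ^^ k) x) ((T ^^ k) y) \<le> \<delta>) \<longrightarrow> dist ((T ^^ m) x) ((T ^^ m) y) \<le> e)"
proof -
  obtain \<delta> where *: "\<delta> > 0 \<and> ((\<forall>x y. (\<forall>n. dist ((T ^^ n) x) ((T ^^ n) y) \<le> \<delta>) \<longrightarrow> x = y) \<or>
     bij T \<and>
     (\<forall>x y. (\<forall>n. dist ((T ^^ n) x) ((T ^^ n) y) \<le> \<delta> \<and>
                 dist ((inv T ^^ n) x) ((inv T ^^ n) y) \<le> \<delta>) \<longrightarrow> x = y))"
    using \<open>expansive T\<close> unfolding expansive_def by (rule exE)
  note \<delta> = conjunct2[OF *]
  have contn: "continuous_on UNIV (T ^^ n)" for n using cont by (rule continuous_on_funpow)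
  have "\<exists>N m. surj (T ^^ m) \<and>
    (\<forall>x y. (\<forall>k\<le>N. dist ((T ^^ k) x) ((T ^^ k) y) \<le> \<delta>) \<longrightarrow> dist ((T ^^ m) x) ((T ^^ m) y) \<le> e)"
    if "e > 0" for e
    using \<delta>
  proof
    assume "\<forall>x y. (\<forall>n. dist ((T ^^ n) x) ((T ^^ n) y) \<le> \<delta>) \<longrightarrow> x = y"
    then have "\<exists>N. \<forall>x y. (\<forall>i\<le>N. dist ((T ^^ i) x) ((T ^^ i) y) \<le> \<delta>) \<longrightarrow> dist x y \<le> e"
      by (intro expansive_uniform[of "\<lambda>i. T ^^ i", OF cpt contn _ that]) simp
    then obtain N where "\<forall>x y. (\<forall>i\<le>N. dist ((T ^^ i) x) ((T ^^ i) y) \<le> \<delta>) \<longrightarrow> dist x y \<le> e" ..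
    then show ?thesis by (intro exI[of _ N] exI[of _ 0]) simp
  next
    assume two: "bij T \<and> (\<forall>x y. (\<forall>n. dist ((T ^^ n) x) ((T ^^ n) y) \<le> \<delta> \<and>
                 dist ((inv T ^^ n) x) ((inv T ^^ n) y) \<le> \<delta>) \<longrightarrow> x = y)"
    then have "bij T" by (rule conjunct1)
    have inv: "inv T (T x) = x" "T (inv T x) = x" for x
      using \<open>bij T\<close> by (simp_all add: bij_is_inj bij_is_surj surj_f_inv_f)
    have "continuous_on (T ` UNIV) (inv T)"
      by (rule continuous_on_inv[OF cont cpt]) (simp add: inv)
    then have contI: "continuous_on UNIV (inv T)" using \<open>bij T\<close> by (simp add: bij_is_surj)
    \<comment> \<open>Forward and backward iterates are interleaved, so that finitely many indices
      control a symmetric window of times.\<close>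
    define S where "S i = (if even i then T ^^ (i div 2) else inv T ^^ (i div 2))" for i :: nat
    have contS: "continuous_on UNIV (S i)" for i
      unfolding S_def using contn continuous_on_funpow[OF contI] by simp
    have "x = y" if *: "\<And>i. dist (S i x) (S i y) \<le> \<delta>" for x y
    proof -
      have "dist ((T ^^ n) x) ((T ^^ n) y) \<le> \<delta> \<and> dist ((inv T ^^ n) x) ((inv T ^^ n) y) \<le> \<delta>" for n
        using *[of "2 * n"] *[of "2 * n + 1"] by (simp add: S_def)
      then show ?thesis using conjunct2[OF two] by simp
    qed
    from expansive_uniform[of S, OF cpt contS this that] obtain N
      where N: "\<forall>x y. (\<forall>i\<le>N. dist (S i x) (S i y) \<le> \<delta>) \<longrightarrow> dist x y \<le> e" ..
    have surj: "surj (T ^^ m)" for m using \<open>bij T\<close> by (simp add: bij_is_surj surj_fn)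
    have invpow: "(inv T ^^ j) ((T ^^ i) x) = (T ^^ (i - j)) x" if "j \<le> i" for i j x
      using that
    proof (induction j)
      case (Suc j)
      then have "i - j = Suc (i - Suc j)" by simp
      then show ?case using Suc by (simp add: inv)
    qed simp
    have "dist ((T ^^ N) x) ((T ^^ N) y) \<le> e" if *: "\<forall>k\<le>2 * N. dist ((T ^^ k) x) ((T ^^ k) y) \<le> \<delta>" for x y
    proof (rule N[rule_format])
      fix i assume "i \<le> N"
      then have le: "i div 2 \<le> N" "i div 2 + N \<le> 2 * N" "N - i div 2 \<le> 2 * N" by linarith+
      have "S i ((T ^^ N) z) = (if even i then (T ^^ (i div 2 + N)) z else (T ^^ (N - i div 2)) z)" for z
        unfolding S_def using invpow[OF le(1)] by (simp add: funpow_add)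
      then show "dist (S i ((T ^^ N) x)) (S i ((T ^^ N) y)) \<le> \<delta>" using * le by simp
    qed
    with surj[of N] show ?thesis by (intro exI[of _ "2 * N"] exI[of _ N]) simp
  qed
  then show ?thesis using conjunct1[OF *] by (intro exI[of _ \<delta>]) simp
qed

text \<open>Replace each point by a preimage under \<open>T ^^ m\<close>. If two points are more
  than \<open>e\<close> apart at time \<open>k\<close>, then by contraposition of the window
  property their preimages are more than \<delta> apart at a time between \<open>k\<close> and
  \<open>k + N\<close>. The Birkhoff sums differ only by the first \<open>m\<close> and the last
  \<open>N\<close> terms.\<close>

lemma ln_sep_sum_window:
  fixes T :: "'a::metric_space \<Rightarrow> 'a"
  assumes cpt: "compact (UNIV :: 'a set)" and surj: "surj (T ^^ m)"
    and window: "\<forall>x y. (\<forall>k\<le>N. dist ((T ^^ k) x) ((T ^^ k) y) \<le> \<delta>) \<longrightarrow> dist ((T ^^ m) x) ((T ^^ m) y) \<le> e"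
    and pos: "n > 0" "e > 0" "\<delta> > 0"
  shows "ln (sep_sum T \<phi> n e) \<le> real (m + N) * norm \<phi> + ln (sep_sum T \<phi> (m + (n + N)) \<delta>)"
proof -
  define s where "s = inv (T ^^ m)"
  have s: "(T ^^ m) (s x) = x" for x unfolding s_def by (rule surj_f_inv_f[OF surj])
  have "sep_sum T \<phi> n e \<le> exp (real (m + N) * norm \<phi>) * sep_sum T \<phi> (m + (n + N)) \<delta>"
  proof (rule sep_sum_le[OF cpt pos(1)])
    fix E assume E: "separated T n e E"
    have sep: "separated T (m + (n + N)) \<delta> (s ` E)"
    proof -
      have "\<exists>k<m + (n + N). dist ((T ^^ k) (s x)) ((T ^^ k) (s y)) > \<delta>"
        if xy: "x \<in> E" "y \<in> E" "s x \<noteq> s y" for x y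
      proof -
        have "x \<noteq> y" using xy(3) by auto
        then obtain k where k: "k < n" "dist ((T ^^ k) x) ((T ^^ k) y) > e"
          using E[unfolded separated_iff[OF pos(1)]] xy by blast
        have shift: "(T ^^ k) z = (T ^^ m) ((T ^^ k) (s z))" for z
        proof -
          have "(T ^^ k) z = (T ^^ (k + m)) (s z)" by (simp add: funpow_add s)
          also have "\<dots> = (T ^^ (m + k)) (s z)" by (simp add: add.commute)
          finally show ?thesis by (simp add: funpow_add)
        qed
        have "\<not> (\<forall>j\<le>N. dist ((T ^^ j) ((T ^^ k) (s x))) ((T ^^ j) ((T ^^ k) (s y))) \<le> \<delta>)"
          using window[THEN spec, of "(T ^^ k) (s x)", THEN spec, of "(T ^^ k) (s y)"] k(2) shift[of x] shift[of y] by auto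
        then obtain j where "j \<le> N" "dist ((T ^^ (j + k)) (s x)) ((T ^^ (j + k)) (s y)) > \<delta>"
          by (auto simp: not_le funpow_add)
        then show ?thesis using k(1) by (intro exI[of _ "j + k"]) simp
      qed
      then show ?thesis using pos(1) by (subst separated_iff) auto
    qed
    have inj: "inj_on s E" unfolding s_def using surj by (intro inj_on_inv_into) simp
    have "exp_sum T \<phi> n E \<le> (\<Sum>x\<in>E. exp (real (m + N) * norm \<phi>) * exp (birkhoff_sum T (m + (n + N)) \<phi> (s x)))"
    proof (rule sum_mono)
      fix x
      have "birkhoff_sum T (m + (n + N)) \<phi> (s x) =
          birkhoff_sum T m \<phi> (s x) + (birkhoff_sum T n \<phi> x + birkhoff_sum T N \<phi> ((T ^^ n) x))"
        by (simp add: birkhoff_sum_add s)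
      then have "birkhoff_sum T n \<phi> x \<le> real (m + N) * norm \<phi> + birkhoff_sum T (m + (n + N)) \<phi> (s x)"
        using abs_birkhoff_sum_le[of T m \<phi> "s x"] abs_birkhoff_sum_le[of T N \<phi> "(T ^^ n) x"]
        by (simp add: algebra_simps)
      then show "exp (birkhoff_sum T n \<phi> x) \<le> exp (real (m + N) * norm \<phi>) * exp (birkhoff_sum T (m + (n + N)) \<phi> (s x))"
        by (simp add: exp_add[symmetric])
    qed
    also have "\<dots> = exp (real (m + N) * norm \<phi>) * exp_sum T \<phi> (m + (n + N)) (s ` E)"
      by (simp add: sum_distrib_left sum.reindex[OF inj])
    also have "\<dots> \<le> exp (real (m + N) * norm \<phi>) * sep_sum T \<phi> (m + (n + N)) \<delta>"
      by (intro mult_left_mono exp_sum_le_sep_sum[OF cpt pos(3) _ sep]) (use pos in simp_all)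
    finally show "exp_sum T \<phi> n E \<le> exp (real (m + N) * norm \<phi>) * sep_sum T \<phi> (m + (n + N)) \<delta>" .
  qed
  then have "ln (sep_sum T \<phi> n e) \<le> ln (exp (real (m + N) * norm \<phi>) * sep_sum T \<phi> (m + (n + N)) \<delta>)"
    using sep_sum_pos[OF cpt pos(2,1), of T \<phi>] by (subst ln_le_cancel_iff) linarith+
  also have "\<dots> = real (m + N) * norm \<phi> + ln (sep_sum T \<phi> (m + (n + N)) \<delta>)"
    using sep_sum_pos[OF cpt pos(3), of "m + (n + N)" T \<phi>] pos(1) by (simp add: ln_mult_pos)
  finally show ?thesis .
qed

text \<open>Both forms of expansivity enter the rest of the argument through the window property, at
  a scale \<delta> that is fixed once and for all.\<close>

locale expansive_dynamics =
  fixes T :: "'a::metric_space \<Rightarrow> 'a" and \<delta> :: real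
  assumes cpt: "compact (UNIV :: 'a set)" and cont: "continuous_on UNIV T" and \<delta>_pos: "\<delta> > 0"
    and window: "\<And>e. e > 0 \<Longrightarrow> \<exists>N m. surj (T ^^ m) \<and>
      (\<forall>x y. (\<forall>k\<le>N. dist ((T ^^ k) x) ((T ^^ k) y) \<le> \<delta>) \<longrightarrow> dist ((T ^^ m) x) ((T ^^ m) y) \<le> e)"
begin

lemma scale_pressure_le_window:
  assumes "e > 0"
  shows "scale_pressure T \<phi> e \<le> scale_pressure T \<phi> \<delta>"
proof -
  obtain p where p: "scale_pressure T \<phi> \<delta> = ereal p"
    using scale_pressure_finite[OF cpt \<delta>_pos, of T \<phi>] by auto
  obtain N m where Nm: "surj (T ^^ m)"
    "\<forall>x y. (\<forall>k\<le>N. dist ((T ^^ k) x) ((T ^^ k) y) \<le> \<delta>) \<longrightarrow> dist ((T ^^ m) x) ((T ^^ m) y) \<le> e"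
    using window[OF assms] by (elim exE conjE)
  show ?thesis
    unfolding p
  proof (rule ereal_le_epsilon2)
    fix d :: real assume "d > 0"
    have "\<forall>\<^sub>F n in sequentially. ln (sep_sum T \<phi> (n + (m + N)) \<delta>) \<le> real (n + (m + N)) * (p + d)"
      using scale_pressure_eventually[OF cpt p \<open>d > 0\<close>] by (subst eventually_sequentially_seg)
    then have "\<forall>\<^sub>F n in sequentially. ln (sep_sum T \<phi> n e) \<le> real n * (p + d) +
        (real (m + N) * norm \<phi> + real (m + N) * (p + d))"
      using eventually_gt_at_top[of 0]
    proof eventually_elim
      case (elim n)
      have "ln (sep_sum T \<phi> n e) \<le> real (m + N) * norm \<phi> + ln (sep_sum T \<phi> (m + (n + N)) \<delta>)"
        by (rule ln_sep_sum_window[OF cpt Nm(1) Nm(2) elim(2) assms \<delta>_pos])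
      also have "m + (n + N) = n + (m + N)" by simp
      finally show ?case using elim(1) by (simp add: algebra_simps)
    qed
    from scale_pressure_le[OF cpt this] show "scale_pressure T \<phi> e \<le> ereal p + ereal d" by simp
  qed
qed

lemma scale_pressure_eq:
  assumes "0 < e" "e \<le> \<delta>"
  shows "scale_pressure T \<phi> e = scale_pressure T \<phi> \<delta>"
proof (rule antisym)
  show "scale_pressure T \<phi> \<delta> \<le> scale_pressure T \<phi> e"
    unfolding scale_pressure_def[OF cpt]
  proof (rule Limsup_mono)
    show "\<forall>\<^sub>F n in sequentially. ereal (1 / real n * ln (sep_sum T \<phi> n \<delta>)) \<le> ereal (1 / real n * ln (sep_sum T \<phi> n e))"
      using eventually_gt_at_top[of 0]
    proof eventually_elim
      case (elim n)
      have "ln (sep_sum T \<phi> n \<delta>) \<le> ln (sep_sum T \<phi> n e)"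
        using sep_sum_antimono[OF cpt assms elim, of T \<phi>] sep_sum_pos[OF cpt \<delta>_pos elim, of T \<phi>]
        by (subst ln_le_cancel_iff) linarith+
      then show ?case by (simp add: divide_right_mono)
    qed
  qed
qed (rule scale_pressure_le_window[OF assms(1)])

abbreviation P :: "('a \<Rightarrow>\<^sub>C real) \<Rightarrow> real" where "P \<equiv> real_pressure T"

text \<open>The limsup does not depend on the scale below \<delta>, so the \<open>Lim\<close> in the
  definition is a genuine limit of an eventually constant function.\<close>

lemma pressure_eq_scale: "pressure T (apply_bcontfun \<phi>) = scale_pressure T \<phi> \<delta>"
proof -
  have "\<forall>\<^sub>F e in at_right 0. scale_pressure T \<phi> e = scale_pressure T \<phi> \<delta>"
    using \<delta>_pos by (intro eventually_at_rightI[of 0 \<delta>] scale_pressure_eq) auto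
  then have "((\<lambda>e. scale_pressure T \<phi> e) \<longlongrightarrow> scale_pressure T \<phi> \<delta>) (at_right 0)"
    by (rule tendsto_eventually)
  then have "Lim (at_right 0) (scale_pressure T \<phi>) = scale_pressure T \<phi> \<delta>"
    by (intro tendsto_Lim) (simp_all add: trivial_limit_at_right_real)
  then show ?thesis unfolding pressure_def scale_pressure_def[OF cpt] .
qed

lemma pressure_eq: "pressure T (apply_bcontfun \<phi>) = ereal (P \<phi>)"
  using scale_pressure_finite[OF cpt \<delta>_pos, of T \<phi>]
  by (simp add: real_pressure_def pressure_eq_scale ereal_real)

lemma ln_sep_sum_eventually_le:
  assumes "0 < e" "e \<le> \<delta>" "d > 0"
  shows "\<forall>\<^sub>F n in sequentially. ln (sep_sum T \<phi> n e) \<le> real n * (P \<phi> + d)"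
  using scale_pressure_eq[OF assms(1,2), of \<phi>]
  by (intro scale_pressure_eventually[OF cpt _ assms(3)]) (simp add: pressure_eq_scale[symmetric] pressure_eq)

lemma ln_sep_sum_frequently_ge:
  assumes "d > 0"
  shows "\<exists>n\<ge>N. real n * (P \<phi> - d) \<le> ln (sep_sum T \<phi> n \<delta>)"
  by (intro scale_pressure_frequently[OF cpt _ assms]) (simp add: pressure_eq_scale[symmetric] pressure_eq)

lemma pressure_lipschitz_le: "P \<phi> \<le> P \<psi> + norm (\<phi> - \<psi>)"
proof (rule field_le_epsilon)
  fix d :: real assume "d > 0"
  then have "d / 2 > 0" by simp
  obtain N where N: "\<And>n. n \<ge> N \<Longrightarrow> ln (sep_sum T \<psi> n \<delta>) \<le> real n * (P \<psi> + d / 2)"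
    using ln_sep_sum_eventually_le[OF \<delta>_pos order_refl \<open>d / 2 > 0\<close>, of \<psi>] unfolding eventually_sequentially by blast
  obtain n where n: "n \<ge> Suc N" "real n * (P \<phi> - d / 2) \<le> ln (sep_sum T \<phi> n \<delta>)"
    using ln_sep_sum_frequently_ge[OF \<open>d / 2 > 0\<close>, of "Suc N" \<phi>] by blast
  have "real n * (P \<phi> - d / 2) \<le> real n * norm (\<phi> - \<psi>) + real n * (P \<psi> + d / 2)"
    using ln_sep_sum_lipschitz[OF cpt \<delta>_pos, of n T \<phi> \<psi>] N[of n] n by simp
  then have "real n * (P \<phi> - d / 2) \<le> real n * (norm (\<phi> - \<psi>) + (P \<psi> + d / 2))"
    by (simp add: distrib_left)
  then have "P \<phi> - d / 2 \<le> norm (\<phi> - \<psi>) + (P \<psi> + d / 2)" using n(1) by simp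
  then show "P \<phi> \<le> P \<psi> + norm (\<phi> - \<psi>) + d" by simp
qed

end

section \<open>Inequalities for finite distributions and spanning separated sets\<close>

lemma simple_function_UNIV_iff:
  assumes "space M = UNIV"
  shows "simple_function M g \<longleftrightarrow> finite (range g) \<and> (\<forall>b. g -` {b} \<in> sets M)"
proof -
  have "g -` {b} = {}" if "b \<notin> range g" for b using that by auto
  then have "(\<forall>b\<in>range g. g -` {b} \<in> sets M) \<longleftrightarrow> (\<forall>b. g -` {b} \<in> sets M)"
    by (metis sets.empty_sets)
  then show ?thesis unfolding simple_function_def assms by simp
qed

lemma ent_mono:
  assumes "prob_space M" "simple_function M f" "\<And>x y. f x = f y \<Longrightarrow> g x = g y"
  shows "ent M g \<le> ent M f"
proof -
  have "g x = g (inv f (f x))" for x by (rule assms(3)) (simp add: f_inv_into_f)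
  then have "ent M g = ent M (\<lambda>x. (\<lambda>b. g (inv f b)) (f x))" by simp
  also have "\<dots> \<le> ent M f" by (rule ent_comp_le[OF assms(1,2)])
  finally show ?thesis .
qed

text \<open>Apply \<open>ln y \<le> y - 1\<close> to the ratio of the Gibbs weight
  \<open>exp (a e) / S\<close> to \<open>p e\<close> and sum. Equality holds for the Gibbs weights
  themselves, which is exploited in the construction of the empirical measures.\<close>

lemma gibbs_variational_ineq:
  fixes p a :: "'b \<Rightarrow> real"
  assumes "finite E" "E \<noteq> {}" "\<And>e. e \<in> E \<Longrightarrow> 0 \<le> p e" "(\<Sum>e\<in>E. p e) = 1"
  shows "- (\<Sum>e\<in>E. p e * ln (p e)) + (\<Sum>e\<in>E. p e * a e) \<le> ln (\<Sum>e\<in>E. exp (a e))"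
proof -
  define S where "S = (\<Sum>e\<in>E. exp (a e))"
  have S: "S > 0" unfolding S_def using assms by (intro sum_pos) auto
  have "(\<Sum>e\<in>E. p e * (a e - ln (p e) - ln S)) \<le> (\<Sum>e\<in>E. exp (a e) / S - p e)"
  proof (rule sum_mono)
    fix e assume "e \<in> E"
    show "p e * (a e - ln (p e) - ln S) \<le> exp (a e) / S - p e"
    proof (cases "p e = 0")
      case True then show ?thesis using S by simp
    next
      case False
      then have pe: "p e > 0" using assms(3)[OF \<open>e \<in> E\<close>] by simp
      have "a e - ln (p e) - ln S = ln (exp (a e) / (p e * S))"
        using pe S by (simp add: ln_divide_pos ln_mult_pos)
      also have "\<dots> \<le> exp (a e) / (p e * S) - 1"
        using pe S by (intro ln_le_minus_one) simp
      finally have "p e * (a e - ln (p e) - ln S) \<le> p e * (exp (a e) / (p e * S) - 1)"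
        using pe by (intro mult_left_mono) auto
      also have "\<dots> = exp (a e) / S - p e" using pe by (simp add: field_simps)
      finally show ?thesis .
    qed
  qed
  also have "\<dots> = S / S - 1"
    by (simp add: sum_subtractf assms(4) sum_divide_distrib[symmetric] S_def[symmetric])
  also have "\<dots> = 0" using S by simp
  finally have "(\<Sum>e\<in>E. p e * a e) - (\<Sum>e\<in>E. p e * ln (p e)) - ln S \<le> 0"
    by (simp add: algebra_simps sum.distrib sum_subtractf sum_distrib_left[symmetric] sum_distrib_right[symmetric] assms(4))
  then show ?thesis unfolding S_def by simp
qed

text \<open>A modulus of continuity at 0 for \<open>x * ln x\<close>, from
  \<open>ln y \<le> y - 1\<close> at \<open>y = 1 / sqrt x\<close>. It controls small atoms and weak
  limits of entropies.\<close>

lemma minus_x_ln_x_le_sqrt: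
  assumes "0 \<le> (x::real)"
  shows "- (x * ln x) \<le> 2 * sqrt x"
proof (cases "x = 0")
  case False
  then have x: "x > 0" using assms by simp
  have "- ln x = 2 * ln (1 / sqrt x)" using x by (simp add: ln_div ln_sqrt)
  also have "\<dots> \<le> 2 * (1 / sqrt x)" using ln_le_minus_one[of "1 / sqrt x"] x by simp
  finally have "x * - ln x \<le> x * (2 * (1 / sqrt x))" using x by (intro mult_left_mono) auto
  also have "x * (2 * (1 / sqrt x)) = 2 * (x / sqrt x)" by simp
  also have "x / sqrt x = sqrt x" using x by (intro real_div_sqrt) simp
  finally show ?thesis by simp
qed simp

text \<open>The counterpart near 1, for an atom of nearly full measure.\<close>

lemma minus_x_ln_x_le_compl:
  assumes "0 \<le> (x::real)" "x \<le> 1"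
  shows "- (x * ln x) \<le> 1 - x"
proof (cases "x = 0")
  case False
  then have x: "x > 0" using assms by simp
  have "- ln x = ln (1 / x)" using x by (simp add: ln_div)
  also have "\<dots> \<le> 1 / x - 1" using x by (intro ln_le_minus_one) simp
  finally have "x * - ln x \<le> x * (1 / x - 1)" using x by (intro mult_left_mono) auto
  then show ?thesis using x by (simp add: algebra_simps)
qed simp

text \<open>A separated set of maximal cardinality is also spanning, since a point far from all its
  members could be added. The uniform bound on cardinalities provides the maximum.\<close>

lemma maximal_separated:
  fixes T :: "'a::metric_space \<Rightarrow> 'a"
  assumes cpt: "compact (UNIV :: 'a set)" and "n > 0" "e > 0"
  shows "\<exists>E. finite E \<and> separated T n e E \<and> (\<forall>x. \<exists>y\<in>E. \<forall>k<n. dist ((T ^^ k) x) ((T ^^ k) y) \<le> e)"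
proof -
  obtain K where K: "\<forall>(T :: 'a \<Rightarrow> 'a) n E. n > 0 \<and> separated T n e E \<longrightarrow> finite E \<and> card E \<le> K ^ n"
    using separated_card_bound[OF cpt assms(3)] by (elim exE conjE)
  have bd: "finite E \<and> card E \<le> K ^ n" if "separated T n e E" for E
    using K[rule_format, of n T E] that assms(2) by simp
  have "separated T n e {}" by (simp add: separated_def)
  then have "\<exists>E. separated T n e E \<and> (\<forall>F. separated T n e F \<longrightarrow> card F \<le> card E)"
    by (rule ex_has_greatest_nat[of "separated T n e" "{}" card "Suc (K ^ n)"])
      (use bd in \<open>simp add: less_Suc_eq_le\<close>)
  then obtain E where E: "separated T n e E" "\<And>F. separated T n e F \<Longrightarrow> card F \<le> card E" by blast
  have "\<exists>y\<in>E. \<forall>k<n. dist ((T ^^ k) x) ((T ^^ k) y) \<le> e" for x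
  proof (rule ccontr)
    assume "\<not> ?thesis"
    then have far: "\<forall>y\<in>E. \<exists>k<n. dist ((T ^^ k) x) ((T ^^ k) y) > e" by (auto simp: not_le)
    have "separated T n e (insert x E)"
      using E(1) far unfolding separated_iff[OF assms(2)] by (auto simp: dist_commute)
    moreover have "x \<notin> E" using far \<open>e > 0\<close> by force
    ultimately show False using E(2)[of "insert x E"] bd[OF E(1)] by simp
  qed
  with E(1) bd[OF E(1)] show ?thesis by blast
qed

section \<open>Invariant measures\<close>

context
  fixes T :: "'a::metric_space \<Rightarrow> 'a" and \<mu> :: "'a measure"
  assumes cont: "continuous_on UNIV T" and inv: "\<mu> \<in> invariant_measures T"
begin

lemma invariant_prob: "prob_space \<mu>"
  and invariant_sets: "sets \<mu> = sets borel"
  and invariant_space: "space \<mu> = UNIV"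
proof -
  show "prob_space \<mu>" "sets \<mu> = sets borel" using inv by (auto simp: invariant_measures_def)
  then show "space \<mu> = UNIV" by (simp add: sets_eq_imp_space_eq)
qed

lemma measurable_funpow_borel: "T ^^ k \<in> borel_measurable borel"
  by (rule borel_measurable_continuous_onI[OF continuous_on_funpow[OF cont]])

lemma measurable_funpow_invariant: "T ^^ k \<in> measurable \<mu> borel"
  using measurable_funpow_borel by (simp add: measurable_cong_sets[OF invariant_sets refl])

lemma invariant_distr_funpow: "distr \<mu> borel (T ^^ k) = \<mu>"
proof (induction k)
  case 0
  show ?case using distr_id2[OF invariant_sets[symmetric]] by (simp add: id_def)
next
  case (Suc k)
  have "T \<in> borel_measurable borel" using measurable_funpow_borel[of 1] by simp
  then have "distr \<mu> borel (T \<circ> T ^^ k) = distr (distr \<mu> borel (T ^^ k)) borel T"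
    by (intro distr_distr[symmetric] measurable_funpow_invariant)
  also have "\<dots> = \<mu>" using inv by (simp add: Suc invariant_measures_def)
  finally show ?case by (simp only: funpow.simps)
qed

lemma invariant_measure_vimage:
  assumes "A \<in> sets borel"
  shows "measure \<mu> ((T ^^ k) -` A) = measure \<mu> A"
  using measure_distr[OF measurable_funpow_invariant assms, of k] invariant_distr_funpow[of k]
  by (simp add: invariant_space)

lemma sets_vimage_funpow: "A \<in> sets borel \<Longrightarrow> (T ^^ k) -` A \<in> sets borel"
  using measurable_sets[OF measurable_funpow_borel, of A k] by simp

lemma invariant_integral_funpow:
  assumes "f \<in> borel_measurable borel"
  shows "(\<integral>x. f ((T ^^ k) x) \<partial>\<mu>) = (\<integral>x. (f x :: real) \<partial>\<mu>)"
  using integral_distr[OF measurable_funpow_invariant assms, of k] by (simp add: invariant_distr_funpow)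

lemma simple_function_itinerary:
  assumes "simple_function \<mu> g"
  shows "simple_function \<mu> (itinerary T g n)"
proof -
  have g: "finite (range g)" "\<And>b. g -` {b} \<in> sets borel"
    using assms by (auto simp: simple_function_UNIV_iff[OF invariant_space] invariant_sets)
  have "itinerary T g n -` {b} \<in> sets borel" for b
  proof (cases "n = 0")
    case False
    then have ne: "{..<n} \<noteq> {}" by auto
    have "(\<Inter>k<n. (T ^^ k) -` (g -` {b ! k})) \<in> sets borel"
      by (rule sets.finite_INT[OF _ ne]) (simp_all only: finite_lessThan sets_vimage_funpow g)
    then show ?thesis by (simp add: itinerary_vimage)
  qed (simp add: itinerary_vimage)
  then show ?thesis
    using finite_range_itinerary[OF g(1)] by (simp add: simple_function_UNIV_iff[OF invariant_space] invariant_sets)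
qed

lemma simple_function_funpow:
  assumes "simple_function \<mu> f"
  shows "simple_function \<mu> (\<lambda>x. f ((T ^^ k) x))"
proof -
  have f: "finite (range f)" "\<And>b. f -` {b} \<in> sets borel"
    using assms by (auto simp: simple_function_UNIV_iff[OF invariant_space] invariant_sets)
  have "(\<lambda>x. f ((T ^^ k) x)) -` {b} = (T ^^ k) -` (f -` {b})" for b by auto
  moreover have "finite (range (\<lambda>x. f ((T ^^ k) x)))" by (rule finite_subset[OF _ f(1)]) auto
  ultimately show ?thesis
    using sets_vimage_funpow[OF f(2)] by (simp add: simple_function_UNIV_iff[OF invariant_space] invariant_sets)
qed

lemma ent_funpow:
  assumes "simple_function \<mu> f"
  shows "ent \<mu> (\<lambda>x. f ((T ^^ k) x)) = ent \<mu> f"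
proof (rule ent_transport)
  have f: "finite (range f)" "\<And>b. f -` {b} \<in> sets borel"
    using assms by (auto simp: simple_function_UNIV_iff[OF invariant_space] invariant_sets)
  show "finite (f ` space \<mu>)" using f by (simp add: invariant_space)
  show "finite ((\<lambda>x. f ((T ^^ k) x)) ` space \<mu>)"
    by (rule finite_subset[OF _ f(1)]) auto
  fix b
  have "(\<lambda>x. f ((T ^^ k) x)) -` {b} = (T ^^ k) -` (f -` {b})" by auto
  then show "measure \<mu> ((\<lambda>x. f ((T ^^ k) x)) -` {b} \<inter> space \<mu>) = measure \<mu> (f -` {b} \<inter> space \<mu>)"
    using invariant_measure_vimage[OF f(2)] by (simp add: invariant_space)
qed

lemma ent_itinerary_add:
  assumes "simple_function \<mu> g"
  shows "ent \<mu> (itinerary T g (m + n)) \<le> ent \<mu> (itinerary T g m) + ent \<mu> (itinerary T g n)"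
proof -
  note s = simple_function_itinerary[OF assms]
  have "ent \<mu> (itinerary T g (m + n)) \<le> ent \<mu> (\<lambda>x. (itinerary T g m x, itinerary T g n ((T ^^ m) x)))"
    by (rule ent_mono[OF invariant_prob simple_function_Pair[OF s simple_function_funpow[OF s]]])
      (simp add: itinerary_add)
  also have "\<dots> \<le> ent \<mu> (itinerary T g m) + ent \<mu> (\<lambda>x. itinerary T g n ((T ^^ m) x))"
    by (rule ent_pair_le[OF invariant_prob s simple_function_funpow[OF s]])
  finally show ?thesis by (simp add: ent_funpow[OF s])
qed

lemma ent_itinerary_le:
  assumes "simple_function \<mu> g"
  shows "ent \<mu> (itinerary T g n) \<le> real n * ent \<mu> g"
proof (induction n)
  case 0
  have "itinerary T g 0 = (\<lambda>_. [])" by (simp add: itinerary_def fun_eq_iff)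
  then show ?case
    using prob_space.prob_space[OF invariant_prob] by (simp add: ent_def invariant_space)
next
  case (Suc n)
  have "ent \<mu> (itinerary T g 1) \<le> ent \<mu> g"
    by (rule ent_mono[OF invariant_prob assms]) (simp add: itinerary_def)
  then show ?case using Suc ent_itinerary_add[OF assms, of n 1] by (simp add: algebra_simps)
qed

lemma simple_function_cell:
  assumes "finite_measurable_partition \<mu> \<P>"
  shows "simple_function \<mu> (cell \<P>)"
proof -
  have p: "finite \<P>" "\<P> \<subseteq> sets \<mu>" "partition_on UNIV \<P>"
    using assms by (auto simp: finite_measurable_partition_def invariant_space)
  have "cell \<P> -` {b} \<in> sets \<mu>" for b
  proof (cases "b \<in> \<P>")
    case True
    then show ?thesis using cell_vimage[OF p(3) True] p(2) by auto
  next
    case False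
    then have "cell \<P> -` {b} = {}" using cell_mem(1)[OF p(3)] by auto
    then show ?thesis by simp
  qed
  then show ?thesis
    using p by (simp add: simple_function_UNIV_iff[OF invariant_space] range_cell)
qed

text \<open>Invariance makes the entropy of itineraries subadditive in the length, so the
  \<open>lim\<close> in the definition is a genuine limit and also a lower bound for every
  quotient.\<close>

lemma entropy_wrt_partition_tendsto:
  assumes "finite_measurable_partition \<mu> \<P>"
  shows "(\<lambda>n. ent \<mu> (itinerary T (cell \<P>) n) / real n) \<longlonglongrightarrow> entropy_wrt_partition T \<mu> \<P>"
    and "n > 0 \<Longrightarrow> entropy_wrt_partition T \<mu> \<P> \<le> ent \<mu> (itinerary T (cell \<P>) n) / real n"
proof -
  obtain L where L: "(\<lambda>n. ent \<mu> (itinerary T (cell \<P>) n) / real n) \<longlonglongrightarrow> L"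
    "\<And>n. n > 0 \<Longrightarrow> L \<le> ent \<mu> (itinerary T (cell \<P>) n) / real n"
    by (rule fekete[of "\<lambda>n. ent \<mu> (itinerary T (cell \<P>) n)"])
      (auto intro: ent_nonneg[OF invariant_prob] ent_itinerary_add simple_function_cell assms)
  have p: "partition_on UNIV \<P>" using assms by (simp add: finite_measurable_partition_def invariant_space)
  have "entropy_wrt_partition T \<mu> \<P> = L"
    unfolding entropy_wrt_partition_def partition_entropy_dynamical_join[OF p invariant_space]
    using L(1) by (intro limI) simp
  with L show "(\<lambda>n. ent \<mu> (itinerary T (cell \<P>) n) / real n) \<longlonglongrightarrow> entropy_wrt_partition T \<mu> \<P>"
    and "n > 0 \<Longrightarrow> entropy_wrt_partition T \<mu> \<P> \<le> ent \<mu> (itinerary T (cell \<P>) n) / real n"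
    by simp_all
qed

end

text \<open>Gibbs' inequality for the distribution of \<open>\<xi>\<close> on the finite set
  \<open>E\<close>, with energies \<open>F\<close>; the constant \<open>c\<close> pays for
  evaluating \<open>f\<close> at the representative instead of the point.\<close>

lemma ent_plus_integral_le:
  fixes F :: "'b \<Rightarrow> real"
  assumes M: "prob_space M" "space M = UNIV" and \<xi>: "simple_function M \<xi>" "range \<xi> \<subseteq> E" "finite E"
    and f: "integrable M f" "\<And>x. f x \<le> F (\<xi> x) + c"
  shows "ent M \<xi> + (\<integral>x. f x \<partial>M) \<le> ln (\<Sum>e\<in>E. exp (F e)) + c"
proof -
  interpret prob_space M by fact
  have ms: "\<xi> -` {e} \<in> sets M" for e using \<xi>(1) by (simp add: simple_function_UNIV_iff[OF M(2)])
  have part: "(\<Sum>e\<in>E. indicator (\<xi> -` {e}) x * h e) = h (\<xi> x)" for h :: "'b \<Rightarrow> real" and x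
  proof -
    have "(\<Sum>e\<in>E. indicator (\<xi> -` {e}) x * h e) = (\<Sum>e\<in>E. if e = \<xi> x then h e else 0)"
      by (intro sum.cong) (auto simp: indicator_def)
    also have "\<dots> = h (\<xi> x)" using \<xi> by (subst sum.delta) auto
    finally show ?thesis .
  qed
  have intg: "integrable M (\<lambda>x. \<Sum>e\<in>E. indicator (\<xi> -` {e}) x * h e)" for h :: "'b \<Rightarrow> real"
    using ms by (intro Bochner_Integration.integrable_sum integrable_mult_left)
      (simp add: integrable_indicator_iff less_top[symmetric])
  have val: "(\<integral>x. (\<Sum>e\<in>E. indicator (\<xi> -` {e}) x * h e) \<partial>M) = (\<Sum>e\<in>E. prob (\<xi> -` {e}) * h e)" for h :: "'b \<Rightarrow> real"
    using ms by (subst Bochner_Integration.integral_sum)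
      (simp_all add: integrable_mult_left integrable_indicator_iff less_top[symmetric] M(2))
  have "(\<integral>x. f x \<partial>M) \<le> (\<integral>x. F (\<xi> x) + c \<partial>M)"
    using intg[of F] unfolding part by (intro integral_mono f) simp_all
  also have "\<dots> = (\<Sum>e\<in>E. prob (\<xi> -` {e}) * F e) + c"
    using intg[of F] val[of F] unfolding part by (simp add: prob_space)
  finally have 1: "(\<integral>x. f x \<partial>M) \<le> (\<Sum>e\<in>E. prob (\<xi> -` {e}) * F e) + c" .
  have "E \<noteq> {}" using \<xi>(2) by auto
  have "(\<Sum>e\<in>E. prob (\<xi> -` {e})) = 1"
    using val[of "\<lambda>_. 1"] unfolding part[of _ "\<lambda>_. 1"] by (simp add: prob_space)
  from gibbs_variational_ineq[OF \<xi>(3) \<open>E \<noteq> {}\<close> _ this, of F]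
  have "- (\<Sum>e\<in>E. prob (\<xi> -` {e}) * ln (prob (\<xi> -` {e}))) + (\<Sum>e\<in>E. prob (\<xi> -` {e}) * F e)
    \<le> ln (\<Sum>e\<in>E. exp (F e))" by simp
  with 1 show ?thesis
    using ent_eq_sum[OF \<xi>(3), of \<xi> M] \<xi>(2) by (simp add: M(2))
qed

text \<open>The atom \<open>None\<close> contributes at most the total mass of the other atoms. Each
  of the others, of mass \<open>m\<close>, thus accounts for at most \<open>m + 2 * sqrt m\<close>,
  which is at most \<open>3 * sqrt \<eta>\<close>.\<close>

lemma ent_le_of_small_atoms:
  assumes M: "prob_space M" "space M = UNIV" and \<gamma>: "simple_function M \<gamma>" "range \<gamma> \<subseteq> insert None (Some ` A)"
    and A: "finite A" and small: "\<And>a. a \<in> A \<Longrightarrow> measure M (\<gamma> -` {Some a}) \<le> \<eta>" and \<eta>: "0 \<le> \<eta>" "\<eta> \<le> 1"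
  shows "ent M \<gamma> \<le> real (card A) * (3 * sqrt \<eta>)"
proof -
  interpret prob_space M by fact
  have ms: "\<gamma> -` {e} \<in> sets M" for e using \<gamma>(1) by (simp add: simple_function_UNIV_iff[OF M(2)])
  define m where "m b = prob (\<gamma> -` {b})" for b
  have fin: "finite (insert None (Some ` A))" using A by simp
  have "ent M \<gamma> = - (\<Sum>b\<in>insert None (Some ` A). m b * ln (m b))"
    using ent_eq_sum[OF fin, of \<gamma> M] \<gamma>(2) by (simp add: M(2) m_def)
  also have "\<dots> = - (m None * ln (m None)) + (\<Sum>a\<in>A. - (m (Some a) * ln (m (Some a))))"
    using A by (simp add: sum.reindex sum_negf)
  also have "- (m None * ln (m None)) \<le> (\<Sum>a\<in>A. m (Some a))"
  proof -
    have "- (m None * ln (m None)) \<le> 1 - m None"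
      by (rule minus_x_ln_x_le_compl) (simp_all add: m_def)
    also have "1 - m None = prob (UNIV - \<gamma> -` {None})"
      using prob_compl[OF ms[of None]] by (simp add: M(2) m_def)
    also have "UNIV - \<gamma> -` {None} = (\<Union>a\<in>A. \<gamma> -` {Some a})" using \<gamma>(2) by auto
    also have "prob \<dots> \<le> (\<Sum>a\<in>A. prob (\<gamma> -` {Some a}))"
      using ms by (intro finite_measure_subadditive_finite A) auto
    finally show ?thesis by (simp add: m_def)
  qed
  also have "(\<Sum>a\<in>A. m (Some a)) + (\<Sum>a\<in>A. - (m (Some a) * ln (m (Some a)))) \<le> (\<Sum>a\<in>A. 3 * sqrt \<eta>)"
    unfolding sum.distrib[symmetric]
  proof (rule sum_mono)
    fix a assume "a \<in> A"
    then have le: "m (Some a) \<le> \<eta>" "0 \<le> m (Some a)" using small by (simp_all add: m_def)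
    have "- (m (Some a) * ln (m (Some a))) \<le> 2 * sqrt (m (Some a))"
      by (rule minus_x_ln_x_le_sqrt[OF le(2)])
    moreover have "sqrt (m (Some a)) \<le> sqrt \<eta>" using le by simp
    moreover have "\<eta> \<le> sqrt \<eta>" using \<eta> by (intro real_le_rsqrt) (simp add: power2_eq_square mult_left_le)
    ultimately show "m (Some a) + - (m (Some a) * ln (m (Some a))) \<le> 3 * sqrt \<eta>" using le by linarith
  qed
  finally show ?thesis by simp
qed

lemma finite_disjoint_compact_separated:
  fixes B :: "'b \<Rightarrow> 'a::metric_space set"
  assumes "finite I" "\<And>i. i \<in> I \<Longrightarrow> compact (B i)" "\<And>i j. i \<in> I \<Longrightarrow> j \<in> I \<Longrightarrow> i \<noteq> j \<Longrightarrow> B i \<inter> B j = {}"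
  shows "\<exists>r>0. \<forall>i\<in>I. \<forall>j\<in>I. \<forall>x\<in>B i. \<forall>y\<in>B j. dist x y < r \<longrightarrow> i = j"
proof -
  have "\<exists>d>0. i = j \<or> (\<forall>x\<in>B i. \<forall>y\<in>B j. d \<le> dist x y)" if "i \<in> I" "j \<in> I" for i j
  proof (cases "i = j")
    case True
    then show ?thesis by (intro exI[of _ 1]) simp
  next
    case False
    show ?thesis
    proof (cases "B i \<times> B j = {}")
      case True
      then show ?thesis by (intro exI[of _ 1]) auto
    next
      case ne: False
      have "compact (B i \<times> B j)" using assms(2) that by (intro compact_Times) auto
      then have "\<exists>p\<in>B i \<times> B j. \<forall>q\<in>B i \<times> B j. dist (fst p) (snd p) \<le> dist (fst q) (snd q)"
        using ne by (intro continuous_attains_inf continuous_intros)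
      then obtain p where p: "p \<in> B i \<times> B j"
        "\<forall>q\<in>B i \<times> B j. dist (fst p) (snd p) \<le> dist (fst q) (snd q)" ..
      have "fst p \<noteq> snd p" using p(1) assms(3)[OF that False] by auto
      then show ?thesis using p(2) by (intro exI[of _ "dist (fst p) (snd p)"]) auto
    qed
  qed
  then have "\<exists>d>0. p \<in> I \<times> I \<longrightarrow> fst p = snd p \<or> (\<forall>x\<in>B (fst p). \<forall>y\<in>B (snd p). d \<le> dist x y)" for p
    by (cases "p \<in> I \<times> I") (auto simp: mem_Times_iff intro: exI[of _ "1::real"])
  then have "\<forall>p. \<exists>d>0. p \<in> I \<times> I \<longrightarrow> fst p = snd p \<or> (\<forall>x\<in>B (fst p). \<forall>y\<in>B (snd p). d \<le> dist x y)"
    by (rule allI)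
  from choice[OF this] obtain d :: "'b \<times> 'b \<Rightarrow> real" where d: "\<forall>p. d p > 0 \<and>
    (p \<in> I \<times> I \<longrightarrow> fst p = snd p \<or> (\<forall>x\<in>B (fst p). \<forall>y\<in>B (snd p). d p \<le> dist x y))" ..
  \<comment> \<open>The added 1 keeps the minimum meaningful when \<open>I\<close> is empty.\<close>
  define r where "r = Min (insert 1 (d ` (I \<times> I)))"
  have fin: "finite (insert 1 (d ` (I \<times> I)))" using assms(1) by simp
  have "r > 0" unfolding r_def using d fin by (subst Min_gr_iff) auto
  moreover have "i = j" if "i \<in> I" "j \<in> I" "x \<in> B i" "y \<in> B j" "dist x y < r" for i j x y
  proof -
    have "r \<le> d (i, j)" unfolding r_def using that fin by (intro Min_le) auto
    then show ?thesis using d[rule_format, of "(i, j)"] that by fastforce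
  qed
  ultimately show ?thesis by blast
qed

section \<open>The upper half of the variational principle\<close>

lemma birkhoff_sum_measurable:
  fixes f :: "'a::metric_space \<Rightarrow>\<^sub>C real"
  assumes "continuous_on UNIV T"
  shows "birkhoff_sum T n f \<in> borel_measurable borel"
proof -
  have "continuous_on UNIV (\<lambda>x. f ((T ^^ k) x))" for k
    by (intro continuous_on_compose2[OF _ continuous_on_funpow[OF assms]] continuous_on_apply_bcontfun) auto
  then have "continuous_on UNIV (birkhoff_sum T n f)"
    unfolding birkhoff_sum_def by (intro continuous_on_sum)
  then show ?thesis by (rule borel_measurable_continuous_onI)
qed

lemma bcontfun_measurable: "apply_bcontfun (f :: 'a::metric_space \<Rightarrow>\<^sub>C real) \<in> borel_measurable borel"
  by (rule borel_measurable_continuous_onI[OF continuous_on_apply_bcontfun])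

lemma integrable_bounded_borel:
  assumes "prob_space M" "sets M = sets borel" "f \<in> borel_measurable borel" "\<And>x. \<bar>f x\<bar> \<le> (B::real)"
  shows "integrable M f"
proof -
  interpret prob_space M by fact
  show ?thesis
    using assms by (intro integrable_const_bound[of _ B]) (auto simp: measurable_cong_sets[OF assms(2) refl])
qed

lemma invariant_integral_birkhoff_sum:
  fixes T :: "'a::metric_space \<Rightarrow> 'a" and f :: "'a \<Rightarrow>\<^sub>C real"
  assumes cont: "continuous_on UNIV T" and inv: "\<mu> \<in> invariant_measures T"
  shows "integrable \<mu> (birkhoff_sum T n f)" "(\<integral>x. birkhoff_sum T n f x \<partial>\<mu>) = real n * (\<integral>x. f x \<partial>\<mu>)"
proof -
  note pr = invariant_prob[OF cont inv] and se = invariant_sets[OF cont inv]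
  show "integrable \<mu> (birkhoff_sum T n f)"
    by (rule integrable_bounded_borel[OF pr se birkhoff_sum_measurable[OF cont] abs_birkhoff_sum_le])
  have "integrable \<mu> (\<lambda>x. f ((T ^^ k) x))" for k
    by (rule integrable_bounded_borel[OF pr se _ bcontfun_abs_le])
      (rule measurable_compose[OF measurable_funpow_borel[OF cont inv] bcontfun_measurable])
  then show "(\<integral>x. birkhoff_sum T n f x \<partial>\<mu>) = real n * (\<integral>x. f x \<partial>\<mu>)"
    unfolding birkhoff_sum_def
    by (subst Bochner_Integration.integral_sum)
      (simp_all add: invariant_integral_funpow[OF cont inv bcontfun_measurable])
qed

text \<open>By regularity each cell has a closed core \<open>B A\<close> that misses little mass.
  The labelling forgets the cell of points in a core and records it elsewhere, so it has small
  entropy. Which core a point lies in will be recovered from metric proximity, as disjoint compact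
  cores keep a positive distance.\<close>

lemma closed_approx_partition:
  fixes \<mu> :: "'a::metric_space measure"
  assumes \<mu>: "prob_space \<mu>" "sets \<mu> = sets borel" and fin: "finite_measurable_partition \<mu> \<P>" and "d > 0"
  shows "\<exists>B. (\<forall>A\<in>\<P>. closed (B A) \<and> B A \<subseteq> A) \<and>
    simple_function \<mu> (\<lambda>x. if x \<in> B (cell \<P> x) then None else Some (cell \<P> x)) \<and>
    ent \<mu> (\<lambda>x. if x \<in> B (cell \<P> x) then None else Some (cell \<P> x)) \<le> d"
proof -
  have sp: "space \<mu> = UNIV" using \<mu>(2) by (simp add: sets_eq_imp_space_eq)
  have P: "finite \<P>" "\<P> \<subseteq> sets borel" "partition_on UNIV \<P>"
    using fin by (auto simp: finite_measurable_partition_def sp \<mu>(2))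
  \<comment> \<open>Chosen so that the bound \<open>card \<P> * 3 * sqrt \<eta>\<close> for small
    atoms stays below \<open>d\<close>; the summand 1 keeps \<open>c\<close> positive.\<close>
  define c where "c = 3 * real (card \<P>) + 1"
  define \<eta> where "\<eta> = min 1 ((d / c)\<^sup>2)"
  have "c > 0" by (simp add: c_def add_nonneg_pos)
  have \<eta>: "0 < \<eta>" "\<eta> \<le> 1" using \<open>d > 0\<close> \<open>c > 0\<close> by (auto simp: \<eta>_def)
  have "\<forall>A\<in>\<P>. \<exists>C. closed C \<and> C \<subseteq> A \<and> measure \<mu> (A - C) \<le> \<eta>"
  proof
    fix A assume "A \<in> \<P>"
    then have "A \<in> sets borel" using P(2) by (rule subsetD[rotated])
    from closed_open_regular[OF \<mu> this \<eta>(1)]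
    obtain C U where CU: "closed C \<and> open U \<and> C \<subseteq> A \<and> A \<subseteq> U \<and> measure \<mu> (U - C) < \<eta>"
      by (elim exE)
    have "measure \<mu> (A - C) \<le> measure \<mu> (U - C)"
      using CU by (intro finite_measure.finite_measure_mono prob_space.finite_measure \<mu>(1)) (auto simp: \<mu>(2))
    with CU show "\<exists>C. closed C \<and> C \<subseteq> A \<and> measure \<mu> (A - C) \<le> \<eta>" by (intro exI[of _ C]) simp
  qed
  from bchoice[OF this] obtain B where B: "\<forall>A\<in>\<P>. closed (B A) \<and> B A \<subseteq> A \<and> measure \<mu> (A - B A) \<le> \<eta>" ..
  define \<gamma> where "\<gamma> x = (if x \<in> B (cell \<P> x) then None else Some (cell \<P> x))" for x
  note cm = cell_mem[OF P(3)]
  have None: "\<gamma> -` {None} = (\<Union>A\<in>\<P>. B A)"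
  proof (intro set_eqI iffI)
    fix x assume "x \<in> \<gamma> -` {None}"
    then have "x \<in> B (cell \<P> x)" by (simp add: \<gamma>_def split: if_splits)
    then show "x \<in> (\<Union>A\<in>\<P>. B A)" by (rule UN_I[OF cm(1)])
  next
    fix x assume "x \<in> (\<Union>A\<in>\<P>. B A)"
    then obtain A where A: "A \<in> \<P>" "x \<in> B A" by blast
    then have "cell \<P> x = A" using B cell_eqI[OF P(3) A(1)] by auto
    then show "x \<in> \<gamma> -` {None}" using A by (simp add: \<gamma>_def)
  qed
  have Some: "\<gamma> -` {Some A} = A - B A" if "A \<in> \<P>" for A
  proof -
    have c: "cell \<P> x = A \<longleftrightarrow> x \<in> A" for x
      using cell_vimage[OF P(3) that] by (metis vimage_singleton_eq)
    have "\<gamma> x = Some A \<longleftrightarrow> x \<in> A - B A" for x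
      using c[of x] by (cases "cell \<P> x = A") (simp_all add: \<gamma>_def)
    then show ?thesis by (intro set_eqI) (simp add: vimage_singleton_eq)
  qed
  have range: "range \<gamma> \<subseteq> insert None (Some ` \<P>)" by (rule image_subsetI) (simp add: \<gamma>_def cm(1))
  have meas: "\<gamma> -` {b} \<in> sets \<mu>" for b
  proof (cases "b \<in> insert None (Some ` \<P>)")
    case False
    then have "b \<notin> range \<gamma>" using range by (rule contra_subsetD[rotated])
    then have "\<gamma> -` {b} = {}" by (simp add: vimage_def image_iff eq_commute)
    then show ?thesis by simp
  next
    case True
    then show ?thesis
    proof
      assume "b = None"
      then show ?thesis
        unfolding \<mu>(2) \<open>b = None\<close> None by (intro sets.finite_UN P(1) borel_closed) (simp add: B)
    next
      assume "b \<in> Some ` \<P>"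
      then obtain A where A: "A \<in> \<P>" "b = Some A" by blast
      have "A \<in> sets borel" using P(2) A(1) by (rule subsetD)
      moreover have "B A \<in> sets borel" using B A(1) by (simp add: borel_closed)
      ultimately show ?thesis unfolding \<mu>(2) A(2) Some[OF A(1)] by (rule sets.Diff)
    qed
  qed
  have fr: "finite (range \<gamma>)" by (rule finite_subset[OF range]) (simp add: P(1))
  have simple: "simple_function \<mu> \<gamma>" using fr meas by (simp add: simple_function_UNIV_iff[OF sp])
  have "ent \<mu> \<gamma> \<le> real (card \<P>) * (3 * sqrt \<eta>)"
    by (rule ent_le_of_small_atoms[OF \<mu>(1) sp simple range P(1)]) (use B \<eta> in \<open>simp_all add: Some\<close>)
  also have "sqrt \<eta> \<le> sqrt ((d / c)\<^sup>2)" by (subst real_sqrt_le_iff) (simp add: \<eta>_def)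
  then have "real (card \<P>) * (3 * sqrt \<eta>) \<le> real (card \<P>) * (3 * (d / c))"
    using \<open>d > 0\<close> \<open>c > 0\<close> by (intro mult_left_mono) (auto simp: real_sqrt_abs)
  also have "\<dots> = (3 * real (card \<P>) / c) * d" by simp
  also have "\<dots> \<le> 1 * d" using \<open>d > 0\<close> \<open>c > 0\<close> by (intro mult_right_mono) (auto simp: c_def)
  finally have "ent \<mu> \<gamma> \<le> d" by simp
  with B simple show ?thesis
    unfolding \<gamma>_def by (intro exI[of _ B]) simp
qed

text \<open>The representative is any admissible point of \<open>E\<close>, not necessarily the
  nearest. It is a function of the finite set \<open>S x\<close> of admissible points, and the
  fibres of \<open>S\<close> are finite intersections of closed and open sets; this makes the choice
  measurable.\<close>

lemma nearest_point_labelling: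
  fixes T :: "'a::metric_space \<Rightarrow> 'a"
  assumes cont: "continuous_on UNIV T" and \<mu>: "sets \<mu> = sets borel"
    and E: "finite E" "\<forall>x. \<exists>y\<in>E. \<forall>k<n. dist ((T ^^ k) x) ((T ^^ k) y) \<le> e"
  shows "\<exists>\<xi>. simple_function \<mu> \<xi> \<and> range \<xi> \<subseteq> E \<and> (\<forall>x. \<forall>k<n. dist ((T ^^ k) x) ((T ^^ k) (\<xi> x)) \<le> e)"
proof -
  have sp: "space \<mu> = UNIV" using \<mu> by (simp add: sets_eq_imp_space_eq)
  define C where "C y = {x. \<forall>k<n. dist ((T ^^ k) x) ((T ^^ k) y) \<le> e}" for y
  define S where "S x = {y \<in> E. x \<in> C y}" for x
  define \<xi> where "\<xi> x = (SOME y. y \<in> S x)" for x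
  have "closed (C y)" for y
  proof -
    have "C y = (\<Inter>k\<in>{..<n}. {x. dist ((T ^^ k) x) ((T ^^ k) y) \<le> e})" by (auto simp: C_def)
    also have "closed \<dots>"
      by (intro closed_INT ballI closed_Collect_le continuous_intros continuous_on_funpow[OF cont])
    finally show ?thesis .
  qed
  then have C: "C y \<in> sets borel" "- C y \<in> sets borel" for y
    by (simp_all add: borel_closed borel_open open_Compl)
  have "E \<noteq> {}" using E(2) by auto
  have "S -` {F} \<in> sets borel" for F
  proof (cases "F \<subseteq> E")
    case True
    have "S x = F \<longleftrightarrow> (\<forall>y\<in>E. x \<in> (if y \<in> F then C y else - C y))" for x
      using True unfolding S_def by auto
    then have "S -` {F} = (\<Inter>y\<in>E. if y \<in> F then C y else - C y)"
      by (intro set_eqI) (simp only: vimage_singleton_eq INT_iff)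
    also have "\<dots> \<in> sets borel" using C \<open>E \<noteq> {}\<close> E(1) by (intro sets.finite_INT) auto
    finally show ?thesis .
  next
    case False
    then have "S -` {F} = {}" by (auto simp: S_def)
    then show ?thesis by simp
  qed
  moreover have "finite (range S)"
    by (rule finite_subset[of _ "Pow E"]) (auto simp: S_def E)
  ultimately have "simple_function \<mu> S" by (simp add: simple_function_UNIV_iff[OF sp] \<mu>)
  then have "simple_function \<mu> ((\<lambda>s. SOME y. y \<in> s) \<circ> S)" by (rule simple_function_compose)
  then have "simple_function \<mu> \<xi>" by (simp add: \<xi>_def[abs_def] comp_def)
  moreover have \<xi>S: "\<xi> x \<in> S x" for x
  proof -
    have "\<exists>y. y \<in> S x" using E(2)[THEN spec, of x] by (auto simp: S_def C_def)
    then show ?thesis unfolding \<xi>_def by (rule someI_ex)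
  qed
  then have "range \<xi> \<subseteq> E" by (auto simp: S_def)
  moreover have "dist ((T ^^ k) x) ((T ^^ k) (\<xi> x)) \<le> e" if "k < n" for x k
    using \<xi>S[of x] that by (simp add: S_def C_def)
  ultimately show ?thesis by (intro exI[of _ \<xi>]) simp
qed

text \<open>The itinerary through \<P> is determined by the representative \<open>\<xi>\<close> in a
  maximal separated set together with the itinerary of the small labelling \<open>\<gamma>\<close>.
  The former is bounded by the separated sum through Gibbs' inequality, the latter by
  \<open>n * d\<close>.\<close>

lemma (in expansive_dynamics) entropy_plus_integral_le:
  assumes inv: "\<mu> \<in> invariant_measures T" and fin: "finite_measurable_partition \<mu> \<P>"
  shows "entropy_wrt_partition T \<mu> \<P> + (\<integral>x. apply_bcontfun \<phi> x \<partial>\<mu>) \<le> P \<phi>"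
proof (rule field_le_epsilon)
  fix d' :: real assume "d' > 0"
  \<comment> \<open>Three losses: the entropy of \<open>\<gamma>\<close>, the oscillation of \<phi>
    at scale \<open>e\<close>, and the excess of the separated sum over the pressure.\<close>
  define d where "d = d' / 3"
  have "d > 0" using \<open>d' > 0\<close> by (simp add: d_def)
  note pr = invariant_prob[OF cont inv] and se = invariant_sets[OF cont inv] and sp = invariant_space[OF cont inv]
  have fP: "finite \<P>" and part: "partition_on UNIV \<P>"
    using fin by (auto simp: finite_measurable_partition_def sp)
  obtain B where B': "\<forall>A\<in>\<P>. closed (B A) \<and> B A \<subseteq> A"
    and sg: "simple_function \<mu> (\<lambda>x. if x \<in> B (cell \<P> x) then None else Some (cell \<P> x))"
    and eg: "ent \<mu> (\<lambda>x. if x \<in> B (cell \<P> x) then None else Some (cell \<P> x)) \<le> d"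
    using closed_approx_partition[OF pr se fin \<open>d > 0\<close>] by (elim exE conjE)
  have B: "closed (B A)" "B A \<subseteq> A" if "A \<in> \<P>" for A using B' that by simp_all
  define \<gamma> where "\<gamma> x = (if x \<in> B (cell \<P> x) then None else Some (cell \<P> x))" for x
  have \<gamma>: "simple_function \<mu> \<gamma>" "ent \<mu> \<gamma> \<le> d" using sg eg by (simp_all add: \<gamma>_def[abs_def])
  have "compact (B A)" if "A \<in> \<P>" for A
    using compact_Int_closed[OF cpt B(1)[OF that]] by simp
  moreover have "B A \<inter> B A' = {}" if "A \<in> \<P>" "A' \<in> \<P>" "A \<noteq> A'" for A A'
  proof -
    have "A \<inter> A' = {}" using partition_onD2[OF part] that unfolding disjoint_def by simp
    then show ?thesis using B(2)[OF that(1)] B(2)[OF that(2)] by auto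
  qed
  ultimately have "\<exists>r>0. \<forall>A\<in>\<P>. \<forall>A'\<in>\<P>. \<forall>x\<in>B A. \<forall>y\<in>B A'. dist x y < r \<longrightarrow> A = A'"
    by (rule finite_disjoint_compact_separated[OF fP])
  then obtain r where r: "r > 0" "\<forall>A\<in>\<P>. \<forall>A'\<in>\<P>. \<forall>x\<in>B A. \<forall>y\<in>B A'. dist x y < r \<longrightarrow> A = A'" by (elim exE conjE)
  have "uniformly_continuous_on UNIV (apply_bcontfun \<phi>)"
    by (rule compact_uniformly_continuous[OF continuous_on_apply_bcontfun cpt])
  then have "\<exists>u>0. \<forall>x y. dist y x < u \<longrightarrow> dist (\<phi> y) (\<phi> x) < d"
    unfolding uniformly_continuous_on_def using \<open>d > 0\<close> by simp
  then obtain u where u: "u > 0" "\<forall>x y. dist y x < u \<longrightarrow> dist (\<phi> y) (\<phi> x) < d" by (elim exE conjE)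
  \<comment> \<open>At most \<delta> so that the scale sees the same pressure,
    \<open>2 * e < r\<close> so that points with a common representative cannot lie in two different
    cores, and \<open>e < u\<close> for the continuity of \<phi>.\<close>
  define e where "e = min \<delta> (min (r / 3) (u / 2))"
  have e: "0 < e" "e \<le> \<delta>" "2 * e < r" "e < u" using \<delta>_pos r u by (auto simp: e_def)
  obtain N where N: "\<forall>n\<ge>N. ln (sep_sum T \<phi> n e) \<le> real n * (P \<phi> + d)"
    using ln_sep_sum_eventually_le[OF e(1,2) \<open>d > 0\<close>, of \<phi>] unfolding eventually_sequentially ..
  define n where "n = Suc N"
  have n: "n > 0" "ln (sep_sum T \<phi> n e) \<le> real n * (P \<phi> + d)"
    using N[rule_format, of n] by (simp_all add: n_def del: of_nat_Suc)
  obtain E where "finite E \<and> separated T n e E \<and> (\<forall>x. \<exists>y\<in>E. \<forall>k<n. dist ((T ^^ k) x) ((T ^^ k) y) \<le> e)"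
    using maximal_separated[OF cpt n(1) e(1)] ..
  then have E: "finite E" "separated T n e E" "\<forall>x. \<exists>y\<in>E. \<forall>k<n. dist ((T ^^ k) x) ((T ^^ k) y) \<le> e" by simp_all
  obtain \<xi> where \<xi>: "simple_function \<mu> \<xi>" "range \<xi> \<subseteq> E"
    and \<xi>d': "\<forall>x. \<forall>k<n. dist ((T ^^ k) x) ((T ^^ k) (\<xi> x)) \<le> e"
    using nearest_point_labelling[OF cont se E(1,3)] by (elim exE conjE)
  have \<xi>d: "dist ((T ^^ k) x) ((T ^^ k) (\<xi> x)) \<le> e" if "k < n" for x k using \<xi>d' that by simp
  have "E \<noteq> {}" using E(3) by auto
  have 1: "ent \<mu> \<xi> + real n * (\<integral>x. \<phi> x \<partial>\<mu>) \<le> ln (exp_sum T \<phi> n E) + real n * d"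
  proof -
    have "birkhoff_sum T n \<phi> x \<le> birkhoff_sum T n \<phi> (\<xi> x) + real n * d" for x
    proof -
      have "birkhoff_sum T n \<phi> x - birkhoff_sum T n \<phi> (\<xi> x) = (\<Sum>k<n. \<phi> ((T ^^ k) x) - \<phi> ((T ^^ k) (\<xi> x)))"
        by (simp add: birkhoff_sum_def sum_subtractf)
      also have "\<dots> \<le> (\<Sum>k<n. d)"
      proof (rule sum_mono)
        fix k assume "k \<in> {..<n}"
        then have "dist ((T ^^ k) x) ((T ^^ k) (\<xi> x)) < u" using \<xi>d[of k x] e(4) by simp
        then have "dist (\<phi> ((T ^^ k) x)) (\<phi> ((T ^^ k) (\<xi> x))) < d" using u(2) by simp
        then show "\<phi> ((T ^^ k) x) - \<phi> ((T ^^ k) (\<xi> x)) \<le> d" by (simp add: dist_real_def)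
      qed
      finally show ?thesis by simp
    qed
    from ent_plus_integral_le[OF pr sp \<xi> E(1) invariant_integral_birkhoff_sum(1)[OF cont inv] this]
    show ?thesis by (simp add: invariant_integral_birkhoff_sum(2)[OF cont inv])
  qed
  have 2: "ent \<mu> (itinerary T (cell \<P>) n) \<le> ent \<mu> \<xi> + real n * d"
  proof -
    note si = simple_function_itinerary[OF cont inv \<gamma>(1)]
    have "ent \<mu> (itinerary T (cell \<P>) n) \<le> ent \<mu> (\<lambda>x. (\<xi> x, itinerary T \<gamma> n x))"
    proof (rule ent_mono[OF pr simple_function_Pair[OF \<xi>(1) si]])
      fix x y assume xy: "(\<xi> x, itinerary T \<gamma> n x) = (\<xi> y, itinerary T \<gamma> n y)"
      have "cell \<P> ((T ^^ k) x) = cell \<P> ((T ^^ k) y)" if "k < n" for k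
      proof -
        have "itinerary T \<gamma> n x = itinerary T \<gamma> n y" using xy by simp
        from arg_cong[OF this, of "\<lambda>b. b ! k"] that
        have eq: "\<gamma> ((T ^^ k) x) = \<gamma> ((T ^^ k) y)" by simp
        have "dist ((T ^^ k) x) ((T ^^ k) y) < r"
          using \<xi>d[OF that, of x] \<xi>d[OF that, of y] xy e(3)
            dist_triangle2[of "(T ^^ k) x" "(T ^^ k) y" "(T ^^ k) (\<xi> x)"] by simp
        moreover have "cell \<P> ((T ^^ k) x) \<in> \<P>" "cell \<P> ((T ^^ k) y) \<in> \<P>"
          by (rule cell_mem(1)[OF part])+
        ultimately show ?thesis
          \<comment> \<open>Either both points lie in cores, which coincide since the points are
            closer than \<open>r\<close>, or \<open>\<gamma>\<close> records the common
            cell.\<close>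
          using eq r(2) unfolding \<gamma>_def by (simp split: if_split_asm) blast
      qed
      then show "itinerary T (cell \<P>) n x = itinerary T (cell \<P>) n y"
        by (intro nth_equalityI) auto
    qed
    also have "\<dots> \<le> ent \<mu> \<xi> + ent \<mu> (itinerary T \<gamma> n)" by (rule ent_pair_le[OF pr \<xi>(1) si])
    also have "ent \<mu> (itinerary T \<gamma> n) \<le> real n * ent \<mu> \<gamma>" by (rule ent_itinerary_le[OF cont inv \<gamma>(1)])
    also have "\<dots> \<le> real n * d" using \<gamma>(2) by (intro mult_left_mono) auto
    finally show ?thesis by simp
  qed
  have 3: "ln (exp_sum T \<phi> n E) \<le> ln (sep_sum T \<phi> n e)"
  proof -
    have "0 < exp_sum T \<phi> n E" using E(1) \<open>E \<noteq> {}\<close> by (intro sum_pos) auto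
    then show ?thesis using exp_sum_le_sep_sum[OF cpt e(1) n(1) E(2), of \<phi>] by (subst ln_le_cancel_iff) linarith+
  qed
  have "entropy_wrt_partition T \<mu> \<P> \<le> ent \<mu> (itinerary T (cell \<P>) n) / real n"
    by (rule entropy_wrt_partition_tendsto(2)[OF cont inv fin n(1)])
  then have "real n * entropy_wrt_partition T \<mu> \<P> \<le> ent \<mu> (itinerary T (cell \<P>) n)"
    using n(1) by (simp add: field_simps)
  then have "real n * (entropy_wrt_partition T \<mu> \<P> + (\<integral>x. \<phi> x \<partial>\<mu>)) \<le> real n * (P \<phi> + 3 * d)"
    using 1 2 3 n(2) by (simp add: algebra_simps)
  then have "entropy_wrt_partition T \<mu> \<P> + (\<integral>x. \<phi> x \<partial>\<mu>) \<le> P \<phi> + 3 * d"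
    using n(1) by simp
  then show "entropy_wrt_partition T \<mu> \<P> + (\<integral>x. \<phi> x \<partial>\<mu>) \<le> P \<phi> + d'" by (simp add: d_def)
qed

section \<open>Empirical measures on separated sets\<close>

lemma simple_function_measure_pmf: "finite (range f) \<Longrightarrow> simple_function (measure_pmf p) f"
  by (simp add: simple_function_def)

lemma finite_range_funpow: "finite (range g) \<Longrightarrow> finite (range (\<lambda>x. g ((T ^^ k) x)))"
  by (rule finite_subset[of _ "range g"]) auto

text \<open>The cut into blocks of length \<open>q\<close> is averaged over its offset \<open>j < q\<close>.\<close>

lemma ent_itinerary_blocks:
  fixes \<sigma> :: "'a pmf" and T :: "'a \<Rightarrow> 'a"
  assumes g: "finite (range g)" and "q > 0"
  shows "real q * ent (measure_pmf \<sigma>) (itinerary T g n) \<le>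
    (\<Sum>i<n. ent (measure_pmf \<sigma>) (\<lambda>x. itinerary T g q ((T ^^ i) x))) + 2 * real q * real q * ln (real (card (range g)))"
proof -
  define c where "c = ln (real (card (range g)))"
  define h where "h s l = ent (measure_pmf \<sigma>) (\<lambda>x. itinerary T g l ((T ^^ s) x))" for s l
  have pr: "prob_space (measure_pmf \<sigma>)" by (rule prob_space_measure_pmf)
  have sf: "simple_function (measure_pmf \<sigma>) (\<lambda>x. itinerary T g l ((T ^^ s) x))" for s l
    by (intro simple_function_measure_pmf finite_range_funpow finite_range_itinerary g)
  have h_add: "h s (l + l') \<le> h s l + h (s + l) l'" for s l l'
  proof -
    have "(T ^^ (s + l)) x = (T ^^ l) ((T ^^ s) x)" for x by (simp add: add.commute[of s l] funpow_add)
    then have "h s (l + l') \<le> ent (measure_pmf \<sigma>) (\<lambda>x. (itinerary T g l ((T ^^ s) x), itinerary T g l' ((T ^^ (s + l)) x)))"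
      unfolding h_def by (intro ent_mono[OF pr simple_function_Pair[OF sf sf]]) (simp add: itinerary_add)
    also have "\<dots> \<le> h s l + h (s + l) l'" unfolding h_def by (rule ent_pair_le[OF pr sf sf])
    finally show ?thesis .
  qed
  have "card (range g) > 0" using g by (simp add: card_gt_0_iff)
  then have "c \<ge> 0" unfolding c_def by simp
  have h_le: "h s l \<le> real l * c" for s l
  proof -
    let ?R = "(\<lambda>x. itinerary T g l ((T ^^ s) x)) ` space (measure_pmf \<sigma>)"
    have fin: "finite (range (itinerary T g l))" by (rule finite_range_itinerary[OF g])
    have "?R \<subseteq> range (itinerary T g l)" by auto
    then have "card ?R \<le> card (range (itinerary T g l))" by (rule card_mono[OF fin])
    also have "\<dots> \<le> card (range g) ^ l" by (rule card_range_itinerary_le[OF g])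
    finally have le: "real (card ?R) \<le> real (card (range g)) ^ l" by (simp flip: of_nat_power)
    have "?R \<noteq> {}" by simp
    moreover have "finite ?R" by (rule finite_subset[OF _ fin]) auto
    ultimately have pos: "0 < real (card ?R)" by (simp add: card_gt_0_iff)
    have "h s l \<le> ln (real (card ?R))" unfolding h_def by (rule ent_le_ln_card[OF pr sf])
    also have "\<dots> \<le> ln (real (card (range g)) ^ l)" using le pos by (subst ln_le_cancel_iff) linarith+
    also have "\<dots> = real l * c" using \<open>card (range g) > 0\<close> by (simp add: ln_realpow c_def)
    finally show ?thesis .
  qed
  have h_mult: "h s (m * q) \<le> (\<Sum>r<m. h (s + r * q) q)" for s m
  proof (induction m)
    case 0
    show ?case using h_le[of s 0] by simp
  next
    case (Suc m)
    have "h s (Suc m * q) \<le> h s (m * q) + h (s + m * q) q"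
      using h_add[of s "m * q" q] by (simp add: add.commute)
    then show ?case using Suc by simp
  qed
  \<comment> \<open>Cut off a head of length \<open>j\<close> and a remainder shorter than
    \<open>q\<close>; each costs at most \<open>q * c\<close>, whence the term
    \<open>2 * real q * c\<close>.\<close>
  have offset: "h 0 n \<le> 2 * real q * c + (\<Sum>r<(n - j) div q. h (j + r * q) q)" if "j < q" for j
  proof (cases "j \<le> n")
    case True
    define m where "m = (n - j) div q"
    define l where "l = (n - j) mod q"
    have n: "n = j + (m * q + l)" using True by (simp add: m_def l_def)
    have "l < q" using \<open>q > 0\<close> by (simp add: l_def)
    have "h 0 n \<le> h 0 j + (h j (m * q) + h (j + m * q) l)"
      unfolding n using h_add[of 0 j "m * q + l"] h_add[of j "m * q" l] by simp
    moreover have "h 0 j \<le> real q * c"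
      using h_le[of 0 j] mult_right_mono[of "real j" "real q" c] that \<open>c \<ge> 0\<close> by simp
    moreover have "h (j + m * q) l \<le> real q * c"
      using h_le[of "j + m * q" l] mult_right_mono[of "real l" "real q" c] \<open>l < q\<close> \<open>c \<ge> 0\<close> by simp
    ultimately show ?thesis using h_mult[of j m] unfolding m_def by simp
  next
    case False
    then have "h 0 n \<le> real q * c"
      using h_le[of 0 n] mult_right_mono[of "real n" "real q" c] that \<open>c \<ge> 0\<close> by simp
    moreover have "real q * c \<ge> 0" using \<open>c \<ge> 0\<close> by simp
    ultimately show ?thesis using False by simp
  qed
  have "real q * h 0 n = (\<Sum>j<q. h 0 n)" by simp
  also have "\<dots> \<le> (\<Sum>j<q. 2 * real q * c + (\<Sum>r<(n - j) div q. h (j + r * q) q))"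
    by (intro sum_mono offset) simp
  also have "\<dots> = 2 * real q * real q * c + (\<Sum>j<q. \<Sum>r<(n - j) div q. h (j + r * q) q)"
    by (simp add: sum.distrib)
  also have "(\<Sum>j<q. \<Sum>r<(n - j) div q. h (j + r * q) q) \<le> (\<Sum>i<n. h i q)"
  proof -
    \<comment> \<open>Over all offsets the full blocks start at the times \<open>j + r * q\<close>.
      Division with remainder recovers \<open>j\<close> and \<open>r\<close>, so each starting time
      below \<open>n\<close> is counted at most once.\<close>
    let ?S = "SIGMA j:{..<q}. {..<(n - j) div q}"
    have inj: "inj_on (\<lambda>(j, r). j + r * q) ?S"
    proof (rule inj_onI)
      fix z z' assume z: "z \<in> ?S" "z' \<in> ?S" "(\<lambda>(j, r). j + r * q) z = (\<lambda>(j, r). j + r * q) z'"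
      obtain j r j' r' where zz: "z = (j, r)" "z' = (j', r')" by (cases z, cases z')
      have "j < q" "j' < q" and eq: "j + r * q = j' + r' * q" using z by (simp_all add: zz)
      have "j = j'" using arg_cong[OF eq, of "\<lambda>i. i mod q"] \<open>j < q\<close> \<open>j' < q\<close> by simp
      moreover have "r = r'" using arg_cong[OF eq, of "\<lambda>i. i div q"] \<open>j < q\<close> \<open>j' < q\<close> by simp
      ultimately show "z = z'" by (simp add: zz)
    qed
    have "(\<lambda>(j, r). j + r * q) ` ?S \<subseteq> {..<n}"
    proof (rule image_subsetI)
      fix z assume z: "z \<in> ?S"
      obtain j r where zz: "z = (j, r)" by (cases z)
      have "r < (n - j) div q" using z by (simp add: zz)
      then have "Suc r * q \<le> (n - j) div q * q" by (intro mult_right_mono) auto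
      also have "\<dots> \<le> n - j" by (rule div_times_less_eq_dividend)
      finally show "(\<lambda>(j, r). j + r * q) z \<in> {..<n}" using \<open>q > 0\<close> by (simp add: zz)
    qed
    then have "(\<Sum>i\<in>(\<lambda>(j, r). j + r * q) ` ?S. h i q) \<le> (\<Sum>i<n. h i q)"
      by (intro sum_mono2) (auto simp: h_def ent_nonneg[OF pr])
    moreover have "(\<Sum>i\<in>(\<lambda>(j, r). j + r * q) ` ?S. h i q) = (\<Sum>z\<in>?S. h ((\<lambda>(j, r). j + r * q) z) q)"
      by (simp only: sum.reindex[OF inj] comp_def)
    moreover have "\<dots> = (\<Sum>j<q. \<Sum>r<(n - j) div q. h (j + r * q) q)"
      by (simp add: sum.Sigma split_beta)
    ultimately show ?thesis by simp
  qed
  finally show ?thesis by (simp add: h_def c_def)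
qed

text \<open>Jensen's inequality for the concave function \<open>- x * ln x\<close>, by its tangent
  at the mean; the case of mean 0 forces all \<open>p i = 0\<close>.\<close>

lemma entropy_function_jensen:
  fixes p :: "'i \<Rightarrow> real"
  assumes "finite I" "I \<noteq> {}" "\<And>i. i \<in> I \<Longrightarrow> 0 \<le> p i" and m: "m = (\<Sum>i\<in>I. p i) / card I"
  shows "(\<Sum>i\<in>I. - (p i * ln (p i))) \<le> card I * (- (m * ln m))"
proof -
  have card: "real (card I) > 0" using assms(1,2) by (simp add: card_gt_0_iff)
  have s: "(\<Sum>i\<in>I. p i) = card I * m" using card by (simp add: m)
  show ?thesis
  proof (cases "m = 0")
    case True
    then have "(\<Sum>i\<in>I. p i) = 0" using s by simp
    then have "\<forall>i\<in>I. p i = 0" using sum_nonneg_eq_0_iff[OF assms(1), of p] assms(3) by simp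
    then show ?thesis using True by simp
  next
    case False
    have "0 \<le> m" unfolding m by (intro divide_nonneg_nonneg sum_nonneg assms(3)) simp_all
    with False have "m > 0" by simp
    have "(\<Sum>i\<in>I. - (p i * ln (p i))) \<le> (\<Sum>i\<in>I. - (p i * ln m) + (m - p i))"
    proof (rule sum_mono)
      fix i assume "i \<in> I"
      show "- (p i * ln (p i)) \<le> - (p i * ln m) + (m - p i)"
      proof (cases "p i = 0")
        case True then show ?thesis using \<open>m > 0\<close> by simp
      next
        case False
        then have pi: "p i > 0" using assms(3)[OF \<open>i \<in> I\<close>] by simp
        have "ln m - ln (p i) = ln (m / p i)" using pi \<open>m > 0\<close> by (simp add: ln_div)
        also have "\<dots> \<le> m / p i - 1" using pi \<open>m > 0\<close> by (intro ln_le_minus_one) simp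
        finally have "p i * (ln m - ln (p i)) \<le> p i * (m / p i - 1)" using pi by (intro mult_left_mono) auto
        also have "\<dots> = m - p i" using pi by (simp add: field_simps)
        finally show ?thesis by (simp add: algebra_simps)
      qed
    qed
    also have "\<dots> = - ((\<Sum>i\<in>I. p i) * ln m) + (card I * m - (\<Sum>i\<in>I. p i))"
      by (simp only: sum.distrib sum_subtractf sum_negf sum_distrib_right[symmetric] sum_constant)
    also have "\<dots> = card I * (- (m * ln m))" by (simp add: s)
    finally show ?thesis .
  qed
qed

text \<open>This is the empirical measure of Misiurewicz's construction, the mean of the first
  \<open>n\<close> push-forwards of \<open>\<sigma>\<close>. As the law of a random orbit point it
  stays a \<open>pmf\<close>.\<close>

definition orbit_average :: "('a \<Rightarrow> 'a) \<Rightarrow> nat \<Rightarrow> 'a pmf \<Rightarrow> 'a pmf" where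
  "orbit_average T n \<sigma> = map_pmf (\<lambda>(i, x). (T ^^ i) x) (pair_pmf (pmf_of_set {..<n}) \<sigma>)"

lemma integral_orbit_average:
  fixes f :: "'a \<Rightarrow> real"
  assumes "n > 0" "finite (set_pmf \<sigma>)"
  shows "(\<integral>x. f x \<partial>measure_pmf (orbit_average T n \<sigma>)) = (\<Sum>i<n. \<integral>x. f ((T ^^ i) x) \<partial>measure_pmf \<sigma>) / real n"
proof -
  have ne: "{..<n} \<noteq> {}" using assms(1) by auto
  have "(\<integral>x. f x \<partial>measure_pmf (orbit_average T n \<sigma>)) =
      (\<integral>z. f ((T ^^ fst z) (snd z)) \<partial>pair_pmf (pmf_of_set {..<n}) \<sigma>)"
    by (simp add: orbit_average_def split_beta)
  also have "\<dots> = (\<Sum>z\<in>{..<n} \<times> set_pmf \<sigma>. f ((T ^^ fst z) (snd z)) * pmf (pair_pmf (pmf_of_set {..<n}) \<sigma>) z)"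
    by (rule integral_measure_pmf_real) (use ne assms(2) in \<open>simp_all add: set_pair_pmf\<close>)
  also have "\<dots> = (\<Sum>z\<in>{..<n} \<times> set_pmf \<sigma>. f ((T ^^ fst z) (snd z)) * (pmf \<sigma> (snd z) / real n))"
  proof -
    have "pmf (pmf_of_set {..<n}) i = 1 / real n" if "i < n" for i
      using that by (subst pmf_of_set[OF ne]) simp_all
    then show ?thesis by (intro sum.cong) (auto simp: pmf_pair)
  qed
  also have "\<dots> = (\<Sum>i<n. \<Sum>x\<in>set_pmf \<sigma>. f ((T ^^ i) x) * (pmf \<sigma> x / real n))"
    by (subst sum.cartesian_product) (rule sum.cong, auto)
  also have "\<dots> = (\<Sum>i<n. (\<Sum>x\<in>set_pmf \<sigma>. f ((T ^^ i) x) * pmf \<sigma> x)) / real n"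
    by (simp add: sum_divide_distrib)
  also have "\<dots> = (\<Sum>i<n. \<integral>x. f ((T ^^ i) x) \<partial>measure_pmf \<sigma>) / real n"
  proof -
    have "(\<integral>x. f ((T ^^ i) x) \<partial>measure_pmf \<sigma>) = (\<Sum>x\<in>set_pmf \<sigma>. f ((T ^^ i) x) * pmf \<sigma> x)" for i
      by (rule integral_measure_pmf_real[OF assms(2)])
    then show ?thesis by simp
  qed
  finally show ?thesis .
qed

lemma measure_orbit_average:
  assumes "n > 0" "finite (set_pmf \<sigma>)"
  shows "measure (measure_pmf (orbit_average T n \<sigma>)) A = (\<Sum>i<n. measure (measure_pmf \<sigma>) ((T ^^ i) -` A)) / real n"
proof -
  have ind: "indicator A ((T ^^ i) x) = (indicator ((T ^^ i) -` A) x :: real)" for i x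
    by (simp add: indicator_def)
  show ?thesis
    using integral_orbit_average[OF assms, of T "indicator A"] unfolding ind by simp
qed

text \<open>Concavity of the entropy in the measure: the average over \<open>i\<close> is applied to
  the mass of each fibre separately.\<close>

lemma ent_orbit_average:
  assumes "n > 0" "finite (set_pmf \<sigma>)" "finite (range f)"
  shows "(\<Sum>i<n. ent (measure_pmf \<sigma>) (\<lambda>x. f ((T ^^ i) x))) \<le> real n * ent (measure_pmf (orbit_average T n \<sigma>)) f"
proof -
  have ne: "{..<n} \<noteq> {}" using assms(1) by auto
  define p where "p b i = measure (measure_pmf \<sigma>) ((T ^^ i) -` (f -` {b}))" for b i
  define m where "m b = measure (measure_pmf (orbit_average T n \<sigma>)) (f -` {b})" for b
  have m: "m b = (\<Sum>i\<in>{..<n}. p b i) / card {..<n}" for b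
    by (simp add: m_def p_def measure_orbit_average[OF assms(1,2)])
  have e1: "ent (measure_pmf \<sigma>) (\<lambda>x. f ((T ^^ i) x)) = (\<Sum>b\<in>range f. - (p b i * ln (p b i)))" for i
  proof -
    have "(\<lambda>x. f ((T ^^ i) x)) -` {b} = (T ^^ i) -` (f -` {b})" for b by auto
    then show ?thesis
      using ent_eq_sum[OF assms(3), of "\<lambda>x. f ((T ^^ i) x)" "measure_pmf \<sigma>"]
      by (simp add: p_def sum_negf image_subset_iff)
  qed
  have e2: "ent (measure_pmf (orbit_average T n \<sigma>)) f = (\<Sum>b\<in>range f. - (m b * ln (m b)))"
    by (simp add: ent_def m_def sum_negf)
  have "(\<Sum>i<n. ent (measure_pmf \<sigma>) (\<lambda>x. f ((T ^^ i) x))) = (\<Sum>b\<in>range f. \<Sum>i<n. - (p b i * ln (p b i)))"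
    unfolding e1 by (rule sum.swap)
  also have "\<dots> \<le> (\<Sum>b\<in>range f. real (card {..<n}) * (- (m b * ln (m b))))"
    by (intro sum_mono entropy_function_jensen[OF _ ne _ m]) (simp_all add: p_def)
  also have "\<dots> = real n * ent (measure_pmf (orbit_average T n \<sigma>)) f"
    by (simp add: e2 sum_distrib_left)
  finally show ?thesis .
qed

lemma ex_pmf_of_weights:
  fixes w :: "'a \<Rightarrow> real"
  assumes "finite E" "\<And>x. x \<in> E \<Longrightarrow> 0 \<le> w x" "(\<Sum>x\<in>E. w x) = 1"
  shows "\<exists>\<sigma> :: 'a pmf. set_pmf \<sigma> \<subseteq> E \<and> (\<forall>x\<in>E. pmf \<sigma> x = w x)"
proof -
  define f where "f x = (if x \<in> E then w x else 0)" for x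
  have nn: "0 \<le> f x" for x using assms(2) by (simp add: f_def)
  have "(\<integral>\<^sup>+x. ennreal (f x) \<partial>count_space UNIV) = (\<Sum>x\<in>E. ennreal (f x))"
    using assms(1) by (intro nn_integral_count_space') (simp_all add: f_def)
  also have "\<dots> = ennreal (\<Sum>x\<in>E. f x)" using nn by (rule sum_ennreal)
  also have "(\<Sum>x\<in>E. f x) = 1" using assms(3) by (simp add: f_def)
  finally have one: "(\<integral>\<^sup>+x. ennreal (f x) \<partial>count_space UNIV) = 1" by simp
  have f_eq: "f x = (if x \<in> E then w x else 0)" for x by (simp add: f_def)
  show ?thesis
    by (intro exI[of _ "embed_pmf f"])
      (auto simp: pmf_embed_pmf[OF nn one] set_embed_pmf[OF nn one] f_eq split: if_splits)
qed

text \<open>Put Gibbs weights of \<phi> on \<open>E\<close> and average along orbits. The three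
  conclusions are a lower bound for entropy plus energy, a comparison with every other potential,
  and almost invariance. The labelling \<open>g\<close> is quantified inside, since
  \<open>\<rho>\<close> must not depend on it; it takes values in \<open>'a set\<close> because it
  will be \<open>cell\<close> of a partition.\<close>

lemma misiurewicz_measure:
  fixes T :: "'a::metric_space \<Rightarrow> 'a" and \<phi> :: "'a \<Rightarrow>\<^sub>C real"
  assumes E: "finite E" "E \<noteq> {}" "separated T n e E" and "n > 0"
  shows "\<exists>\<rho> :: 'a pmf.
    (\<forall>(g :: 'a \<Rightarrow> 'a set) q. finite (range g) \<and> (\<forall>x y. g x = g y \<longrightarrow> dist x y \<le> e) \<and> q > 0 \<longrightarrow>
      real q * ln (exp_sum T \<phi> n E) \<le> real n * ent (measure_pmf \<rho>) (itinerary T g q) + 2 * real q * real q * ln (real (card (range g)))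
        + real q * real n * (\<integral>x. \<phi> x \<partial>measure_pmf \<rho>)) \<and>
    (\<forall>\<psi> :: 'a \<Rightarrow>\<^sub>C real. ln (exp_sum T \<phi> n E) - ln (exp_sum T \<psi> n E) \<le> real n * (\<integral>x. \<phi> x - \<psi> x \<partial>measure_pmf \<rho>)) \<and>
    (\<forall>f B. (\<forall>x. \<bar>f x\<bar> \<le> B) \<longrightarrow> \<bar>(\<integral>x. f (T x) \<partial>measure_pmf \<rho>) - (\<integral>x. f x \<partial>measure_pmf \<rho>)\<bar> \<le> 2 * B / real n)"
proof -
  define S where "S x = birkhoff_sum T n \<phi> x" for x
  define w where "w x = exp (S x) / exp_sum T \<phi> n E" for x
  have Zpos: "0 < exp_sum T \<psi> n E" for \<psi> :: "'a \<Rightarrow>\<^sub>C real" using E by (intro sum_pos) auto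
  have w: "0 < w x" for x using Zpos[of \<phi>] by (simp add: w_def)
  have lnw: "ln (w x) = S x - ln (exp_sum T \<phi> n E)" for x
    using Zpos[of \<phi>] unfolding w_def by (subst ln_divide_pos) simp_all
  have w1: "(\<Sum>x\<in>E. w x) = 1"
    using Zpos[of \<phi>] by (simp add: w_def S_def sum_divide_distrib[symmetric])
  obtain \<sigma> where \<sigma>: "set_pmf \<sigma> \<subseteq> E" "\<forall>x\<in>E. pmf \<sigma> x = w x"
    using ex_pmf_of_weights[OF E(1) less_imp_le[OF w] w1] by (elim exE conjE)
  have fin: "finite (set_pmf \<sigma>)" using \<sigma>(1) E(1) by (rule finite_subset)
  have int\<sigma>: "(\<integral>x. f x \<partial>measure_pmf \<sigma>) = (\<Sum>x\<in>E. w x * f x)" for f :: "'a \<Rightarrow> real"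
    using \<sigma> E(1) by (subst integral_measure_pmf_real[of E]) (auto simp: mult.commute intro!: sum.cong)
  define \<rho> where "\<rho> = orbit_average T n \<sigma>"
  have birk: "(\<Sum>x\<in>E. w x * birkhoff_sum T n f x) = real n * (\<integral>x. f x \<partial>measure_pmf \<rho>)" for f :: "'a \<Rightarrow> real"
  proof -
    have "(\<Sum>x\<in>E. w x * birkhoff_sum T n f x) = (\<Sum>i<n. \<Sum>x\<in>E. w x * f ((T ^^ i) x))"
      unfolding birkhoff_sum_def sum_distrib_left by (rule sum.swap)
    also have "\<dots> = real n * (\<integral>x. f x \<partial>measure_pmf \<rho>)"
      using \<open>n > 0\<close> by (simp add: \<rho>_def integral_orbit_average[OF \<open>n > 0\<close> fin] int\<sigma>)
    finally show ?thesis .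
  qed
  have Sw: "(\<Sum>x\<in>E. w x * S x) = real n * (\<integral>x. \<phi> x \<partial>measure_pmf \<rho>)" unfolding S_def by (rule birk)
  \<comment> \<open>The equality case of \<open>gibbs_variational_ineq\<close>.\<close>
  have wln: "- (\<Sum>x\<in>E. w x * ln (w x)) + (\<Sum>x\<in>E. w x * S x) = ln (exp_sum T \<phi> n E)"
  proof -
    have "(\<Sum>x\<in>E. w x * ln (w x)) = (\<Sum>x\<in>E. w x * S x) - (\<Sum>x\<in>E. w x * ln (exp_sum T \<phi> n E))"
      by (simp only: lnw right_diff_distrib sum_subtractf)
    also have "(\<Sum>x\<in>E. w x * ln (exp_sum T \<phi> n E)) = ln (exp_sum T \<phi> n E)"
      by (simp only: sum_distrib_right[symmetric] w1 mult_1)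
    finally show ?thesis by simp
  qed
  have blocks: "real q * ln (exp_sum T \<phi> n E) \<le> real n * ent (measure_pmf \<rho>) (itinerary T g q) + 2 * real q * real q * ln (real (card (range g)))
        + real q * real n * (\<integral>x. \<phi> x \<partial>measure_pmf \<rho>)"
    if g: "finite (range g)" "\<forall>x y. g x = g y \<longrightarrow> dist x y \<le> e" and "q > 0" for g :: "'a \<Rightarrow> 'a set" and q
  proof -
    \<comment> \<open>Cells of diameter at most \<open>e\<close> distinguish points that separate by
      more than \<open>e\<close>. Hence the itinerary of length \<open>n\<close> has the full
      entropy of the weights, before any block cutting.\<close>
    have inj: "inj_on (itinerary T g n) E"
    proof (rule inj_onI, rule ccontr)
      fix x y assume xy: "x \<in> E" "y \<in> E" "itinerary T g n x = itinerary T g n y" "x \<noteq> y"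
      then have "\<exists>k<n. dist ((T ^^ k) x) ((T ^^ k) y) > e"
        using E(3) separated_iff[OF \<open>n > 0\<close>, of T e E] by simp
      then obtain k where k: "k < n" "dist ((T ^^ k) x) ((T ^^ k) y) > e" by (elim exE conjE)
      have "g ((T ^^ k) x) = g ((T ^^ k) y)"
        using arg_cong[OF xy(3), of "\<lambda>b. b ! k"] k(1) by simp
      then show False using g(2) k(2) by (simp add: not_le[symmetric])
    qed
    have meas: "measure (measure_pmf \<sigma>) (itinerary T g n -` {b}) = (\<Sum>x\<in>{x\<in>E. itinerary T g n x = b}. w x)" for b
    proof -
      have "measure (measure_pmf \<sigma>) (itinerary T g n -` {b}) = (\<integral>x. indicator (itinerary T g n -` {b}) x \<partial>measure_pmf \<sigma>)" by simp
      also have "\<dots> = (\<Sum>x\<in>E. w x * indicator (itinerary T g n -` {b}) x)" by (rule int\<sigma>)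
      also have "\<dots> = (\<Sum>x\<in>E. if itinerary T g n x = b then w x else 0)"
        by (intro sum.cong) (auto simp: indicator_def)
      also have "\<dots> = (\<Sum>x\<in>{x\<in>E. itinerary T g n x = b}. w x)"
        using E(1) by (rule sum.inter_filter[symmetric])
      finally show ?thesis .
    qed
    have mx: "measure (measure_pmf \<sigma>) (itinerary T g n -` {itinerary T g n x}) = w x" if "x \<in> E" for x
    proof -
      have "{y\<in>E. itinerary T g n y = itinerary T g n x} = {x}" using inj that by (auto dest: inj_onD)
      then show ?thesis by (simp add: meas)
    qed
    have m0: "measure (measure_pmf \<sigma>) (itinerary T g n -` {b}) = 0" if "b \<notin> itinerary T g n ` E" for b
    proof -
      have "{y\<in>E. itinerary T g n y = b} = {}" using that by auto
      then show ?thesis by (simp only: meas sum.empty)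
    qed
    define m where "m b = measure (measure_pmf \<sigma>) (itinerary T g n -` {b})" for b
    have "(\<Sum>b\<in>range (itinerary T g n). m b * ln (m b)) = (\<Sum>b\<in>itinerary T g n ` E. m b * ln (m b))"
      by (rule sum.mono_neutral_right[OF finite_range_itinerary[OF g(1)]]) (use m0 in \<open>auto simp: m_def\<close>)
    then have "ent (measure_pmf \<sigma>) (itinerary T g n) = - (\<Sum>b\<in>itinerary T g n ` E. m b * ln (m b))"
      by (simp add: ent_def m_def)
    also have "\<dots> = - (\<Sum>x\<in>E. w x * ln (w x))"
      by (simp add: sum.reindex[OF inj] mx m_def)
    finally have ent: "ent (measure_pmf \<sigma>) (itinerary T g n) + real n * (\<integral>x. \<phi> x \<partial>measure_pmf \<rho>) = ln (exp_sum T \<phi> n E)"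
      using wln Sw by simp
    have "real q * ent (measure_pmf \<sigma>) (itinerary T g n) \<le>
        (\<Sum>i<n. ent (measure_pmf \<sigma>) (\<lambda>x. itinerary T g q ((T ^^ i) x))) + 2 * real q * real q * ln (real (card (range g)))"
      by (rule ent_itinerary_blocks[OF g(1) \<open>q > 0\<close>])
    also have "(\<Sum>i<n. ent (measure_pmf \<sigma>) (\<lambda>x. itinerary T g q ((T ^^ i) x))) \<le> real n * ent (measure_pmf \<rho>) (itinerary T g q)"
      unfolding \<rho>_def by (rule ent_orbit_average[OF \<open>n > 0\<close> fin finite_range_itinerary[OF g(1)]])
    finally have "real q * ent (measure_pmf \<sigma>) (itinerary T g n) \<le>
      real n * ent (measure_pmf \<rho>) (itinerary T g q) + 2 * real q * real q * ln (real (card (range g)))" by simp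
    then show ?thesis unfolding ent[symmetric] by (simp add: algebra_simps)
  qed
  \<comment> \<open>Gibbs' inequality for the weights of \<phi> with the energies of \<psi>,
    subtracted from the equality for \<phi>.\<close>
  have gibbs: "ln (exp_sum T \<phi> n E) - ln (exp_sum T \<psi> n E) \<le> real n * (\<integral>x. \<phi> x - \<psi> x \<partial>measure_pmf \<rho>)" for \<psi> :: "'a \<Rightarrow>\<^sub>C real"
  proof -
    have "- (\<Sum>x\<in>E. w x * ln (w x)) + (\<Sum>x\<in>E. w x * birkhoff_sum T n \<psi> x) \<le> ln (exp_sum T \<psi> n E)"
      using gibbs_variational_ineq[OF E(1,2) less_imp_le[OF w] w1] by simp
    then have "ln (exp_sum T \<phi> n E) - ln (exp_sum T \<psi> n E) \<le> (\<Sum>x\<in>E. w x * S x) - (\<Sum>x\<in>E. w x * birkhoff_sum T n \<psi> x)"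
      using wln by linarith
    also have "\<dots> = (\<Sum>x\<in>E. w x * birkhoff_sum T n (\<lambda>x. \<phi> x - \<psi> x) x)"
      by (simp add: S_def birkhoff_sum_def sum_subtractf right_diff_distrib)
    also have "\<dots> = real n * (\<integral>x. \<phi> x - \<psi> x \<partial>measure_pmf \<rho>)" by (rule birk)
    finally show ?thesis .
  qed
  have almost_invariant: "\<bar>(\<integral>x. f (T x) \<partial>measure_pmf \<rho>) - (\<integral>x. f x \<partial>measure_pmf \<rho>)\<bar> \<le> 2 * B / real n" if B: "\<forall>x. \<bar>f x\<bar> \<le> B" for f :: "'a \<Rightarrow> real" and B
  proof -
    define a where "a i = (\<integral>x. f ((T ^^ i) x) \<partial>measure_pmf \<sigma>)" for i
    have ab: "\<bar>a i\<bar> \<le> B" for i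
    proof -
      have "\<bar>a i\<bar> \<le> (\<Sum>x\<in>E. \<bar>w x * f ((T ^^ i) x)\<bar>)" unfolding a_def int\<sigma> by (rule sum_abs)
      also have "\<dots> \<le> (\<Sum>x\<in>E. w x * B)"
        using B w by (intro sum_mono) (simp add: abs_mult abs_of_pos mult_left_mono less_imp_le)
      also have "\<dots> = B" by (simp add: sum_distrib_right[symmetric] w1)
      finally show ?thesis .
    qed
    have "(\<integral>x. f (T x) \<partial>measure_pmf \<rho>) = (\<Sum>i<n. a (Suc i)) / real n"
      using integral_orbit_average[OF \<open>n > 0\<close> fin, of T "\<lambda>x. f (T x)"] by (simp add: \<rho>_def a_def)
    moreover have "(\<integral>x. f x \<partial>measure_pmf \<rho>) = (\<Sum>i<n. a i) / real n"
      using integral_orbit_average[OF \<open>n > 0\<close> fin, of T f] by (simp add: \<rho>_def a_def)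
    ultimately have "(\<integral>x. f (T x) \<partial>measure_pmf \<rho>) - (\<integral>x. f x \<partial>measure_pmf \<rho>) = ((\<Sum>i<n. a (Suc i)) - (\<Sum>i<n. a i)) / real n"
      by (simp add: diff_divide_distrib)
    also have "(\<Sum>i<n. a (Suc i)) - (\<Sum>i<n. a i) = a n - a 0"
      by (simp add: sum_subtractf[symmetric] sum_lessThan_telescope)
    finally have "\<bar>(\<integral>x. f (T x) \<partial>measure_pmf \<rho>) - (\<integral>x. f x \<partial>measure_pmf \<rho>)\<bar> = \<bar>a n - a 0\<bar> / real n" by simp
    also have "\<dots> \<le> 2 * B / real n"
      using ab[of n] ab[of 0] by (intro divide_right_mono) linarith+
    finally show ?thesis .
  qed
  show ?thesis
  proof (intro exI[of _ \<rho>] conjI allI impI, goal_cases)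
    case (1 g q)
    then show ?case by (intro blocks) simp_all
  next
    case (2 \<psi>)
    show ?case by (rule gibbs)
  next
    case (3 f B)
    then show ?case by (rule almost_invariant)
  qed
qed

section \<open>Weak limits and continuity sets\<close>

text \<open>The sets with null boundary of the portmanteau theorem, on which weak convergence passes
  to measures of sets.\<close>

definition continuity_set :: "'a::topological_space measure \<Rightarrow> 'a set \<Rightarrow> bool" where
  "continuity_set \<mu> A \<longleftrightarrow> A \<in> sets borel \<and> measure \<mu> (frontier A) = 0"

lemma continuity_set_Compl: "continuity_set \<mu> A \<Longrightarrow> continuity_set \<mu> (- A)"
  by (auto simp: continuity_set_def)

lemma continuity_set_subset_frontier:
  fixes \<mu> :: "'a::topological_space measure"
  assumes "prob_space \<mu>" "sets \<mu> = sets borel" "A \<in> sets borel"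
    and "frontier A \<subseteq> N" "N \<in> sets borel" "measure \<mu> N = 0"
  shows "continuity_set \<mu> A"
proof -
  interpret prob_space \<mu> by fact
  have "measure \<mu> (frontier A) \<le> measure \<mu> N"
    using assms by (intro finite_measure_mono) auto
  then show ?thesis using assms by (simp add: continuity_set_def measure_le_0_iff)
qed

lemma continuity_set_Int:
  fixes \<mu> :: "'a::topological_space measure"
  assumes \<mu>: "prob_space \<mu>" "sets \<mu> = sets borel" and "continuity_set \<mu> A" "continuity_set \<mu> B"
  shows "continuity_set \<mu> (A \<inter> B)"
proof (rule continuity_set_subset_frontier[OF \<mu> _ frontier_Int_subset])
  interpret prob_space \<mu> by fact
  have fr: "frontier A \<in> sets borel" "frontier B \<in> sets borel" by (simp_all add: borel_closed)
  then show "frontier A \<union> frontier B \<in> sets borel" by (rule sets.Un)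
  have "measure \<mu> (frontier A \<union> frontier B) \<le> measure \<mu> (frontier A) + measure \<mu> (frontier B)"
    using fr by (intro measure_Un_le) (simp_all add: \<mu>(2))
  then show "measure \<mu> (frontier A \<union> frontier B) = 0"
    using assms(3,4) by (simp add: continuity_set_def measure_le_0_iff)
  show "A \<inter> B \<in> sets borel" using assms(3,4) by (auto simp: continuity_set_def)
qed

lemma continuity_set_finite_INT:
  fixes \<mu> :: "'a::topological_space measure"
  assumes \<mu>: "prob_space \<mu>" "sets \<mu> = sets borel" and "finite I" "\<And>i. i \<in> I \<Longrightarrow> continuity_set \<mu> (A i)"
  shows "continuity_set \<mu> (\<Inter>i\<in>I. A i)"
  using assms(3,4)
proof (induction I)
  case empty
  show ?case by (simp add: continuity_set_def)
next
  case (insert i I)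
  then have "continuity_set \<mu> (A i \<inter> (\<Inter>i\<in>I. A i))"
    by (intro continuity_set_Int[OF \<mu>]) auto
  then show ?case by simp
qed

lemma frontier_vimage_subset:
  assumes "continuous_on UNIV T"
  shows "frontier (T -` A) \<subseteq> T -` frontier A"
proof -
  have "closed (T -` closure A)" using assms by (simp add: closed_vimage)
  then have "closure (T -` A) \<subseteq> T -` closure A"
    by (intro closure_minimal vimage_mono closure_subset)
  moreover have "open (T -` interior A)" using assms by (simp add: open_vimage)
  then have "T -` interior A \<subseteq> interior (T -` A)"
    by (intro interior_maximal vimage_mono interior_subset)
  ultimately show ?thesis unfolding frontier_def by auto
qed

text \<open>The boundary of a preimage lies in the preimage of the boundary, which stays null by
  invariance. Thus atoms of iterated joins inherit null boundaries from the partition.\<close>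

lemma continuity_set_vimage_funpow:
  fixes T :: "'a::metric_space \<Rightarrow> 'a"
  assumes cont: "continuous_on UNIV T" and inv: "\<mu> \<in> invariant_measures T" and "continuity_set \<mu> A"
  shows "continuity_set \<mu> ((T ^^ k) -` A)"
proof (rule continuity_set_subset_frontier[OF invariant_prob[OF cont inv] invariant_sets[OF cont inv] _
      frontier_vimage_subset[OF continuous_on_funpow[OF cont]]])
  have fr: "frontier A \<in> sets borel" by (simp add: borel_closed)
  show "(T ^^ k) -` A \<in> sets borel" "(T ^^ k) -` frontier A \<in> sets borel"
    using assms(3) fr by (simp_all add: sets_vimage_funpow[OF cont inv] continuity_set_def)
  show "measure \<mu> ((T ^^ k) -` frontier A) = 0"
    using assms(3) invariant_measure_vimage[OF cont inv fr] by (simp add: continuity_set_def)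
qed

lemma continuity_set_itinerary:
  fixes T :: "'a::metric_space \<Rightarrow> 'a"
  assumes cont: "continuous_on UNIV T" and inv: "\<mu> \<in> invariant_measures T" and "\<And>b. continuity_set \<mu> (g -` {b})"
  shows "continuity_set \<mu> (itinerary T g n -` {b})"
proof (cases "length b = n")
  case True
  have "continuity_set \<mu> (\<Inter>k<n. (T ^^ k) -` (g -` {b ! k}))"
    by (intro continuity_set_finite_INT[OF invariant_prob[OF cont inv] invariant_sets[OF cont inv]]
        continuity_set_vimage_funpow[OF cont inv] assms(3)) simp
  then show ?thesis using True by (simp add: itinerary_vimage)
next
  case False
  then have "itinerary T g n -` {b} = {}" by auto
  then show ?thesis by (simp add: continuity_set_def)
qed

text \<open>Spheres of different radii about \<open>z\<close> are disjoint, so only countably many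
  carry mass: they are the atoms of the law of the distance to \<open>z\<close>.\<close>

lemma ex_continuity_ball:
  fixes \<mu> :: "'a::metric_space measure"
  assumes \<mu>: "prob_space \<mu>" "sets \<mu> = sets borel" and "e > 0"
  shows "\<exists>r. 0 < r \<and> r < e \<and> continuity_set \<mu> (ball z r)"
proof -
  interpret prob_space \<mu> by fact
  have sp: "space \<mu> = UNIV" using \<mu>(2) by (simp add: sets_eq_imp_space_eq)
  have cd: "continuous_on UNIV (\<lambda>y. dist z y)" by (intro continuous_intros)
  have m: "(\<lambda>y. dist z y) \<in> measurable \<mu> borel"
    using borel_measurable_continuous_onI[OF cd] by (simp add: measurable_cong_sets[OF \<mu>(2) refl])
  interpret D: prob_space "distr \<mu> borel (\<lambda>y. dist z y)" by (rule prob_space_distr[OF m])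
  have "\<exists>r\<in>{0<..<e}. r \<notin> {r. measure (distr \<mu> borel (\<lambda>y. dist z y)) {r} \<noteq> 0}"
    using \<open>e > 0\<close> by (intro open_minus_countable[OF D.countable_support]) auto
  then obtain r where r: "0 < r" "r < e" "measure (distr \<mu> borel (\<lambda>y. dist z y)) {r} = 0" by auto
  have S: "closed {y. dist z y = r}" by (intro closed_Collect_eq cd continuous_on_const)
  have "measure \<mu> {y. dist z y = r} = 0"
    using r(3) measure_distr[OF m, of "{r}"] by (simp add: sp vimage_def)
  moreover have "frontier (ball z r) \<subseteq> {y. dist z y = r}"
  proof
    fix y assume "y \<in> frontier (ball z r)"
    then have "y \<in> closure (ball z r)" "y \<notin> ball z r" by (simp_all add: frontier_def interior_open)
    then have "y \<in> cball z r" using closure_minimal[OF ball_subset_cball closed_cball] by blast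
    with \<open>y \<notin> ball z r\<close> show "y \<in> {y. dist z y = r}" by simp
  qed
  ultimately have "continuity_set \<mu> (ball z r)"
    using S by (intro continuity_set_subset_frontier[OF \<mu>]) (simp_all add: borel_closed borel_open)
  with r show ?thesis by blast
qed

text \<open>Cover by finitely many small balls with null boundary and group the points by the set
  \<open>G x\<close> of balls that contain them.\<close>

lemma ex_continuity_partition:
  fixes \<mu> :: "'a::metric_space measure"
  assumes cpt: "compact (UNIV :: 'a set)" and \<mu>: "prob_space \<mu>" "sets \<mu> = sets borel" and "e > 0"
  shows "\<exists>\<P>. finite_measurable_partition \<mu> \<P> \<and> (\<forall>A\<in>\<P>. continuity_set \<mu> A) \<and>
    (\<forall>A\<in>\<P>. \<forall>x\<in>A. \<forall>y\<in>A. dist x y \<le> e)"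
proof -
  have sp: "space \<mu> = UNIV" using \<mu>(2) by (simp add: sets_eq_imp_space_eq)
  have "e / 2 > 0" using \<open>e > 0\<close> by simp
  then have "\<forall>z. \<exists>r. 0 < r \<and> r < e / 2 \<and> continuity_set \<mu> (ball z r)"
    using ex_continuity_ball[OF \<mu>] by blast
  from choice[OF this] obtain r where r: "\<forall>z. 0 < r z \<and> r z < e / 2 \<and> continuity_set \<mu> (ball z (r z))" ..
  have "UNIV \<subseteq> (\<Union>z\<in>UNIV. ball z (r z))" using r by auto
  then have "\<exists>F\<subseteq>UNIV. finite F \<and> UNIV \<subseteq> (\<Union>z\<in>F. ball z (r z))"
    by (rule compactE_image[OF cpt, rotated]) auto
  then obtain F where F: "finite F" "UNIV \<subseteq> (\<Union>z\<in>F. ball z (r z))" by (elim exE conjE)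
  define G where "G x = {z \<in> F. x \<in> ball z (r z)}" for x
  have cs: "continuity_set \<mu> (G -` {G x})" for x
  proof -
    have "G y = G x \<longleftrightarrow> (\<forall>z\<in>F. y \<in> (if z \<in> G x then ball z (r z) else - ball z (r z)))" for y
      unfolding G_def by auto
    then have eq: "G -` {G x} = (\<Inter>z\<in>F. if z \<in> G x then ball z (r z) else - ball z (r z))"
      by (intro set_eqI) (simp only: vimage_singleton_eq INT_iff)
    have "continuity_set \<mu> (if z \<in> G x then ball z (r z) else - ball z (r z))" for z
      using r continuity_set_Compl by auto
    then show ?thesis unfolding eq by (intro continuity_set_finite_INT[OF \<mu> F(1)])
  qed
  define \<P> where "\<P> = (\<lambda>x. G -` {G x}) ` UNIV"
  have "finite (range G)" by (rule finite_subset[of _ "Pow F"]) (auto simp: G_def F)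
  then have "finite ((\<lambda>H. G -` {H}) ` range G)" by simp
  then have "finite \<P>" unfolding \<P>_def by (simp add: image_image)
  moreover have "\<P> \<subseteq> sets \<mu>" using cs unfolding \<P>_def \<mu>(2) by (auto simp: continuity_set_def)
  moreover have "partition_on UNIV \<P>"
    unfolding \<P>_def by (rule partition_onI) (auto simp: disjnt_def)
  ultimately have "finite_measurable_partition \<mu> \<P>" by (simp add: finite_measurable_partition_def sp)
  moreover have "\<forall>A\<in>\<P>. continuity_set \<mu> A" using cs by (simp add: \<P>_def)
  moreover have "dist x y \<le> e" if "G x = G y" for x y
  proof -
    obtain z where z: "z \<in> F" "x \<in> ball z (r z)" using F(2) by blast
    then have "z \<in> G y" using that by (auto simp: G_def)
    then have "dist z x < r z" "dist z y < r z" using z(2) by (simp_all add: G_def)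
    moreover have "r z < e / 2" using r by simp
    ultimately have "dist z x < e / 2" "dist z y < e / 2" by linarith+
    then show ?thesis using dist_triangle3[of x y z] by simp
  qed
  then have "\<forall>A\<in>\<P>. \<forall>x\<in>A. \<forall>y\<in>A. dist x y \<le> e" by (simp add: \<P>_def)
  ultimately show ?thesis by blast
qed

context
  fixes \<rho> :: "nat \<Rightarrow> 'a::metric_space pmf" and \<mu> :: "'a measure"
  assumes \<mu>: "prob_space \<mu>" "sets \<mu> = sets borel"
    and weak: "\<forall>f :: 'a \<Rightarrow> real. continuous_on UNIV f \<longrightarrow>
      (\<lambda>k. \<integral>x. f x \<partial>measure_pmf (\<rho> k)) \<longlonglongrightarrow> (\<integral>x. f x \<partial>\<mu>)"
begin

text \<open>The portmanteau bound: a continuous cutoff lies above the indicator of \<open>F\<close>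
  and has integral below \<open>c\<close> in the limit.\<close>

lemma weak_limit_closed:
  assumes "closed F" "measure \<mu> F < c"
  shows "\<forall>\<^sub>F k in sequentially. measure (measure_pmf (\<rho> k)) F < c"
proof (cases "F = {}")
  case True
  then show ?thesis using assms by simp
next
  case False
  define f where "f j x = max 0 (1 - real j * infdist x F)" for j x
  have "(\<lambda>j. \<integral>x. f j x \<partial>\<mu>) \<longlonglongrightarrow> measure \<mu> F"
    unfolding f_def by (rule integral_infdist_cutoff_tendsto[OF \<mu> assms(1) False])
  from order_tendstoD(2)[OF this assms(2)] obtain j where j: "(\<integral>x. f j x \<partial>\<mu>) < c"
    by (auto simp: eventually_sequentially)
  have "continuous_on UNIV (f j)" unfolding f_def by (rule continuous_on_infdist_cutoff)
  then have "(\<lambda>k. \<integral>x. f j x \<partial>measure_pmf (\<rho> k)) \<longlonglongrightarrow> (\<integral>x. f j x \<partial>\<mu>)" using weak by simp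
  from order_tendstoD(2)[OF this j] show ?thesis
  proof eventually_elim
    case (elim k)
    have "measure (measure_pmf (\<rho> k)) F = (\<integral>x. indicator F x \<partial>measure_pmf (\<rho> k))" by simp
    also have "\<dots> \<le> (\<integral>x. f j x \<partial>measure_pmf (\<rho> k))"
    proof (rule integral_mono)
      show "integrable (measure_pmf (\<rho> k)) (indicator F :: 'a \<Rightarrow> real)"
        by (rule measure_pmf.integrable_const_bound[where B=1]) auto
      show "integrable (measure_pmf (\<rho> k)) (f j)"
        by (rule measure_pmf.integrable_const_bound[where B=1])
          (auto simp: f_def infdist_nonneg)
      show "indicator F x \<le> f j x" for x by (auto simp: f_def indicator_def)
    qed
    finally show ?case using elim by simp
  qed
qed

text \<open>Apply the bound for closed sets to the closures of \<open>A\<close> and of its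
  complement; the null boundary makes the resulting upper and lower bounds meet.\<close>

lemma weak_limit_continuity_set:
  assumes "continuity_set \<mu> A"
  shows "(\<lambda>k. measure (measure_pmf (\<rho> k)) A) \<longlonglongrightarrow> measure \<mu> A"
proof (rule LIMSEQ_I)
  fix e :: real assume "e > 0"
  interpret prob_space \<mu> by fact
  have sp: "space \<mu> = UNIV" using \<mu>(2) by (simp add: sets_eq_imp_space_eq)
  have cl: "measure \<mu> (closure B) \<le> measure \<mu> B" if "continuity_set \<mu> B" for B
  proof -
    have "closure B \<subseteq> B \<union> frontier B" using interior_subset by (auto simp: frontier_def)
    then have "measure \<mu> (closure B) \<le> measure \<mu> (B \<union> frontier B)"
      using that by (intro finite_measure_mono) (auto simp: \<mu>(2) continuity_set_def borel_closed)
    also have "\<dots> \<le> measure \<mu> B + measure \<mu> (frontier B)"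
      using that by (intro measure_Un_le) (auto simp: \<mu>(2) continuity_set_def borel_closed)
    finally show ?thesis using that by (simp add: continuity_set_def)
  qed
  have compl: "measure \<mu> (- A) = 1 - measure \<mu> A"
    using prob_compl[of A] assms by (simp add: sp \<mu>(2) continuity_set_def Compl_eq_Diff_UNIV)
  have compl': "measure (measure_pmf p) (- A) = 1 - measure (measure_pmf p) A" for p :: "'a pmf"
    using measure_pmf.prob_compl[of A p] by (simp add: Compl_eq_Diff_UNIV)
  have mono: "measure (measure_pmf p) B \<le> measure (measure_pmf p) (closure B)" for p :: "'a pmf" and B
    by (intro measure_pmf.finite_measure_mono closure_subset) simp
  have "\<forall>\<^sub>F k in sequentially. measure (measure_pmf (\<rho> k)) (closure A) < measure \<mu> A + e"
    using cl[OF assms] \<open>e > 0\<close> by (intro weak_limit_closed) auto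
  moreover have "\<forall>\<^sub>F k in sequentially. measure (measure_pmf (\<rho> k)) (closure (- A)) < measure \<mu> (- A) + e"
    using cl[OF continuity_set_Compl[OF assms]] \<open>e > 0\<close> by (intro weak_limit_closed) auto
  ultimately have "\<forall>\<^sub>F k in sequentially. norm (measure (measure_pmf (\<rho> k)) A - measure \<mu> A) < e"
  proof eventually_elim
    case (elim k)
    then show ?case
      using mono[of "\<rho> k" A] mono[of "\<rho> k" "- A"] compl compl'[of "\<rho> k"]
      by (simp only: real_norm_def abs_less_iff) linarith
  qed
  then show "\<exists>no. \<forall>n\<ge>no. norm (measure (measure_pmf (\<rho> n)) A - measure \<mu> A) < e"
    by (simp add: eventually_sequentially)
qed

end

text \<open>Away from 0 this is continuity of \<open>ln\<close>; at 0 the square root bound squeezes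
  the product.\<close>

lemma tendsto_x_ln_x:
  fixes p :: "'b \<Rightarrow> real"
  assumes lim: "(p \<longlongrightarrow> m) F" and nonneg: "\<And>k. 0 \<le> p k" and "0 \<le> m"
  shows "((\<lambda>k. p k * ln (p k)) \<longlongrightarrow> m * ln m) F"
proof (cases "m = 0")
  case False
  with lim show ?thesis by (intro tendsto_intros) auto
next
  case True
  have "((\<lambda>k. - (p k * ln (p k))) \<longlongrightarrow> 0) F"
  proof (rule tendsto_sandwich[where f = "\<lambda>_. 0" and h = "\<lambda>k. 2 * sqrt (p k)"])
    show "((\<lambda>k. 2 * sqrt (p k)) \<longlongrightarrow> 0) F"
      using tendsto_mult[OF tendsto_const[of 2] tendsto_real_sqrt[OF lim]] True by simp
    show "\<forall>\<^sub>F k in F. - (p k * ln (p k)) \<le> 2 * sqrt (p k)"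
      using minus_x_ln_x_le_sqrt[OF nonneg] by simp
    have "\<forall>\<^sub>F k in F. p k < 1" using order_tendstoD(2)[OF lim, of 1] True by simp
    then show "\<forall>\<^sub>F k in F. 0 \<le> - (p k * ln (p k))"
    proof eventually_elim
      case (elim k)
      then show ?case using nonneg[of k]
        by (cases "p k = 0") (simp_all add: mult_nonneg_nonpos)
    qed
  qed simp
  then have "((\<lambda>k. - (- (p k * ln (p k)))) \<longlongrightarrow> - 0) F" by (rule tendsto_minus)
  then show ?thesis using True by simp
qed

lemma weak_limit_ent:
  fixes \<rho> :: "nat \<Rightarrow> 'a::metric_space pmf" and \<mu> :: "'a measure"
  assumes \<mu>: "prob_space \<mu>" "sets \<mu> = sets borel"
    and weak: "\<forall>f :: 'a \<Rightarrow> real. continuous_on UNIV f \<longrightarrow>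
      (\<lambda>k. \<integral>x. f x \<partial>measure_pmf (\<rho> k)) \<longlonglongrightarrow> (\<integral>x. f x \<partial>\<mu>)"
    and f: "finite (range f)" "\<And>b. continuity_set \<mu> (f -` {b})"
  shows "(\<lambda>k. ent (measure_pmf (\<rho> k)) f) \<longlonglongrightarrow> ent \<mu> f"
proof -
  have sp: "space \<mu> = UNIV" using \<mu>(2) by (simp add: sets_eq_imp_space_eq)
  show ?thesis
    unfolding ent_def sp space_measure_pmf Int_UNIV_right
    by (intro tendsto_minus tendsto_sum tendsto_x_ln_x weak_limit_continuity_set[OF \<mu> weak] f(2)) simp_all
qed

section \<open>Existence of equilibrium states\<close>

context expansive_dynamics
begin

text \<open>The lower bound, coming from a limsup, is available only for infinitely many
  \<open>n\<close>, the upper bound for all large \<open>n\<close>; a common \<open>n\<close>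
  therefore exists for two different potentials.\<close>

lemma near_optimal_separated_set:
  assumes "d > 0"
  shows "\<exists>n\<ge>N. n > 0 \<and> (\<exists>E. finite E \<and> E \<noteq> {} \<and> separated T n \<delta> E \<and>
    real n * (P \<phi> - d) \<le> ln (exp_sum T \<phi> n E) \<and> ln (exp_sum T \<psi> n E) \<le> real n * (P \<psi> + d))"
proof -
  have "d / 2 > 0" using assms by simp
  obtain N1 where N1: "\<forall>n\<ge>N1. ln (sep_sum T \<psi> n \<delta>) \<le> real n * (P \<psi> + d)"
    using ln_sep_sum_eventually_le[OF \<delta>_pos order_refl assms, of \<psi>] unfolding eventually_sequentially ..
  \<comment> \<open>Makes \<open>n * d / 2\<close> at least 1, which absorbs the loss of 1 in the
    choice of a nearly optimal set.\<close>
  obtain N2 :: nat where N2: "2 / d < real N2" using reals_Archimedean2 by blast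
  obtain n where n: "n \<ge> Suc (N + N1 + N2)" "real n * (P \<phi> - d / 2) \<le> ln (sep_sum T \<phi> n \<delta>)"
    using ln_sep_sum_frequently_ge[OF \<open>d / 2 > 0\<close>, of "Suc (N + N1 + N2)" \<phi>] by blast
  have "n > 0" "n \<ge> N" "n \<ge> N1" "n \<ge> N2" using n(1) by simp_all
  have "2 / d < real n" using N2 \<open>n \<ge> N2\<close> by linarith
  then have "1 \<le> real n * (d / 2)" using assms by (simp add: field_simps)
  obtain E where E: "finite E" "E \<noteq> {}" "separated T n \<delta> E" "ln (sep_sum T \<phi> n \<delta>) - 1 \<le> ln (exp_sum T \<phi> n E)"
    by (rule sep_sum_attained_approx[OF cpt \<delta>_pos \<open>n > 0\<close>])
  have "real n * (P \<phi> - d) \<le> ln (exp_sum T \<phi> n E)"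
    using E(4) n(2) \<open>1 \<le> real n * (d / 2)\<close> by (simp add: algebra_simps)
  moreover have "0 < exp_sum T \<psi> n E" using E by (intro sum_pos) auto
  then have "ln (exp_sum T \<psi> n E) \<le> ln (sep_sum T \<psi> n \<delta>)"
    using exp_sum_le_sep_sum[OF cpt \<delta>_pos \<open>n > 0\<close> E(3), of \<psi>] by (subst ln_le_cancel_iff) linarith+
  then have "ln (exp_sum T \<psi> n E) \<le> real n * (P \<psi> + d)" using N1 \<open>n \<ge> N1\<close> by fastforce
  ultimately show ?thesis using E(1-3) \<open>n > 0\<close> \<open>n \<ge> N\<close> by blast
qed

text \<open>The empirical measure is built for \<open>\<phi> + t \<psi>\<close> but judged by
  \<phi>. One measure is nearly an equilibrium state of \<phi>, has a large integral of \<psi>, and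
  is nearly invariant, with errors that vanish with \<open>t\<close>.\<close>

lemma approximate_equilibrium:
  assumes "t > 0"
  shows "\<exists>\<rho> :: 'a pmf.
    (\<forall>(g :: 'a \<Rightarrow> 'a set) q. finite (range g) \<and> (\<forall>x y. g x = g y \<longrightarrow> dist x y \<le> \<delta>) \<and> q > 0 \<longrightarrow>
      P \<phi> \<le> ent (measure_pmf \<rho>) (itinerary T g q) / real q + (\<integral>x. \<phi> x \<partial>measure_pmf \<rho>)
        + t * (t + 2 * norm \<psi> + 2 * real q * ln (real (card (range g))))) \<and>
    (P (\<phi> + t *\<^sub>R \<psi>) - P \<phi>) / t \<le> (\<integral>x. \<psi> x \<partial>measure_pmf \<rho>) + 2 * t \<and>
    (\<forall>f B. (\<forall>x. \<bar>f x\<bar> \<le> B) \<longrightarrow>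
      \<bar>(\<integral>x. f (T x) \<partial>measure_pmf \<rho>) - (\<integral>x. f x \<partial>measure_pmf \<rho>)\<bar> \<le> 2 * B * t)"
proof -
  define \<phi>' where "\<phi>' = \<phi> + t *\<^sub>R \<psi>"
  \<comment> \<open>A length of at least \<open>1 / t\<close> turns errors of order
    \<open>1 / n\<close> into errors of order \<open>t\<close>. The precision below is the square of
    \<open>t\<close>, since the difference of pressures is divided by \<open>t\<close>
    afterwards.\<close>
  obtain N :: nat where N: "1 / t < real N" using reals_Archimedean2 by blast
  have "t\<^sup>2 > 0" using assms by simp
  from near_optimal_separated_set[OF this, of N \<phi>' \<phi>] obtain n E
    where n: "n \<ge> N" "n > 0" and E: "finite E" "E \<noteq> {}" "separated T n \<delta> E"
      and Z1: "real n * (P \<phi>' - t\<^sup>2) \<le> ln (exp_sum T \<phi>' n E)" and Z2: "ln (exp_sum T \<phi> n E) \<le> real n * (P \<phi> + t\<^sup>2)"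
    by (elim exE conjE)
  have "1 / t < real n" using N n(1) by linarith
  then have nt: "1 \<le> t * real n" using assms by (simp add: field_simps)
  obtain \<rho> :: "'a pmf" where
    blocks: "\<forall>(g :: 'a \<Rightarrow> 'a set) q. finite (range g) \<and> (\<forall>x y. g x = g y \<longrightarrow> dist x y \<le> \<delta>) \<and> q > 0 \<longrightarrow>
      real q * ln (exp_sum T \<phi>' n E) \<le> real n * ent (measure_pmf \<rho>) (itinerary T g q)
        + 2 * real q * real q * ln (real (card (range g))) + real q * real n * (\<integral>x. \<phi>' x \<partial>measure_pmf \<rho>)"
    and gibbs: "\<forall>\<psi> :: 'a \<Rightarrow>\<^sub>C real. ln (exp_sum T \<phi>' n E) - ln (exp_sum T \<psi> n E) \<le> real n * (\<integral>x. \<phi>' x - \<psi> x \<partial>measure_pmf \<rho>)"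
    and inv: "\<forall>f B. (\<forall>x. \<bar>f x\<bar> \<le> B) \<longrightarrow>
      \<bar>(\<integral>x. f (T x) \<partial>measure_pmf \<rho>) - (\<integral>x. f x \<partial>measure_pmf \<rho>)\<bar> \<le> 2 * B / real n"
    using misiurewicz_measure[OF E n(2), of \<phi>'] by (elim exE conjE)
  have intg: "integrable (measure_pmf \<rho>) (apply_bcontfun f)" for f :: "'a \<Rightarrow>\<^sub>C real"
    by (rule measure_pmf.integrable_const_bound[where B="norm f"]) (simp_all add: bcontfun_abs_le)
  have i\<phi>': "(\<integral>x. \<phi>' x \<partial>measure_pmf \<rho>) = (\<integral>x. \<phi> x \<partial>measure_pmf \<rho>) + t * (\<integral>x. \<psi> x \<partial>measure_pmf \<rho>)"
    by (simp add: \<phi>'_def plus_bcontfun.rep_eq scaleR_bcontfun.rep_eq intg)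
  have i\<psi>: "\<bar>\<integral>x. \<psi> x \<partial>measure_pmf \<rho>\<bar> \<le> norm \<psi>"
  proof -
    have "\<bar>\<integral>x. \<psi> x \<partial>measure_pmf \<rho>\<bar> \<le> (\<integral>x. \<bar>\<psi> x\<bar> \<partial>measure_pmf \<rho>)" by (rule integral_abs_bound)
    also have "\<dots> \<le> (\<integral>x. norm \<psi> \<partial>measure_pmf \<rho>)"
      by (intro integral_mono integrable_abs intg) (simp_all add: bcontfun_abs_le)
    finally show ?thesis by simp
  qed
  \<comment> \<open>Returning to \<phi> costs \<open>t * norm \<psi>\<close> once in the pressure
    and once in the integral, hence the term \<open>2 * norm \<psi>\<close>.\<close>
  have P\<phi>': "P \<phi> \<le> P \<phi>' + t * norm \<psi>"
    using pressure_lipschitz_le[of \<phi> \<phi>'] assms by (simp add: \<phi>'_def)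
  have A: "P \<phi> \<le> ent (measure_pmf \<rho>) (itinerary T g q) / real q + (\<integral>x. \<phi> x \<partial>measure_pmf \<rho>)
        + t * (t + 2 * norm \<psi> + 2 * real q * ln (real (card (range g))))"
    if g: "finite (range g)" "\<forall>x y. g x = g y \<longrightarrow> dist x y \<le> \<delta>" "q > 0" for g :: "'a \<Rightarrow> 'a set" and q
  proof -
    define H where "H = ent (measure_pmf \<rho>) (itinerary T g q)"
    define L where "L = ln (real (card (range g)))"
    define I where "I = (\<integral>x. \<phi>' x \<partial>measure_pmf \<rho>)"
    have "card (range g) > 0" using g(1) by (simp add: card_gt_0_iff)
    then have "L \<ge> 0" by (simp add: L_def)
    have "real q * (real n * (P \<phi>' - t\<^sup>2)) \<le> real q * ln (exp_sum T \<phi>' n E)"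
      using Z1 by (intro mult_left_mono) simp_all
    also have "\<dots> \<le> real n * H + 2 * real q * real q * L + real q * real n * I"
      using blocks g unfolding H_def L_def I_def by simp
    also have "2 * real q * real q * L \<le> (t * real n) * (2 * real q * real q * L)"
      using mult_right_mono[OF nt, of "2 * real q * real q * L"] \<open>L \<ge> 0\<close> by simp
    finally have "(real q * real n) * (P \<phi>' - t\<^sup>2) \<le> (real q * real n) * (H / real q + 2 * real q * L * t + I)"
      using g(3) by (simp add: algebra_simps)
    then have "P \<phi>' - t\<^sup>2 \<le> H / real q + 2 * real q * L * t + I"
      using g(3) n(2) by (subst (asm) mult_le_cancel_left_pos) simp_all
    moreover have "I \<le> (\<integral>x. \<phi> x \<partial>measure_pmf \<rho>) + t * norm \<psi>"
      using i\<psi> assms unfolding I_def i\<phi>' by (intro add_left_mono mult_left_mono) simp_all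
    ultimately have "P \<phi> \<le> H / real q + (\<integral>x. \<phi> x \<partial>measure_pmf \<rho>) + (t\<^sup>2 + 2 * (t * norm \<psi>) + 2 * real q * L * t)"
      using P\<phi>' by linarith
    then show ?thesis unfolding H_def L_def by (simp add: algebra_simps power2_eq_square)
  qed
  have B: "(P \<phi>' - P \<phi>) / t \<le> (\<integral>x. \<psi> x \<partial>measure_pmf \<rho>) + 2 * t"
  proof -
    have "(\<integral>x. \<phi>' x - \<phi> x \<partial>measure_pmf \<rho>) = t * (\<integral>x. \<psi> x \<partial>measure_pmf \<rho>)"
      using i\<phi>' intg[of \<phi>'] intg[of \<phi>] by simp
    then have "ln (exp_sum T \<phi>' n E) - ln (exp_sum T \<phi> n E) \<le> real n * (t * (\<integral>x. \<psi> x \<partial>measure_pmf \<rho>))"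
      using gibbs[THEN spec, of \<phi>] by simp
    then have "real n * (P \<phi>' - P \<phi>) \<le> real n * (t * (\<integral>x. \<psi> x \<partial>measure_pmf \<rho>) + 2 * t\<^sup>2)"
      using Z1 Z2 by (simp add: algebra_simps)
    then have "P \<phi>' - P \<phi> \<le> t * (\<integral>x. \<psi> x \<partial>measure_pmf \<rho>) + 2 * t\<^sup>2"
      using n(2) by (subst (asm) mult_le_cancel_left_pos) simp_all
    then show ?thesis using assms by (simp add: field_simps power2_eq_square)
  qed
  have C: "\<bar>(\<integral>x. f (T x) \<partial>measure_pmf \<rho>) - (\<integral>x. f x \<partial>measure_pmf \<rho>)\<bar> \<le> 2 * B * t"
    if "\<forall>x. \<bar>f x\<bar> \<le> B" for f :: "'a \<Rightarrow> real" and B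
  proof -
    have "0 \<le> B" using that[THEN spec, of undefined] by linarith
    have "2 * B / real n \<le> 2 * B * t"
      using mult_left_mono[OF nt, of "2 * B"] \<open>0 \<le> B\<close> n(2) by (simp add: field_simps)
    moreover have "\<bar>(\<integral>x. f (T x) \<partial>measure_pmf \<rho>) - (\<integral>x. f x \<partial>measure_pmf \<rho>)\<bar> \<le> 2 * B / real n"
      by (rule inv[rule_format]) (use that in simp)
    ultimately show ?thesis by linarith
  qed
  show ?thesis
  proof (intro exI[of _ \<rho>] conjI allI impI, goal_cases)
    case (1 g q)
    then show ?case by (intro A) simp_all
  next
    case 2
    show ?case using B by (simp add: \<phi>'_def)
  next
    case (3 f B)
    then show ?case by (rule C)
  qed
qed

text \<open>A weak limit of the measures above as \<open>t\<close> tends to 0. Quantifying over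
  lower bounds \<open>c\<close> of all right difference quotients replaces the right derivative,
  whose existence is not yet available.\<close>

lemma ex_invariant_measure_entropy_ge:
  "\<exists>\<mu>\<in>invariant_measures T.
    (\<exists>\<P>. finite_measurable_partition \<mu> \<P> \<and> P \<phi> \<le> entropy_wrt_partition T \<mu> \<P> + (\<integral>x. apply_bcontfun \<phi> x \<partial>\<mu>)) \<and>
    (\<forall>c. (\<forall>t>0. c \<le> (P (\<phi> + t *\<^sub>R \<psi>) - P \<phi>) / t) \<longrightarrow> c \<le> (\<integral>x. apply_bcontfun \<psi> x \<partial>\<mu>))"
proof -
  define t where "t k = inverse (real (Suc k))" for k
  have t0: "t k > 0" for k by (simp add: t_def)
  have "t \<longlonglongrightarrow> 0" unfolding t_def[abs_def] by (rule LIMSEQ_inverse_real_of_nat)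
  define good where "good k \<rho> \<longleftrightarrow>
    (\<forall>(g :: 'a \<Rightarrow> 'a set) q. finite (range g) \<and> (\<forall>x y. g x = g y \<longrightarrow> dist x y \<le> \<delta>) \<and> q > 0 \<longrightarrow>
      P \<phi> \<le> ent (measure_pmf \<rho>) (itinerary T g q) / real q + (\<integral>x. \<phi> x \<partial>measure_pmf \<rho>)
        + t k * (t k + 2 * norm \<psi> + 2 * real q * ln (real (card (range g))))) \<and>
    (P (\<phi> + t k *\<^sub>R \<psi>) - P \<phi>) / t k \<le> (\<integral>x. \<psi> x \<partial>measure_pmf \<rho>) + 2 * t k \<and>
    (\<forall>f B. (\<forall>x. \<bar>f x\<bar> \<le> B) \<longrightarrow>
      \<bar>(\<integral>x. f (T x) \<partial>measure_pmf \<rho>) - (\<integral>x. f x \<partial>measure_pmf \<rho>)\<bar> \<le> 2 * B * t k)" for k \<rho>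
  have "\<forall>k. \<exists>\<rho>. good k \<rho>"
    unfolding good_def by (rule allI) (rule approximate_equilibrium[OF t0])
  from choice[OF this] obtain \<rho>' where \<rho>': "\<forall>k. good k (\<rho>' k)" ..
  obtain s \<mu> where s: "strict_mono (s :: nat \<Rightarrow> nat)" and \<mu>: "prob_space \<mu>" "sets \<mu> = sets (borel :: 'a measure)"
    and weak: "\<forall>f :: 'a \<Rightarrow> real. continuous_on UNIV f \<longrightarrow>
       (\<lambda>k. \<integral>x. f x \<partial>measure_pmf (\<rho>' (s k))) \<longlonglongrightarrow> (\<integral>x. f x \<partial>\<mu>)"
    using pmf_weak_limit[OF cpt, of \<rho>'] by (elim exE conjE)
  define \<rho> where "\<rho> k = \<rho>' (s k)" for k
  define u where "u k = t (s k)" for k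
  have u: "u \<longlonglongrightarrow> 0"
    using LIMSEQ_subseq_LIMSEQ[OF \<open>t \<longlonglongrightarrow> 0\<close> s] by (simp add: u_def[abs_def] comp_def)
  have u0: "u k > 0" for k by (simp add: u_def t0)
  have weak: "\<forall>f :: 'a \<Rightarrow> real. continuous_on UNIV f \<longrightarrow>
       (\<lambda>k. \<integral>x. f x \<partial>measure_pmf (\<rho> k)) \<longlonglongrightarrow> (\<integral>x. f x \<partial>\<mu>)"
    using weak by (simp add: \<rho>_def)
  have good: "good (s k) (\<rho> k)" for k using \<rho>' by (simp add: \<rho>_def)
  have G1: "P \<phi> \<le> ent (measure_pmf (\<rho> k)) (itinerary T g q) / real q + (\<integral>x. \<phi> x \<partial>measure_pmf (\<rho> k))
        + u k * (u k + 2 * norm \<psi> + 2 * real q * ln (real (card (range g))))"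
    if "finite (range g)" "\<forall>x y. g x = g y \<longrightarrow> dist x y \<le> \<delta>" "q > 0" for g :: "'a \<Rightarrow> 'a set" and q k
    unfolding u_def by (rule conjunct1[OF good[unfolded good_def], rule_format]) (use that in simp)
  have G2: "(P (\<phi> + u k *\<^sub>R \<psi>) - P \<phi>) / u k \<le> (\<integral>x. \<psi> x \<partial>measure_pmf (\<rho> k)) + 2 * u k" for k
    unfolding u_def by (rule conjunct1[OF conjunct2[OF good[unfolded good_def]]])
  have G3: "\<bar>(\<integral>x. f (T x) \<partial>measure_pmf (\<rho> k)) - (\<integral>x. f x \<partial>measure_pmf (\<rho> k))\<bar> \<le> 2 * B * u k"
    if "\<And>x. \<bar>f x\<bar> \<le> B" for f :: "'a \<Rightarrow> real" and B k
    unfolding u_def by (rule conjunct2[OF conjunct2[OF good[unfolded good_def]], rule_format]) (rule that)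
  have Tm: "T \<in> measurable \<mu> borel"
    using borel_measurable_continuous_onI[OF cont] by (simp add: measurable_cong_sets[OF \<mu>(2) refl])
  have inv: "\<mu> \<in> invariant_measures T"
  proof -
    have "distr \<mu> borel T = \<mu>"
    proof (rule finite_measure_eqI_continuous[OF prob_space.prob_space_distr[OF \<mu>(1) Tm] sets_distr \<mu>])
      fix f :: "'a \<Rightarrow> real" assume f: "continuous_on UNIV f" "\<And>x. \<bar>f x\<bar> \<le> 1"
      have fT: "continuous_on UNIV (\<lambda>x. f (T x))" by (rule continuous_on_compose2[OF f(1) cont]) simp
      have "(\<lambda>k. (\<integral>x. f (T x) \<partial>measure_pmf (\<rho> k)) - (\<integral>x. f x \<partial>measure_pmf (\<rho> k))) \<longlonglongrightarrow>
          (\<integral>x. f (T x) \<partial>\<mu>) - (\<integral>x. f x \<partial>\<mu>)"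
        using weak fT f(1) by (intro tendsto_diff) simp_all
      moreover have "(\<lambda>k. (\<integral>x. f (T x) \<partial>measure_pmf (\<rho> k)) - (\<integral>x. f x \<partial>measure_pmf (\<rho> k))) \<longlonglongrightarrow> 0"
      proof (rule Lim_null_comparison)
        show "(\<lambda>k. 2 * 1 * u k) \<longlonglongrightarrow> 0" using tendsto_mult_left[OF u, of "2 * 1"] by simp
        show "\<forall>\<^sub>F k in sequentially. norm ((\<integral>x. f (T x) \<partial>measure_pmf (\<rho> k)) - (\<integral>x. f x \<partial>measure_pmf (\<rho> k))) \<le> 2 * 1 * u k"
          unfolding real_norm_def by (intro always_eventually allI G3 f(2))
      qed
      ultimately have "(\<integral>x. f (T x) \<partial>\<mu>) - (\<integral>x. f x \<partial>\<mu>) = 0" by (rule LIMSEQ_unique)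
      then show "(\<integral>x. f x \<partial>distr \<mu> borel T) = (\<integral>x. f x \<partial>\<mu>)"
        using integral_distr[OF Tm borel_measurable_continuous_onI[OF f(1)]] by simp
    qed
    then show ?thesis using \<mu> by (simp add: invariant_measures_def)
  qed
  have dir: "c \<le> (\<integral>x. \<psi> x \<partial>\<mu>)" if c: "\<forall>t>0. c \<le> (P (\<phi> + t *\<^sub>R \<psi>) - P \<phi>) / t" for c
  proof (rule tendsto_lowerbound)
    have "(\<lambda>k. (\<integral>x. \<psi> x \<partial>measure_pmf (\<rho> k)) + 2 * u k) \<longlonglongrightarrow> (\<integral>x. \<psi> x \<partial>\<mu>) + 2 * 0"
      using weak by (intro tendsto_intros u) (simp add: continuous_on_apply_bcontfun)
    then show "(\<lambda>k. (\<integral>x. \<psi> x \<partial>measure_pmf (\<rho> k)) + 2 * u k) \<longlonglongrightarrow> (\<integral>x. \<psi> x \<partial>\<mu>)" by simp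
    have "c \<le> (\<integral>x. \<psi> x \<partial>measure_pmf (\<rho> k)) + 2 * u k" for k
      using c[rule_format, OF u0[of k]] G2[of k] by linarith
    then show "\<forall>\<^sub>F k in sequentially. c \<le> (\<integral>x. \<psi> x \<partial>measure_pmf (\<rho> k)) + 2 * u k" by simp
  qed simp
  \<comment> \<open>Diameter at most \<delta> makes the partition admissible in \<open>G1\<close>,
    and null boundaries allow passage to the limit. Such a partition depends on \<mu>.\<close>
  obtain \<P> where fin: "finite_measurable_partition \<mu> \<P>" and cs: "\<forall>A\<in>\<P>. continuity_set \<mu> A"
    and small: "\<forall>A\<in>\<P>. \<forall>x\<in>A. \<forall>y\<in>A. dist x y \<le> \<delta>"
    using ex_continuity_partition[OF cpt \<mu> \<delta>_pos] by (elim exE conjE)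
  have part: "partition_on UNIV \<P>" and "finite \<P>"
    using fin by (simp_all add: finite_measurable_partition_def invariant_space[OF cont inv])
  have fr: "finite (range (cell \<P>))" using \<open>finite \<P>\<close> by (simp add: range_cell[OF part])
  have diam: "\<forall>x y. cell \<P> x = cell \<P> y \<longrightarrow> dist x y \<le> \<delta>"
    using small cell_mem[OF part] by metis
  have fib: "continuity_set \<mu> (cell \<P> -` {b})" for b
  proof (cases "b \<in> \<P>")
    case True
    then show ?thesis using cs by (simp add: cell_vimage[OF part])
  next
    case False
    then have "b \<notin> range (cell \<P>)" by (simp add: range_cell[OF part])
    then have "cell \<P> -` {b} = {}" by (simp add: vimage_def image_iff eq_commute)
    then show ?thesis by (simp add: continuity_set_def)
  qed
  \<comment> \<open>First \<open>k\<close> tends to infinity with the block length \<open>q\<close>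
    fixed, so that the error term is killed by \<open>u k\<close>; only afterwards does
    \<open>q\<close> tend to infinity.\<close>
  have ineq: "P \<phi> - (\<integral>x. \<phi> x \<partial>\<mu>) \<le> ent \<mu> (itinerary T (cell \<P>) q) / real q" if "q > 0" for q
  proof -
    define L where "L = ln (real (card (range (cell \<P>))))"
    define F where "F k = ent (measure_pmf (\<rho> k)) (itinerary T (cell \<P>) q) / real q
      + (\<integral>x. \<phi> x \<partial>measure_pmf (\<rho> k)) + u k * (u k + 2 * norm \<psi> + 2 * real q * L)" for k
    have "(\<lambda>k. ent (measure_pmf (\<rho> k)) (itinerary T (cell \<P>) q)) \<longlonglongrightarrow> ent \<mu> (itinerary T (cell \<P>) q)"
      by (rule weak_limit_ent[OF \<mu> weak finite_range_itinerary[OF fr] continuity_set_itinerary[OF cont inv fib]])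
    then have "F \<longlonglongrightarrow> ent \<mu> (itinerary T (cell \<P>) q) / real q + (\<integral>x. \<phi> x \<partial>\<mu>) + 0 * (0 + 2 * norm \<psi> + 2 * real q * L)"
      unfolding F_def[abs_def] using weak that
      by (intro tendsto_intros u) (simp_all add: continuous_on_apply_bcontfun)
    moreover have "P \<phi> \<le> F k" for k unfolding F_def L_def by (rule G1[OF fr diam that])
    then have "\<forall>\<^sub>F k in sequentially. P \<phi> \<le> F k" by simp
    ultimately have "P \<phi> \<le> ent \<mu> (itinerary T (cell \<P>) q) / real q + (\<integral>x. \<phi> x \<partial>\<mu>) + 0 * (0 + 2 * norm \<psi> + 2 * real q * L)"
      by (rule tendsto_lowerbound) simp
    then show ?thesis by simp
  qed
  have "P \<phi> - (\<integral>x. \<phi> x \<partial>\<mu>) \<le> entropy_wrt_partition T \<mu> \<P>"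
  proof (rule tendsto_lowerbound[OF entropy_wrt_partition_tendsto(1)[OF cont inv fin]])
    show "\<forall>\<^sub>F q in sequentially. P \<phi> - (\<integral>x. \<phi> x \<partial>\<mu>) \<le> ent \<mu> (itinerary T (cell \<P>) q) / real q"
      using eventually_gt_at_top[of 0] by eventually_elim (rule ineq)
  qed simp
  then have "P \<phi> \<le> entropy_wrt_partition T \<mu> \<P> + (\<integral>x. \<phi> x \<partial>\<mu>)" by linarith
  with inv fin dir show ?thesis by (intro bexI[of _ \<mu>] conjI exI[of _ \<P>]) simp_all
qed

lemma measure_entropy_le:
  assumes "\<mu> \<in> invariant_measures T"
  shows "measure_entropy T \<mu> \<le> ereal (P \<phi> - (\<integral>x. apply_bcontfun \<phi> x \<partial>\<mu>))"
  unfolding measure_entropy_def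
  using entropy_plus_integral_le[OF assms, of _ \<phi>] by (intro SUP_least) (simp add: le_diff_eq)

lemma equilibrium_state_iff:
  "\<mu> \<in> equilibrium_states T (apply_bcontfun \<phi>) \<longleftrightarrow>
    \<mu> \<in> invariant_measures T \<and> measure_entropy T \<mu> = ereal (P \<phi> - (\<integral>x. apply_bcontfun \<phi> x \<partial>\<mu>))"
  unfolding equilibrium_states_def pressure_eq
  by (cases "measure_entropy T \<mu>") auto

text \<open>The supremum defining the entropy is bounded above by the variational inequality and
  below by a single partition, and the two bounds agree.\<close>

theorem ex_equilibrium_state_direction:
  "\<exists>\<mu>\<in>equilibrium_states T (apply_bcontfun \<phi>).
    \<forall>c. (\<forall>t>0. c \<le> (P (\<phi> + t *\<^sub>R \<psi>) - P \<phi>) / t) \<longrightarrow> c \<le> (\<integral>x. apply_bcontfun \<psi> x \<partial>\<mu>)"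
proof -
  obtain \<mu> \<P> where inv: "\<mu> \<in> invariant_measures T" and fin: "finite_measurable_partition \<mu> \<P>"
    and le: "P \<phi> \<le> entropy_wrt_partition T \<mu> \<P> + (\<integral>x. \<phi> x \<partial>\<mu>)"
    and dir: "\<forall>c. (\<forall>t>0. c \<le> (P (\<phi> + t *\<^sub>R \<psi>) - P \<phi>) / t) \<longrightarrow> c \<le> (\<integral>x. \<psi> x \<partial>\<mu>)"
    using ex_invariant_measure_entropy_ge[of \<phi> \<psi>] by (elim bexE conjE exE)
  have "ereal (P \<phi> - (\<integral>x. \<phi> x \<partial>\<mu>)) \<le> ereal (entropy_wrt_partition T \<mu> \<P>)"
    using le by simp
  also have "\<dots> \<le> measure_entropy T \<mu>"
    unfolding measure_entropy_def using fin by (intro SUP_upper) simp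
  finally have "measure_entropy T \<mu> = ereal (P \<phi> - (\<integral>x. \<phi> x \<partial>\<mu>))"
    using measure_entropy_le[OF inv, of \<phi>] by (rule antisym[rotated])
  with inv have "\<mu> \<in> equilibrium_states T \<phi>" by (simp add: equilibrium_state_iff)
  with dir show ?thesis by (rule bexI[of _ \<mu>])
qed

text \<open>Equilibrium states are subgradients of P at \<phi>: the variational inequality at
  \<open>\<phi> + \<psi>\<close> is combined with equality at \<phi>.\<close>

lemma equilibrium_state_supports:
  assumes "\<mu> \<in> equilibrium_states T (apply_bcontfun \<phi>)"
  shows "P \<phi> + (\<integral>x. apply_bcontfun \<psi> x \<partial>\<mu>) \<le> P (\<phi> + \<psi>)"
proof -
  have inv: "\<mu> \<in> invariant_measures T" and eq: "measure_entropy T \<mu> = ereal (P \<phi> - (\<integral>x. \<phi> x \<partial>\<mu>))"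
    using assms by (simp_all add: equilibrium_state_iff)
  have intg: "integrable \<mu> (apply_bcontfun f)" for f :: "'a \<Rightarrow>\<^sub>C real"
    by (rule integrable_bounded_borel[OF invariant_prob[OF cont inv] invariant_sets[OF cont inv] bcontfun_measurable bcontfun_abs_le])
  have "(\<integral>x. (\<phi> + \<psi>) x \<partial>\<mu>) = (\<integral>x. \<phi> x \<partial>\<mu>) + (\<integral>x. \<psi> x \<partial>\<mu>)"
    by (simp add: plus_bcontfun.rep_eq intg)
  then show ?thesis using measure_entropy_le[OF inv, of "\<phi> + \<psi>"] unfolding eq by simp
qed

end

section \<open>Differentiability of the pressure\<close>

text \<open>
  Two members of \<open>K\<close> whose values on a finite \<open>\<eta>\<close>-net agree up to rounding to multiples of \<open>e\<close>
  are uniformly close, and there are only finitely many patterns of rounded values.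
\<close>

lemma equicontinuous_finite_net:
  fixes K :: "('a::metric_space \<Rightarrow>\<^sub>C real) set"
  assumes cpt: "compact (UNIV :: 'a set)" and "e > 0" "\<eta> > 0"
    and K: "\<And>u. u \<in> K \<Longrightarrow> norm u \<le> M" "\<And>u x y. u \<in> K \<Longrightarrow> dist x y < \<eta> \<Longrightarrow> \<bar>u x - u y\<bar> \<le> e"
  shows "\<exists>F\<subseteq>K. finite F \<and> (\<forall>u\<in>K. \<exists>v\<in>F. norm (u - v) \<le> 3 * e)"
proof -
  obtain N :: "'a set" where N: "finite N" "UNIV \<subseteq> (\<Union>z\<in>N. ball z \<eta>)"
    using compact_finite_net[OF cpt \<open>\<eta> > 0\<close>] by blast
  define code where "code u = restrict (\<lambda>z. \<lfloor>apply_bcontfun u z / e\<rfloor>) N" for u :: "'a \<Rightarrow>\<^sub>C real"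
  \<comment> \<open>A finite range for the rounded values; the margin of 1 on either side covers
    rounding down.\<close>
  define I where "I = {- \<lceil>M / e\<rceil> - 1 .. \<lceil>M / e\<rceil> + 1}"
  have code: "code u \<in> (\<Pi>\<^sub>E z\<in>N. I)" if "u \<in> K" for u
  proof -
    have "\<lfloor>u z / e\<rfloor> \<in> I" for z
    proof -
      have "\<bar>u z\<bar> \<le> M" using bcontfun_abs_le[of u z] K(1)[OF that] by linarith
      then have "\<bar>u z / e\<bar> \<le> M / e" using \<open>e > 0\<close> by (simp add: divide_right_mono)
      then have "u z / e \<le> M / e" "- (M / e) \<le> u z / e" by linarith+
      then show ?thesis unfolding I_def atLeastAtMost_iff by linarith
    qed
    then show ?thesis unfolding code_def by (intro PiE_I) simp_all
  qed
  have "finite (\<Pi>\<^sub>E z\<in>N. I)" by (intro finite_PiE N(1)) (simp add: I_def)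
  moreover have "code ` K \<subseteq> (\<Pi>\<^sub>E z\<in>N. I)" using code by (rule image_subsetI)
  ultimately have fin: "finite (code ` K)" by (rule finite_subset[rotated])
  define F where "F = (\<lambda>c. SOME v. v \<in> K \<and> code v = c) ` (code ` K)"
  have pick: "(SOME v. v \<in> K \<and> code v = code u) \<in> K \<and> code (SOME v. v \<in> K \<and> code v = code u) = code u"
    if "u \<in> K" for u
    by (rule someI[of _ u]) (simp add: that)
  \<comment> \<open>One \<open>e\<close> for the rounding at the net point and one for the
    oscillation of each of the two functions.\<close>
  have "norm (u - v) \<le> 3 * e" if uv: "u \<in> K" "v \<in> K" "code v = code u" for u v
  proof (rule norm_bound)
    fix x
    obtain z where z: "z \<in> N" "dist z x < \<eta>" using N(2) by (auto simp: subset_eq)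
    have "\<lfloor>v z / e\<rfloor> = \<lfloor>u z / e\<rfloor>"
      using fun_cong[OF uv(3), of z] z(1) by (simp add: code_def)
    then have "\<bar>u z / e - v z / e\<bar> \<le> 1" by linarith
    then have "\<bar>u z - v z\<bar> \<le> e"
      using \<open>e > 0\<close> by (simp add: diff_divide_distrib[symmetric] abs_divide divide_le_eq)
    moreover have "\<bar>u z - u x\<bar> \<le> e" "\<bar>v z - v x\<bar> \<le> e" using K(2) uv z(2) by blast+
    ultimately show "norm ((u - v) x) \<le> 3 * e" by (simp add: minus_bcontfun.rep_eq)
  qed
  moreover have "F \<subseteq> K" unfolding F_def using pick by auto
  moreover have "finite F" unfolding F_def by (rule finite_imageI[OF fin])
  moreover have "\<exists>v\<in>F. v \<in> K \<and> code v = code u" if "u \<in> K" for u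
    using pick[OF that] that unfolding F_def by blast
  ultimately show ?thesis by (intro exI[of _ F]) blast
qed

text \<open>Every function is bounded by some \<open>M\<close> and, for each \<open>j\<close>,
  oscillates by at most \<open>1 / (j + 1)\<close> at some scale \<open>1 / (l + 1)\<close>. The
  countably many classes obtained in this way have finite nets.\<close>

lemma bcontfun_separable:
  assumes cpt: "compact (UNIV :: 'a::metric_space set)"
  shows "\<exists>D :: ('a \<Rightarrow>\<^sub>C real) set. countable D \<and> (\<forall>u. \<forall>e>0. \<exists>v\<in>D. norm (u - v) < e)"
proof -
  define K where "K M j l = {u :: 'a \<Rightarrow>\<^sub>C real. norm u \<le> real M \<and>
    (\<forall>x y. dist x y < inverse (real (Suc l)) \<longrightarrow> \<bar>apply_bcontfun u x - apply_bcontfun u y\<bar> \<le> inverse (real (Suc j)))}" for M j l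
  have "\<exists>F\<subseteq>K M j l. finite F \<and> (\<forall>u\<in>K M j l. \<exists>v\<in>F. norm (u - v) \<le> 3 * inverse (real (Suc j)))" for M j l
    by (rule equicontinuous_finite_net[OF cpt, of _ "inverse (real (Suc l))"]) (auto simp: K_def)
  then have "\<forall>p. \<exists>F. finite F \<and> (\<forall>u\<in>K (fst p) (fst (snd p)) (snd (snd p)). \<exists>v\<in>F. norm (u - v) \<le> 3 * inverse (real (Suc (fst (snd p)))))"
    by blast
  from choice[OF this] obtain F where F: "\<forall>p. finite (F p) \<and>
    (\<forall>u\<in>K (fst p) (fst (snd p)) (snd (snd p)). \<exists>v\<in>F p. norm (u - v) \<le> 3 * inverse (real (Suc (fst (snd p)))))" ..
  define D where "D = (\<Union>p :: nat \<times> nat \<times> nat. F p)"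
  have "finite (F p)" for p by (rule conjunct1[OF F[THEN spec]])
  then have "countable D" unfolding D_def by (intro countable_UN) (simp_all add: countable_finite)
  moreover have "\<exists>v\<in>D. norm (u - v) < e" if e0: "e > 0" for u :: "'a \<Rightarrow>\<^sub>C real" and e
  proof -
    obtain M :: nat where M: "norm u \<le> real M" using real_arch_simple by blast
    obtain j where j: "inverse (real (Suc j)) < e / 3" using reals_Archimedean[of "e / 3"] e0 by auto
    have "uniformly_continuous_on UNIV (apply_bcontfun u)"
      by (rule compact_uniformly_continuous[OF continuous_on_apply_bcontfun cpt])
    then have "\<exists>d>0. \<forall>x y. dist y x < d \<longrightarrow> dist (u y) (u x) < inverse (real (Suc j))"
      unfolding uniformly_continuous_on_def by simp
    then obtain d where d: "d > 0" "\<forall>x y. dist y x < d \<longrightarrow> dist (u y) (u x) < inverse (real (Suc j))"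
      by (elim exE conjE)
    obtain l where l: "inverse (real (Suc l)) < d" using reals_Archimedean[OF d(1)] by blast
    have "\<bar>u x - u y\<bar> \<le> inverse (real (Suc j))" if "dist x y < inverse (real (Suc l))" for x y
      using d(2)[THEN spec, of y, THEN spec, of x] that l by (simp add: dist_real_def)
    then have "u \<in> K M j l" using M by (simp add: K_def)
    then obtain v where v: "v \<in> F (M, j, l)" "norm (u - v) \<le> 3 * inverse (real (Suc j))"
      using F[THEN spec, of "(M, j, l)"] by auto
    have "v \<in> D" using v(1) unfolding D_def by blast
    moreover have "norm (u - v) < e" using v(2) j by linarith
    ultimately show ?thesis by blast
  qed
  ultimately show ?thesis by blast
qed

lemma ex1_mem_iff_singleton: "(\<exists>!x. x \<in> S) \<longleftrightarrow> (\<exists>x. S = {x})"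
  unfolding Ex1_def set_eq_iff singleton_iff by blast

lemma bcontfun_integral:
  fixes \<mu> :: "'a::metric_space measure"
  assumes \<mu>: "prob_space \<mu>" "sets \<mu> = sets borel"
  shows "bounded_linear (\<lambda>f. \<integral>x. apply_bcontfun f x \<partial>\<mu> :: real)"
    and "\<bar>\<integral>x. apply_bcontfun f x \<partial>\<mu>\<bar> \<le> norm (f :: 'a \<Rightarrow>\<^sub>C real)"
proof -
  interpret prob_space \<mu> by fact
  have intg: "integrable \<mu> (apply_bcontfun f)" for f :: "'a \<Rightarrow>\<^sub>C real"
    by (rule integrable_bounded_borel[OF \<mu> bcontfun_measurable bcontfun_abs_le])
  have le: "\<bar>\<integral>x. apply_bcontfun f x \<partial>\<mu>\<bar> \<le> norm f" for f :: "'a \<Rightarrow>\<^sub>C real"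
  proof -
    have "\<bar>\<integral>x. f x \<partial>\<mu>\<bar> \<le> (\<integral>x. \<bar>f x\<bar> \<partial>\<mu>)" by (rule integral_abs_bound)
    also have "\<dots> \<le> (\<integral>x. norm f \<partial>\<mu>)"
      by (intro integral_mono integrable_abs intg) (simp_all add: bcontfun_abs_le)
    finally show ?thesis by (simp add: prob_space)
  qed
  then show "\<bar>\<integral>x. apply_bcontfun f x \<partial>\<mu>\<bar> \<le> norm f" .
  show "bounded_linear (\<lambda>f. \<integral>x. apply_bcontfun f x \<partial>\<mu> :: real)"
    by (rule bounded_linear_intro[where K=1])
      (simp_all add: plus_bcontfun.rep_eq scaleR_bcontfun.rep_eq intg le)
qed

lemma measure_eqI_bcontfun:
  fixes M N :: "'a::metric_space measure"
  assumes "prob_space M" "sets M = sets borel" "prob_space N" "sets N = sets borel"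
    and eq: "\<And>f :: 'a \<Rightarrow>\<^sub>C real. (\<integral>x. f x \<partial>M) = (\<integral>x. f x \<partial>N)"
  shows "M = N"
proof (rule finite_measure_eqI_continuous[OF assms(1-4)])
  fix f :: "'a \<Rightarrow> real" assume f: "continuous_on UNIV f" "\<And>x. \<bar>f x\<bar> \<le> 1"
  have "f \<in> bcontfun" using f by (intro bcontfun_normI[of _ 1]) simp_all
  then have "apply_bcontfun (Bcontfun f) = f" by (rule Bcontfun_inverse)
  then show "(\<integral>x. f x \<partial>M) = (\<integral>x. f x \<partial>N)" using eq[of "Bcontfun f"] by simp
qed

section \<open>Supporting functionals, convexity and generic uniqueness\<close>

context expansive_dynamics
begin

lemma pressure_lipschitz: "\<bar>P \<phi> - P \<psi>\<bar> \<le> norm (\<phi> - \<psi>)"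
  using pressure_lipschitz_le[of \<phi> \<psi>] pressure_lipschitz_le[of \<psi> \<phi>] by (simp add: norm_minus_commute abs_le_iff)

lemma continuous_on_pressure: "continuous_on UNIV P"
proof (rule continuous_onI)
  fix \<phi> :: "'a \<Rightarrow>\<^sub>C real" and e :: real assume "e > 0"
  show "\<exists>d>0. \<forall>\<psi>\<in>UNIV. dist \<psi> \<phi> < d \<longrightarrow> dist (P \<psi>) (P \<phi>) \<le> e"
  proof (intro exI[of _ e] conjI ballI impI \<open>e > 0\<close>)
    show "dist (P \<psi>) (P \<phi>) \<le> e" if "dist \<psi> \<phi> < e" for \<psi>
      using pressure_lipschitz[of \<psi> \<phi>] that by (simp add: dist_norm)
  qed
qed

lemma equilibrium_state_prob:
  assumes "\<mu> \<in> equilibrium_states T (apply_bcontfun \<phi>)"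
  shows "prob_space \<mu>" "sets \<mu> = sets borel"
  using assms by (simp_all add: equilibrium_states_def invariant_measures_def)

lemma equilibrium_state_le_quotient:
  assumes "\<mu> \<in> equilibrium_states T (apply_bcontfun \<phi>)" "t > 0"
  shows "(\<integral>x. apply_bcontfun \<psi> x \<partial>\<mu>) \<le> (P (\<phi> + t *\<^sub>R \<psi>) - P \<phi>) / t"
  using equilibrium_state_supports[OF assms(1), of "t *\<^sub>R \<psi>"] assms(2)
  by (simp add: scaleR_bcontfun.rep_eq field_simps)

lemma ex_equilibrium_state: "\<exists>\<mu>. \<mu> \<in> equilibrium_states T (apply_bcontfun \<phi>)"
  using ex_equilibrium_state_direction by blast

text \<open>Convexity along a line: the supporting functional at the intermediate point
  \<open>\<phi> + s \<psi>\<close> is compared with P at the two endpoints, displacements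
  \<open>- s\<close> and \<open>t - s\<close>.\<close>

lemma pressure_quotient_mono:
  assumes "0 < s" "s \<le> t"
  shows "(P (\<phi> + s *\<^sub>R \<psi>) - P \<phi>) / s \<le> (P (\<phi> + t *\<^sub>R \<psi>) - P \<phi>) / t"
proof -
  have "t > 0" using assms by simp
  obtain \<mu> where \<mu>: "\<mu> \<in> equilibrium_states T (apply_bcontfun (\<phi> + s *\<^sub>R \<psi>))" using ex_equilibrium_state by blast
  define a where "a = (\<integral>x. apply_bcontfun \<psi> x \<partial>\<mu>)"
  have "P (\<phi> + s *\<^sub>R \<psi>) + r * a \<le> P (\<phi> + s *\<^sub>R \<psi> + r *\<^sub>R \<psi>)" for r
    using equilibrium_state_supports[OF \<mu>, of "r *\<^sub>R \<psi>"] by (simp add: a_def scaleR_bcontfun.rep_eq)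
  from this[of "- s"] this[of "t - s"]
  have 1: "P (\<phi> + s *\<^sub>R \<psi>) - s * a \<le> P \<phi>" and 2: "P (\<phi> + s *\<^sub>R \<psi>) + (t - s) * a \<le> P (\<phi> + t *\<^sub>R \<psi>)"
    by (simp_all add: algebra_simps)
  have "(t - s) * (P (\<phi> + s *\<^sub>R \<psi>) - P \<phi>) \<le> (t - s) * (s * a)"
    using 1 assms by (intro mult_left_mono) linarith+
  also have "\<dots> = s * ((t - s) * a)" by simp
  also have "\<dots> \<le> s * (P (\<phi> + t *\<^sub>R \<psi>) - P (\<phi> + s *\<^sub>R \<psi>))"
    using 2 assms by (intro mult_left_mono) linarith+
  finally have "t * (P (\<phi> + s *\<^sub>R \<psi>) - P \<phi>) \<le> s * (P (\<phi> + t *\<^sub>R \<psi>) - P \<phi>)"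
    by (simp add: algebra_simps)
  then show ?thesis using assms(1) \<open>t > 0\<close> by (simp add: field_simps)
qed

text \<open>If all quotients exceeded the integral by \<open>e\<close>, some equilibrium state would
  have a larger integral of \<psi> than the only one available. Monotonicity extends the bound from
  one step to all smaller ones; the left endpoint is included because \<mu> is a
  subgradient.\<close>

lemma unique_equilibrium_right_derivative:
  assumes "equilibrium_states T (apply_bcontfun \<phi>) = {\<mu>}" "e > 0"
  shows "\<exists>d>0. \<forall>t. 0 < t \<and> t < d \<longrightarrow>
    (P (\<phi> + t *\<^sub>R \<psi>) - P \<phi>) / t \<in> {(\<integral>x. apply_bcontfun \<psi> x \<partial>\<mu>) ..< (\<integral>x. apply_bcontfun \<psi> x \<partial>\<mu>) + e}"
proof -
  define a where "a = (\<integral>x. apply_bcontfun \<psi> x \<partial>\<mu>)"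
  have mem: "\<mu> \<in> equilibrium_states T (apply_bcontfun \<phi>)" using assms(1) by simp
  have "\<exists>t>0. (P (\<phi> + t *\<^sub>R \<psi>) - P \<phi>) / t < a + e"
  proof (rule ccontr)
    assume "\<not> ?thesis"
    then have ge: "\<forall>t>0. a + e \<le> (P (\<phi> + t *\<^sub>R \<psi>) - P \<phi>) / t" by (meson not_le)
    have "\<forall>c. (\<forall>t>0. c \<le> (P (\<phi> + t *\<^sub>R \<psi>) - P \<phi>) / t) \<longrightarrow> c \<le> a"
      using ex_equilibrium_state_direction[of \<phi> \<psi>] unfolding assms(1) a_def by simp
    from this[THEN spec, THEN mp, OF ge] have "a + e \<le> a" .
    then show False using assms(2) by simp
  qed
  then obtain d where d: "d > 0" "(P (\<phi> + d *\<^sub>R \<psi>) - P \<phi>) / d < a + e" by (elim exE conjE)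
  have "(P (\<phi> + t *\<^sub>R \<psi>) - P \<phi>) / t \<in> {a..<a + e}" if "0 < t" "t < d" for t
    using pressure_quotient_mono[of t d \<phi> \<psi>] equilibrium_state_le_quotient[OF mem that(1), of \<psi>] that d
    unfolding a_def by simp
  then show ?thesis using d(1) unfolding a_def by (intro exI[of _ d]) simp
qed

lemma unique_equilibrium_gateaux:
  assumes uniq: "equilibrium_states T (apply_bcontfun \<phi>) = {\<mu>}"
  shows "has_gateaux_derivative P (\<lambda>\<psi>. \<integral>x. apply_bcontfun \<psi> x \<partial>\<mu>) \<phi>"
  unfolding has_gateaux_derivative_def
proof (intro conjI allI)
  have mem: "\<mu> \<in> equilibrium_states T (apply_bcontfun \<phi>)" using uniq by simp
  note pr = equilibrium_state_prob[OF mem]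
  show "bounded_linear (\<lambda>\<psi>. \<integral>x. apply_bcontfun \<psi> x \<partial>\<mu> :: real)" by (rule bcontfun_integral(1)[OF pr])
  fix \<psi> :: "'a \<Rightarrow>\<^sub>C real"
  define a where "a = (\<integral>x. apply_bcontfun \<psi> x \<partial>\<mu>)"
  have neg: "(\<integral>x. apply_bcontfun (- \<psi>) x \<partial>\<mu>) = - a"
    unfolding a_def using linear_neg[OF bounded_linear.linear[OF bcontfun_integral(1)[OF pr]]] by simp
  have "((\<lambda>t. P (\<phi> + t *\<^sub>R \<psi>)) has_real_derivative a) (at 0)"
    unfolding DERIV_def
  proof (rule LIM_I)
    fix e :: real assume "e > 0"
    obtain d1 where d1: "d1 > 0" "\<forall>t. 0 < t \<and> t < d1 \<longrightarrow> (P (\<phi> + t *\<^sub>R \<psi>) - P \<phi>) / t \<in> {a ..< a + e}"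
      using unique_equilibrium_right_derivative[OF uniq \<open>e > 0\<close>, of \<psi>] unfolding a_def by (elim exE conjE)
    \<comment> \<open>The direction \<open>- \<psi>\<close> supplies the derivative from the
      left.\<close>
    obtain d2 where d2: "d2 > 0" "\<forall>t. 0 < t \<and> t < d2 \<longrightarrow> (P (\<phi> + t *\<^sub>R (- \<psi>)) - P \<phi>) / t \<in> {- a ..< - a + e}"
      using unique_equilibrium_right_derivative[OF uniq \<open>e > 0\<close>, of "- \<psi>"] unfolding neg by (elim exE conjE)
    have "norm ((P (\<phi> + (0 + t) *\<^sub>R \<psi>) - P (\<phi> + 0 *\<^sub>R \<psi>)) / t - a) < e" if t: "t \<noteq> 0" "norm (t - 0) < min d1 d2" for t
    proof (cases "t > 0")
      case True
      then show ?thesis using d1(2)[THEN spec, of t] t by (simp, linarith?)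
    next
      case False
      then have "(P (\<phi> + (- t) *\<^sub>R (- \<psi>)) - P \<phi>) / (- t) \<in> {- a ..< - a + e}"
        using d2(2)[THEN spec, of "- t"] t by simp
      then show ?thesis by (simp, linarith?)
    qed
    then show "\<exists>s>0. \<forall>t. t \<noteq> 0 \<and> norm (t - 0) < s \<longrightarrow>
        norm ((P (\<phi> + (0 + t) *\<^sub>R \<psi>) - P (\<phi> + 0 *\<^sub>R \<psi>)) / t - a) < e"
      using d1(1) d2(1) by (intro exI[of _ "min d1 d2"]) simp
  qed
  then show "((\<lambda>t. P (\<phi> + t *\<^sub>R \<psi>)) has_vector_derivative (\<integral>x. apply_bcontfun \<psi> x \<partial>\<mu>)) (at 0)"
    unfolding a_def by (simp add: has_real_derivative_iff_has_vector_derivative)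
qed

text \<open>Subtracting the supporting line of \<mu> leaves a function with a minimum at 0, whose
  derivative there vanishes.\<close>

lemma gateaux_derivative_equilibrium:
  assumes "has_gateaux_derivative P D \<phi>" and \<mu>: "\<mu> \<in> equilibrium_states T (apply_bcontfun \<phi>)"
  shows "D \<psi> = (\<integral>x. apply_bcontfun \<psi> x \<partial>\<mu>)"
proof -
  define a where "a = (\<integral>x. apply_bcontfun \<psi> x \<partial>\<mu>)"
  have "((\<lambda>t. P (\<phi> + t *\<^sub>R \<psi>)) has_real_derivative D \<psi>) (at 0)"
    using assms(1) by (simp add: has_gateaux_derivative_def has_real_derivative_iff_has_vector_derivative)
  then have "((\<lambda>t. P (\<phi> + t *\<^sub>R \<psi>) - t * a) has_real_derivative (D \<psi> - 1 * a)) (at 0)"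
    by (intro DERIV_diff DERIV_cmult_right DERIV_ident)
  moreover have "\<forall>t. \<bar>0 - t\<bar> < 1 \<longrightarrow> P (\<phi> + 0 *\<^sub>R \<psi>) - 0 * a \<le> P (\<phi> + t *\<^sub>R \<psi>) - t * a"
    using equilibrium_state_supports[OF \<mu>, of "_ *\<^sub>R \<psi>"] by (simp add: a_def scaleR_bcontfun.rep_eq le_diff_eq)
  ultimately have "D \<psi> - 1 * a = 0" by (rule DERIV_local_min[OF _ zero_less_one])
  then show ?thesis by (simp add: a_def)
qed

lemma gateaux_imp_unique:
  assumes "gateaux_differentiable P \<phi>"
  shows "\<exists>\<mu>. equilibrium_states T (apply_bcontfun \<phi>) = {\<mu>}"
proof -
  obtain D where D: "has_gateaux_derivative P D \<phi>" using assms unfolding gateaux_differentiable_def ..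
  obtain \<mu> where \<mu>: "\<mu> \<in> equilibrium_states T (apply_bcontfun \<phi>)" using ex_equilibrium_state by blast
  have "\<nu> = \<mu>" if \<nu>: "\<nu> \<in> equilibrium_states T (apply_bcontfun \<phi>)" for \<nu>
  proof (rule measure_eqI_bcontfun[OF equilibrium_state_prob[OF \<nu>] equilibrium_state_prob[OF \<mu>]])
    show "(\<integral>x. f x \<partial>\<nu>) = (\<integral>x. f x \<partial>\<mu>)" for f :: "'a \<Rightarrow>\<^sub>C real"
      using gateaux_derivative_equilibrium[OF D \<nu>, of f] gateaux_derivative_equilibrium[OF D \<mu>, of f] by simp
  qed
  with \<mu> show ?thesis by blast
qed

text \<open>For convex P, the second difference divided by \<open>t\<close> decreases, as
  \<open>t\<close> tends to 0, to the gap between the one-sided derivatives in direction \<psi>. A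
  strict inequality at a single \<open>t\<close> thus bounds this gap and is an open condition on
  \<phi>.\<close>

definition nearly_differentiable :: "('a \<Rightarrow>\<^sub>C real) \<Rightarrow> nat \<Rightarrow> ('a \<Rightarrow>\<^sub>C real) set" where
  "nearly_differentiable \<psi> n =
    {\<phi>. \<exists>t>0. P (\<phi> + t *\<^sub>R \<psi>) + P (\<phi> - t *\<^sub>R \<psi>) - 2 * P \<phi> < t * inverse (real (Suc n))}"

lemma open_nearly_differentiable: "open (nearly_differentiable \<psi> n)"
proof -
  have "nearly_differentiable \<psi> n =
      (\<Union>t\<in>{0<..}. {\<phi>. P (\<phi> + t *\<^sub>R \<psi>) + P (\<phi> - t *\<^sub>R \<psi>) - 2 * P \<phi> < t * inverse (real (Suc n))})"
    by (auto simp: nearly_differentiable_def)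
  also have "open \<dots>"
    by (intro open_UN ballI open_Collect_less continuous_intros continuous_on_compose2[OF continuous_on_pressure]) simp_all
  finally show ?thesis .
qed

text \<open>
  If the second differences with step \<open>h\<close> were at least \<open>h / (n + 1)\<close> throughout a segment, they
  would sum up to a first difference that violates the Lipschitz bound.
\<close>

lemma dense_nearly_differentiable: "closure (nearly_differentiable \<psi> n) = UNIV"
proof -
  have "\<exists>\<phi>'\<in>nearly_differentiable \<psi> n. dist \<phi>' \<phi> < e" if "e > 0" for \<phi> e
  proof (rule ccontr)
    assume none: "\<not> ?thesis"
    define c where "c = inverse (real (Suc n))"
    have "c > 0" by (simp add: c_def)
    \<comment> \<open>So many second differences of size \<open>c * h\<close> add up to more than
      twice the Lipschitz bound \<open>h * norm \<psi>\<close> for first differences.\<close>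
    obtain N :: nat where N: "2 * norm \<psi> / c < real N" using reals_Archimedean2 by blast
    \<comment> \<open>Small enough for the interior nodes, up to index \<open>N\<close>, to stay in
      the ball of radius \<open>e\<close> around \<phi>.\<close>
    define h where "h = e / ((norm \<psi> + 1) * (real N + 1))"
    have den: "(norm \<psi> + 1) * (real N + 1) > 0" by (intro mult_pos_pos) (simp_all add: add_nonneg_pos)
    then have "h > 0" using that by (simp add: h_def)
    define p where "p i = P (\<phi> + (real i * h) *\<^sub>R \<psi>)" for i
    have second: "c * h \<le> p (Suc (Suc i)) + p i - 2 * p (Suc i)" if "i < N" for i
    proof -
      let ?\<phi>' = "\<phi> + (real (Suc i) * h) *\<^sub>R \<psi>"
      have "real (Suc i) * h * norm \<psi> < e"
      proof -
        have "real (Suc i) * norm \<psi> \<le> (real N + 1) * norm \<psi>" using that by (intro mult_right_mono) simp_all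
        also have "\<dots> < (norm \<psi> + 1) * (real N + 1)" by (simp add: algebra_simps add_pos_nonneg)
        finally have "real (Suc i) * norm \<psi> * h < (norm \<psi> + 1) * (real N + 1) * h"
          using \<open>h > 0\<close> by (intro mult_strict_right_mono)
        also have "(norm \<psi> + 1) * (real N + 1) * h = e"
          unfolding h_def times_divide_eq_right
          using less_imp_neq[OF den, symmetric] by (rule nonzero_mult_div_cancel_left)
        finally show ?thesis by (simp add: mult_ac)
      qed
      then have "dist ?\<phi>' \<phi> < e" using \<open>h > 0\<close> by (simp add: dist_norm abs_mult)
      with none have "?\<phi>' \<notin> nearly_differentiable \<psi> n" by blast
      then have "\<not> P (?\<phi>' + h *\<^sub>R \<psi>) + P (?\<phi>' - h *\<^sub>R \<psi>) - 2 * P ?\<phi>' < h * c"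
        using \<open>h > 0\<close> unfolding nearly_differentiable_def c_def by blast
      then have "h * c \<le> P (?\<phi>' + h *\<^sub>R \<psi>) + P (?\<phi>' - h *\<^sub>R \<psi>) - 2 * P ?\<phi>'" by (rule leI)
      moreover have "?\<phi>' + h *\<^sub>R \<psi> = \<phi> + (real (Suc (Suc i)) * h) *\<^sub>R \<psi>" "?\<phi>' - h *\<^sub>R \<psi> = \<phi> + (real i * h) *\<^sub>R \<psi>"
      proof -
        have "real (Suc (Suc i)) * h = real (Suc i) * h + h" "real (Suc i) * h = real i * h + h"
          by (simp_all add: algebra_simps)
        then show "?\<phi>' + h *\<^sub>R \<psi> = \<phi> + (real (Suc (Suc i)) * h) *\<^sub>R \<psi>" "?\<phi>' - h *\<^sub>R \<psi> = \<phi> + (real i * h) *\<^sub>R \<psi>"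
          by (simp_all only: scaleR_add_left add.assoc[symmetric] add_diff_cancel_right')
      qed
      ultimately show ?thesis unfolding p_def by (simp only: mult.commute)
    qed
    have sum: "real m * (c * h) \<le> (p (Suc m) - p m) - (p 1 - p 0)" if "m \<le> N" for m
      using that
    proof (induction m)
      case (Suc m)
      then show ?case using second[of m] by (simp add: algebra_simps)
    qed simp
    have lip: "\<bar>p (Suc m) - p m\<bar> \<le> h * norm \<psi>" for m
      using pressure_lipschitz[of "\<phi> + (real (Suc m) * h) *\<^sub>R \<psi>" "\<phi> + (real m * h) *\<^sub>R \<psi>"] \<open>h > 0\<close>
      by (simp add: p_def scaleR_left_diff_distrib[symmetric] algebra_simps)
    have "real N * (c * h) \<le> 2 * (h * norm \<psi>)"
      using sum[of N] lip[of N] lip[of 0] by simp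
    then have "h * (real N * c) \<le> h * (2 * norm \<psi>)" by (simp add: algebra_simps)
    then have "real N * c \<le> 2 * norm \<psi>" using \<open>h > 0\<close> by simp
    then show False using N \<open>c > 0\<close> by (simp add: field_simps)
  qed
  then show ?thesis by (auto simp: closure_approachable)
qed

lemma unique_imp_nearly_differentiable:
  assumes uniq: "equilibrium_states T (apply_bcontfun \<phi>) = {\<mu>}"
  shows "\<phi> \<in> nearly_differentiable \<psi> n"
proof -
  \<comment> \<open>Half of the tolerance for each of the two one-sided quotients.\<close>
  define e where "e = inverse (real (Suc n)) / 2"
  have "e > 0" by (simp add: e_def)
  have mem: "\<mu> \<in> equilibrium_states T (apply_bcontfun \<phi>)" using uniq by simp
  define a where "a = (\<integral>x. apply_bcontfun \<psi> x \<partial>\<mu>)"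
  have neg: "(\<integral>x. apply_bcontfun (- \<psi>) x \<partial>\<mu>) = - a"
    unfolding a_def
    using linear_neg[OF bounded_linear.linear[OF bcontfun_integral(1)[OF equilibrium_state_prob[OF mem]]]] by simp
  obtain d1 where d1: "d1 > 0" "\<forall>t. 0 < t \<and> t < d1 \<longrightarrow> (P (\<phi> + t *\<^sub>R \<psi>) - P \<phi>) / t \<in> {a ..< a + e}"
    using unique_equilibrium_right_derivative[OF uniq \<open>e > 0\<close>, of \<psi>] unfolding a_def by (elim exE conjE)
  obtain d2 where d2: "d2 > 0" "\<forall>t. 0 < t \<and> t < d2 \<longrightarrow> (P (\<phi> + t *\<^sub>R (- \<psi>)) - P \<phi>) / t \<in> {- a ..< - a + e}"
    using unique_equilibrium_right_derivative[OF uniq \<open>e > 0\<close>, of "- \<psi>"] unfolding neg by (elim exE conjE)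
  define t where "t = min d1 d2 / 2"
  have t: "0 < t" "t < d1" "t < d2" using d1(1) d2(1) by (auto simp: t_def)
  have "(P (\<phi> + t *\<^sub>R \<psi>) - P \<phi>) / t < a + e" "(P (\<phi> - t *\<^sub>R \<psi>) - P \<phi>) / t < - a + e"
    using d1(2)[THEN spec, of t] d2(2)[THEN spec, of t] t by simp_all
  then have "P (\<phi> + t *\<^sub>R \<psi>) - P \<phi> < (a + e) * t" "P (\<phi> - t *\<^sub>R \<psi>) - P \<phi> < (- a + e) * t"
    using t(1) by (simp_all add: pos_divide_less_eq)
  then have "P (\<phi> + t *\<^sub>R \<psi>) + P (\<phi> - t *\<^sub>R \<psi>) - 2 * P \<phi> < t * (2 * e)" by (simp add: algebra_simps)
  then show ?thesis using t(1) unfolding nearly_differentiable_def e_def by auto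
qed

text \<open>The subgradient \<mu> is used in direction \<psi> and \<nu> in direction
  \<open>- \<psi>\<close>: their gap is at most the second difference divided by \<open>t\<close>.
  Exchanging the two measures gives equality.\<close>

lemma nearly_differentiable_integral_eq:
  assumes nd: "\<And>n. \<phi> \<in> nearly_differentiable \<psi> n"
    and \<mu>: "\<mu> \<in> equilibrium_states T (apply_bcontfun \<phi>)" and \<nu>: "\<nu> \<in> equilibrium_states T (apply_bcontfun \<phi>)"
  shows "(\<integral>x. apply_bcontfun \<psi> x \<partial>\<mu>) \<le> (\<integral>x. apply_bcontfun \<psi> x \<partial>\<nu>)"
proof (rule field_le_epsilon)
  fix e :: real assume "e > 0"
  then obtain n where n: "inverse (real (Suc n)) < e" using reals_Archimedean by blast
  obtain t where t: "t > 0" "P (\<phi> + t *\<^sub>R \<psi>) + P (\<phi> - t *\<^sub>R \<psi>) - 2 * P \<phi> < t * inverse (real (Suc n))"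
    using nd[of n] unfolding nearly_differentiable_def by blast
  have "P \<phi> + t * (\<integral>x. apply_bcontfun \<psi> x \<partial>\<mu>) \<le> P (\<phi> + t *\<^sub>R \<psi>)"
    using equilibrium_state_supports[OF \<mu>, of "t *\<^sub>R \<psi>"] by (simp add: scaleR_bcontfun.rep_eq)
  moreover have "P \<phi> - t * (\<integral>x. apply_bcontfun \<psi> x \<partial>\<nu>) \<le> P (\<phi> - t *\<^sub>R \<psi>)"
    using equilibrium_state_supports[OF \<nu>, of "(- t) *\<^sub>R \<psi>"] by (simp add: scaleR_bcontfun.rep_eq)
  moreover have "t * inverse (real (Suc n)) < t * e" using n t(1) by (rule mult_strict_left_mono)
  ultimately have "t * (\<integral>x. apply_bcontfun \<psi> x \<partial>\<mu>) \<le> t * ((\<integral>x. apply_bcontfun \<psi> x \<partial>\<nu>) + e)"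
    using t(2) by (simp add: distrib_left)
  then show "(\<integral>x. apply_bcontfun \<psi> x \<partial>\<mu>) \<le> (\<integral>x. apply_bcontfun \<psi> x \<partial>\<nu>) + e" using t(1) by simp
qed

text \<open>Equality of integrals on a dense set of directions passes to all continuous functions,
  as integration against a probability measure is 1-Lipschitz in the supremum norm.\<close>

lemma unique_equilibrium_iff_nearly_differentiable:
  assumes D: "\<forall>u. \<forall>e>0. \<exists>v\<in>D. norm (u - v) < e"
  shows "(\<exists>!\<mu>. \<mu> \<in> equilibrium_states T (apply_bcontfun \<phi>)) \<longleftrightarrow> (\<forall>\<psi>\<in>D. \<forall>n. \<phi> \<in> nearly_differentiable \<psi> n)"
proof
  assume "\<exists>!\<mu>. \<mu> \<in> equilibrium_states T (apply_bcontfun \<phi>)"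
  then obtain \<mu> where "equilibrium_states T (apply_bcontfun \<phi>) = {\<mu>}" unfolding ex1_mem_iff_singleton ..
  then show "\<forall>\<psi>\<in>D. \<forall>n. \<phi> \<in> nearly_differentiable \<psi> n" using unique_imp_nearly_differentiable by blast
next
  assume nd: "\<forall>\<psi>\<in>D. \<forall>n. \<phi> \<in> nearly_differentiable \<psi> n"
  obtain \<mu> where \<mu>: "\<mu> \<in> equilibrium_states T (apply_bcontfun \<phi>)" using ex_equilibrium_state by blast
  have "\<nu> = \<mu>" if \<nu>: "\<nu> \<in> equilibrium_states T (apply_bcontfun \<phi>)" for \<nu>
  proof (rule measure_eqI_bcontfun[OF equilibrium_state_prob[OF \<nu>] equilibrium_state_prob[OF \<mu>]])
    fix f :: "'a \<Rightarrow>\<^sub>C real"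
    have "\<bar>(\<integral>x. f x \<partial>\<nu>) - (\<integral>x. f x \<partial>\<mu>)\<bar> \<le> 0 + e" if e0: "e > 0" for e
    proof -
      obtain v where v: "v \<in> D" "norm (f - v) < e / 2" using D[THEN spec, of f, THEN spec, of "e / 2"] e0 by auto
      have eq: "(\<integral>x. v x \<partial>\<nu>) = (\<integral>x. v x \<partial>\<mu>)"
        using nd v(1) by (intro antisym nearly_differentiable_integral_eq[OF _ \<nu> \<mu>] nearly_differentiable_integral_eq[OF _ \<mu> \<nu>]) simp_all
      have "\<bar>(\<integral>x. f x \<partial>L) - (\<integral>x. v x \<partial>L)\<bar> \<le> norm (f - v)"
        if L: "L \<in> equilibrium_states T (apply_bcontfun \<phi>)" for L
        using bcontfun_integral(2)[OF equilibrium_state_prob[OF L], of "f - v"]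
          linear_diff[OF bounded_linear.linear[OF bcontfun_integral(1)[OF equilibrium_state_prob[OF L]]], of f v] by simp
      from this[OF \<nu>] this[OF \<mu>] show ?thesis using v(2) eq by linarith
    qed
    then have "\<bar>(\<integral>x. f x \<partial>\<nu>) - (\<integral>x. f x \<partial>\<mu>)\<bar> \<le> 0" by (rule field_le_epsilon)
    then show "(\<integral>x. f x \<partial>\<nu>) = (\<integral>x. f x \<partial>\<mu>)" by simp
  qed
  with \<mu> show "\<exists>!\<mu>. \<mu> \<in> equilibrium_states T (apply_bcontfun \<phi>)" by blast
qed

lemma unique_equilibrium_generic:
  "gdelta {\<phi> :: 'a \<Rightarrow>\<^sub>C real. \<exists>!\<mu>. \<mu> \<in> equilibrium_states T (apply_bcontfun \<phi>)}"
  "closure {\<phi> :: 'a \<Rightarrow>\<^sub>C real. \<exists>!\<mu>. \<mu> \<in> equilibrium_states T (apply_bcontfun \<phi>)} = UNIV"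
proof -
  obtain D :: "('a \<Rightarrow>\<^sub>C real) set" where D: "countable D" "\<forall>u. \<forall>e>0. \<exists>v\<in>D. norm (u - v) < e"
    using bcontfun_separable[OF cpt] by (elim exE conjE)
  have "D \<noteq> {}" using D(2) zero_less_one by blast
  define v where "v = from_nat_into D"
  have range_v: "range v = D" unfolding v_def by (rule range_from_nat_into[OF \<open>D \<noteq> {}\<close> D(1)])
  \<comment> \<open>The pairs of a direction and a precision are enumerated by one natural number,
    since the intersection must be over a sequence.\<close>
  define F where "F k = nearly_differentiable (v (fst (prod_decode k))) (snd (prod_decode k))" for k
  have "(\<forall>\<psi>\<in>D. \<forall>n. \<phi> \<in> nearly_differentiable \<psi> n) \<longleftrightarrow> (\<forall>k. \<phi> \<in> F k)" for \<phi>
  proof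
    assume "\<forall>\<psi>\<in>D. \<forall>n. \<phi> \<in> nearly_differentiable \<psi> n"
    then show "\<forall>k. \<phi> \<in> F k" unfolding F_def range_v[symmetric] by simp
  next
    assume all: "\<forall>k. \<phi> \<in> F k"
    show "\<forall>\<psi>\<in>D. \<forall>n. \<phi> \<in> nearly_differentiable \<psi> n"
      unfolding range_v[symmetric]
    proof (intro ballI allI)
      fix \<psi> n assume "\<psi> \<in> range v"
      then obtain i where "\<psi> = v i" by blast
      then show "\<phi> \<in> nearly_differentiable \<psi> n" using all[THEN spec, of "prod_encode (i, n)"] by (simp add: F_def)
    qed
  qed
  then have eq: "{\<phi> :: 'a \<Rightarrow>\<^sub>C real. \<exists>!\<mu>. \<mu> \<in> equilibrium_states T (apply_bcontfun \<phi>)} = (\<Inter>(F ` UNIV))"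
    unfolding unique_equilibrium_iff_nearly_differentiable[OF D(2)] by (intro set_eqI) simp
  have op: "open (F k)" and de: "closure (F k) = UNIV" for k
    by (simp_all add: F_def open_nearly_differentiable dense_nearly_differentiable)
  show "gdelta {\<phi> :: 'a \<Rightarrow>\<^sub>C real. \<exists>!\<mu>. \<mu> \<in> equilibrium_states T (apply_bcontfun \<phi>)}"
    unfolding eq by (rule gdelta.intros[OF op])
  have "euclidean closure_of \<Inter>(range F) = topspace (euclidean :: ('a \<Rightarrow>\<^sub>C real) topology)"
    by (rule Baire_category) (auto simp: completely_metrizable_space_euclidean op de)
  then show "closure {\<phi> :: 'a \<Rightarrow>\<^sub>C real. \<exists>!\<mu>. \<mu> \<in> equilibrium_states T (apply_bcontfun \<phi>)} = UNIV"
    unfolding eq by simp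
qed

end

section \<open>Hoelder potentials and the Frechet derivative\<close>

lemma hoelder_le:
  assumes "f \<in> hoelder_space \<alpha>"
  shows "0 \<le> hoelder_seminorm \<alpha> f" "\<bar>f x - f y\<bar> \<le> hoelder_seminorm \<alpha> f * dist x y powr \<alpha>"
proof -
  obtain K where K: "\<forall>x y. \<bar>f x - f y\<bar> \<le> K * dist x y powr \<alpha>"
    using assms unfolding hoelder_space_def by blast
  have bdd: "bdd_above ((\<lambda>(x, y). \<bar>f x - f y\<bar> / dist x y powr \<alpha>) ` UNIV)"
  proof (rule bdd_aboveI2, clarify)
    fix x y
    \<comment> \<open>The maximum with 0 covers the diagonal terms: on a one-point space the
      constant \<open>K\<close> may be negative.\<close>
    show "\<bar>f x - f y\<bar> / dist x y powr \<alpha> \<le> max K 0"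
    proof (cases "x = y")
      case False
      then have "dist x y powr \<alpha> > 0" by simp
      then show ?thesis using K by (simp add: divide_le_eq le_max_iff_disj)
    qed simp
  qed
  have le: "\<bar>f x - f y\<bar> / dist x y powr \<alpha> \<le> hoelder_seminorm \<alpha> f" for x y
    unfolding hoelder_seminorm_def using cSUP_upper[OF _ bdd, of "(x, y)"] by simp
  show "0 \<le> hoelder_seminorm \<alpha> f" using le[of undefined undefined] by simp
  show "\<bar>f x - f y\<bar> \<le> hoelder_seminorm \<alpha> f * dist x y powr \<alpha>"
  proof (cases "x = y")
    case False
    then have "dist x y powr \<alpha> > 0" by simp
    then show ?thesis using le[of x y] by (simp add: divide_le_eq)
  qed simp
qed

text \<open>
  The unit ball of the Hoelder norm is totally bounded for the supremum norm, so that the Lipschitz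
  bound upgrades the directional derivatives to a Frechet derivative.
\<close>

lemma (in expansive_dynamics) unique_equilibrium_frechet:
  assumes uniq: "equilibrium_states T (apply_bcontfun \<phi>) = {\<mu>}" and "\<alpha> > 0"
  shows "frechet_differentiable_wrt (hoelder_space \<alpha>) (hoelder_norm \<alpha>) P \<phi>"
proof -
  have mem: "\<mu> \<in> equilibrium_states T (apply_bcontfun \<phi>)" using uniq by simp
  note pr = equilibrium_state_prob[OF mem]
  define D where "D \<psi> = (\<integral>x. apply_bcontfun \<psi> x \<partial>\<mu>)" for \<psi> :: "'a \<Rightarrow>\<^sub>C real"
  have D: "bounded_linear D" unfolding D_def[abs_def] by (rule bcontfun_integral(1)[OF pr])
  note lin = bounded_linear.linear[OF D]
  have Dle: "\<bar>D \<psi>\<bar> \<le> norm \<psi>" for \<psi> unfolding D_def by (rule bcontfun_integral(2)[OF pr])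
  have small: "\<exists>d>0. \<forall>h\<in>hoelder_space \<alpha>. hoelder_norm \<alpha> h < d \<longrightarrow>
      norm (P (\<phi> + h) - P \<phi> - D h) \<le> e * hoelder_norm \<alpha> h" if "e > 0" for e
  proof -
    define K where "K = {u :: 'a \<Rightarrow>\<^sub>C real. norm u \<le> 1 \<and> (\<forall>x y. \<bar>apply_bcontfun u x - apply_bcontfun u y\<bar> \<le> dist x y powr \<alpha>)}"
    \<comment> \<open>At this scale functions in \<open>K\<close> oscillate by at most
      \<open>e / 12\<close>, which yields a net of radius
      \<open>3 * (e / 12) = e / 4\<close>.\<close>
    define \<eta> where "\<eta> = (e / 12) powr (1 / \<alpha>)"
    have "\<eta> > 0" using that by (simp add: \<eta>_def)
    have "dist x y powr \<alpha> \<le> e / 12" if "dist x y < \<eta>" for x y :: 'a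
    proof -
      have "dist x y powr \<alpha> \<le> \<eta> powr \<alpha>" using that \<open>\<alpha> > 0\<close> by (intro powr_mono2) simp_all
      also have "\<dots> = e / 12" using \<open>e > 0\<close> \<open>\<alpha> > 0\<close> by (simp add: \<eta>_def powr_powr)
      finally show ?thesis .
    qed
    then have Kd: "\<bar>u x - u y\<bar> \<le> e / 12" if "u \<in> K" "dist x y < \<eta>" for u x y
      using that unfolding K_def by (blast intro: order_trans)
    have Kn: "norm u \<le> 1" if "u \<in> K" for u using that by (simp add: K_def)
    have "e / 12 > 0" using that by simp
    have "\<exists>F\<subseteq>K. finite F \<and> (\<forall>u\<in>K. \<exists>v\<in>F. norm (u - v) \<le> 3 * (e / 12))"
      by (rule equicontinuous_finite_net[OF cpt \<open>e / 12 > 0\<close> \<open>\<eta> > 0\<close> Kn Kd])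
    then obtain F where F: "finite F" "\<forall>u\<in>K. \<exists>v\<in>F. norm (u - v) \<le> 3 * (e / 12)" by (elim exE conjE)
    have "e / 4 > 0" using that by simp
    have "\<forall>v. \<exists>d>0. \<forall>t. 0 < t \<and> t < d \<longrightarrow> (P (\<phi> + t *\<^sub>R v) - P \<phi>) / t \<in> {D v ..< D v + e / 4}"
      using unique_equilibrium_right_derivative[OF uniq \<open>e / 4 > 0\<close>] unfolding D_def by (rule allI)
    from choice[OF this] obtain d where d: "\<forall>v. d v > 0 \<and> (\<forall>t. 0 < t \<and> t < d v \<longrightarrow>
      (P (\<phi> + t *\<^sub>R v) - P \<phi>) / t \<in> {D v ..< D v + e / 4})" ..
    \<comment> \<open>Finitely many directions admit a common step size; this is where total
      boundedness gives uniformity.\<close>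
    define d0 where "d0 = Min (insert 1 (d ` F))"
    have fin: "finite (insert 1 (d ` F))" using F(1) by simp
    have "d0 > 0" unfolding d0_def using fin d by (subst Min_gr_iff) auto
    have "norm (P (\<phi> + h) - P \<phi> - D h) \<le> e * hoelder_norm \<alpha> h"
      if h: "h \<in> hoelder_space \<alpha>" "hoelder_norm \<alpha> h < d0" for h
    proof -
      define t where "t = hoelder_norm \<alpha> h"
      have nt: "norm h \<le> t" "hoelder_seminorm \<alpha> h \<le> t"
        using hoelder_le(1)[OF h(1)] by (simp_all add: t_def hoelder_norm_def)
      have lower: "0 \<le> P (\<phi> + h) - P \<phi> - D h"
        using equilibrium_state_supports[OF mem, of h] by (simp add: D_def)
      show ?thesis
      proof (cases "t = 0")
        case True
        then have "h = 0" using nt(1) by simp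
        then show ?thesis using True linear_0[OF lin] by (simp add: t_def)
      next
        case False
        then have "t > 0" using nt(1) norm_ge_zero[of h] by linarith
        define u where "u = (1 / t) *\<^sub>R h"
        have h_eq: "h = t *\<^sub>R u" using \<open>t > 0\<close> by (simp add: u_def)
        have "u \<in> K"
        proof -
          have "\<bar>u x - u y\<bar> \<le> dist x y powr \<alpha>" for x y
          proof -
            have "u x - u y = (h x - h y) / t"
              by (simp add: u_def scaleR_bcontfun.rep_eq diff_divide_distrib)
            then have "\<bar>u x - u y\<bar> = \<bar>h x - h y\<bar> / t" using \<open>t > 0\<close> by simp
            also have "\<dots> \<le> (t * dist x y powr \<alpha>) / t"
            proof (rule divide_right_mono)
              have "\<bar>h x - h y\<bar> \<le> hoelder_seminorm \<alpha> h * dist x y powr \<alpha>" by (rule hoelder_le(2)[OF h(1)])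
              also have "\<dots> \<le> t * dist x y powr \<alpha>" using nt(2) by (intro mult_right_mono) simp_all
              finally show "\<bar>h x - h y\<bar> \<le> t * dist x y powr \<alpha>" .
            qed (use \<open>t > 0\<close> in simp)
            finally show ?thesis using \<open>t > 0\<close> by simp
          qed
          moreover have "norm u \<le> 1" using nt(1) \<open>t > 0\<close> by (simp add: u_def)
          ultimately show ?thesis by (simp add: K_def)
        qed
        then obtain v where v: "v \<in> F" "norm (u - v) \<le> 3 * (e / 12)" using F(2) by blast
        have "d0 \<le> d v" unfolding d0_def using fin v(1) by (intro Min_le) auto
        then have "t < d v" using h(2) by (simp add: t_def)
        then have "(P (\<phi> + t *\<^sub>R v) - P \<phi>) / t < D v + e / 4" using d \<open>t > 0\<close> by simp
        then have 1: "P (\<phi> + t *\<^sub>R v) - P \<phi> < t * (D v + e / 4)"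
          using \<open>t > 0\<close> by (simp add: pos_divide_less_eq mult.commute)
        have "P (\<phi> + h) \<le> P (\<phi> + t *\<^sub>R v) + norm (\<phi> + h - (\<phi> + t *\<^sub>R v))" by (rule pressure_lipschitz_le)
        also have "\<phi> + h - (\<phi> + t *\<^sub>R v) = t *\<^sub>R (u - v)" by (simp add: h_eq scaleR_diff_right)
        also have "norm (t *\<^sub>R (u - v)) \<le> t * (e / 4)" using v(2) \<open>t > 0\<close> by simp
        finally have 2: "P (\<phi> + h) \<le> P (\<phi> + t *\<^sub>R v) + t * (e / 4)" by simp
        have "D v - D u \<le> e / 4"
          using Dle[of "v - u"] v(2) by (simp add: linear_diff[OF lin] norm_minus_commute)
        then have 3: "t * (D v - D u) \<le> t * (e / 4)" using \<open>t > 0\<close> by (intro mult_left_mono) simp_all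
        have "D h = t * D u" unfolding h_eq by (simp add: linear_scale[OF lin])
        \<comment> \<open>Three errors of \<open>t * (e / 4)\<close>: the derivative in the net
          direction, the change of direction in P, and the change of direction in
          \<open>D\<close>.\<close>
        then have "P (\<phi> + h) - P \<phi> - D h \<le> t * e"
          using 1 2 3 \<open>t > 0\<close> that(1) mult_pos_pos[OF \<open>t > 0\<close> \<open>e > 0\<close>] by (simp add: algebra_simps)
        then show ?thesis using lower by (simp add: t_def mult.commute)
      qed
    qed
    then show ?thesis using \<open>d0 > 0\<close> by blast
  qed
  have bound: "norm (D v) \<le> 1 * hoelder_norm \<alpha> v" if "v \<in> hoelder_space \<alpha>" for v
    using Dle[of v] hoelder_le(1)[OF that] by (simp add: hoelder_norm_def)
  show ?thesis
    unfolding frechet_differentiable_wrt_def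
  proof (intro exI[of _ D] conjI ballI allI impI)
    show "D (u + v) = D u + D v" for u v by (rule linear_add[OF lin])
    show "D (c *\<^sub>R v) = c *\<^sub>R D v" for c v by (rule linear_scale[OF lin])
    show "\<exists>K. \<forall>v\<in>hoelder_space \<alpha>. norm (D v) \<le> K * hoelder_norm \<alpha> v"
      by (intro exI[of _ 1] ballI bound)
  qed (rule small)
qed

text \<open>The opening finiteness claim ensures that \<open>real_pressure\<close> faithfully
  represents the extended real pressure, because \<open>real_of_ereal\<close> would send infinite
  values to 0.\<close>

theorem theorem1p4:
  fixes T :: "'a::metric_space \<Rightarrow> 'a"
  assumes "compact (UNIV :: 'a set)"
    and "continuous_on UNIV T"
    and "expansive T"
  shows "(\<forall>\<phi> :: 'a \<Rightarrow>\<^sub>C real. \<bar>pressure T \<phi>\<bar> \<noteq> \<infinity>) \<and>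
    (\<forall>\<phi> :: 'a \<Rightarrow>\<^sub>C real.
       gateaux_differentiable (real_pressure T) \<phi> \<longleftrightarrow> (\<exists>!\<mu>. \<mu> \<in> equilibrium_states T \<phi>)) \<and>
    (\<forall>\<phi> :: 'a \<Rightarrow>\<^sub>C real. gateaux_differentiable (real_pressure T) \<phi> \<longrightarrow>
       (\<exists>\<mu>. equilibrium_states T \<phi> = {\<mu>} \<and>
            has_gateaux_derivative (real_pressure T) (\<lambda>\<psi>. \<integral>x. \<psi> x \<partial>\<mu>) \<phi>)) \<and>
    (gdelta {\<phi> :: 'a \<Rightarrow>\<^sub>C real. \<exists>!\<mu>. \<mu> \<in> equilibrium_states T \<phi>} \<and>
     closure {\<phi> :: 'a \<Rightarrow>\<^sub>C real. \<exists>!\<mu>. \<mu> \<in> equilibrium_states T \<phi>} = UNIV) \<and>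
    (\<forall>\<alpha>::real. 0 < \<alpha> \<and> \<alpha> \<le> 1 \<and> specification_property T \<longrightarrow>
       (\<forall>\<phi> :: 'a \<Rightarrow>\<^sub>C real. \<phi> \<in> hoelder_space \<alpha> \<and>
          (\<exists>\<mu>. equilibrium_states T \<phi> = {\<mu>} \<and> exponential_decay_of_correlations T \<alpha> \<mu>) \<longrightarrow>
          frechet_differentiable_wrt (hoelder_space \<alpha>) (hoelder_norm \<alpha>) (real_pressure T) \<phi>))"
proof -
  obtain \<delta> where \<delta>: "\<delta> > 0" "\<forall>e>0. \<exists>N m. surj (T ^^ m) \<and>
    (\<forall>x y. (\<forall>k\<le>N. dist ((T ^^ k) x) ((T ^^ k) y) \<le> \<delta>) \<longrightarrow> dist ((T ^^ m) x) ((T ^^ m) y) \<le> e)"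
    using expansive_window[OF assms] by (elim exE conjE)
  interpret expansive_dynamics T \<delta>
    by (unfold_locales) (use assms \<delta> in simp_all)
  have gat: "gateaux_differentiable (real_pressure T) \<phi> \<longleftrightarrow> (\<exists>\<mu>. equilibrium_states T \<phi> = {\<mu>})"
    for \<phi> :: "'a \<Rightarrow>\<^sub>C real"
    using gateaux_imp_unique unique_equilibrium_gateaux unfolding gateaux_differentiable_def by blast
  have ex1: "(\<exists>!\<mu>. \<mu> \<in> equilibrium_states T \<phi>) \<longleftrightarrow> (\<exists>\<mu>. equilibrium_states T \<phi> = {\<mu>})"
    for \<phi> :: "'a \<Rightarrow>\<^sub>C real"
    by (rule ex1_mem_iff_singleton)
  show ?thesis
  proof (intro conjI allI impI)
    show "\<bar>pressure T \<phi>\<bar> \<noteq> \<infinity>" for \<phi> :: "'a \<Rightarrow>\<^sub>C real" by (simp add: pressure_eq)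
    show "gateaux_differentiable (real_pressure T) \<phi> \<longleftrightarrow> (\<exists>!\<mu>. \<mu> \<in> equilibrium_states T \<phi>)"
      for \<phi> :: "'a \<Rightarrow>\<^sub>C real"
      unfolding gat ex1 ..
    show "\<exists>\<mu>. equilibrium_states T \<phi> = {\<mu>} \<and>
        has_gateaux_derivative (real_pressure T) (\<lambda>\<psi>. \<integral>x. \<psi> x \<partial>\<mu>) \<phi>"
      if "gateaux_differentiable (real_pressure T) \<phi>" for \<phi> :: "'a \<Rightarrow>\<^sub>C real"
      using gateaux_imp_unique[OF that] unique_equilibrium_gateaux by blast
    show "gdelta {\<phi> :: 'a \<Rightarrow>\<^sub>C real. \<exists>!\<mu>. \<mu> \<in> equilibrium_states T \<phi>}"
      "closure {\<phi> :: 'a \<Rightarrow>\<^sub>C real. \<exists>!\<mu>. \<mu> \<in> equilibrium_states T \<phi>} = UNIV"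
      by (rule unique_equilibrium_generic)+
    show "frechet_differentiable_wrt (hoelder_space \<alpha>) (hoelder_norm \<alpha>) (real_pressure T) \<phi>"
      if "0 < \<alpha> \<and> \<alpha> \<le> 1 \<and> specification_property T" and "\<phi> \<in> hoelder_space \<alpha> \<and>
        (\<exists>\<mu>. equilibrium_states T \<phi> = {\<mu>} \<and> exponential_decay_of_correlations T \<alpha> \<mu>)"
      for \<alpha> and \<phi> :: "'a \<Rightarrow>\<^sub>C real"
      using that unique_equilibrium_frechet by blast
  qed
qed

end
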